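(* Consider the sequence of bandwidth sharing networks indexed by $\epsilon\in(0,1)$ described in the context, operated under a weighted proportionally fair policy with weights $\kappa_1,\dots,\kappa_R$, with exponential file size distributions and arrival rate vector $\bm\lambda^{(\epsilon)}=(1-\epsilon)\bm\lambda^{(0)}$, where under $\bm\lambda^{(0)}$ exactly $L_s$ links are critically loaded. Let $\overline{\bm N}^{(\epsilon)}=(\overline N^{(\epsilon)}_r)_r$ be a random vector distributed according to the stationary distribution of the flow count process $(\bm N^{(\epsilon)}(t):t\ge0)$. Then as $\epsilon\to0^+$, $$\frac{L_s\cdot\min_r\kappa_r}{\epsilon}+o\Bigl(\frac1\epsilon\Bigr)\le\mathbb E\Bigl[\sum_r\kappa_r\overline N_r^{(\epsilon)}\Bigr]\le\frac{L_s\cdot\max_r\kappa_r}{\epsilon}+o\Bigl(\frac1\epsilon\Bigr).$$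
   Context: **Network.** Links $\mathcal L=\{1,\dots,L\}$ with capacities $C_\ell>0$; routes $\mathcal R=\{1,\dots,R\}$, each route being a nonempty set of links ($\ell\in r$ means link $\ell$ is on route $r$). The routing matrix $H=(h_{\ell r})$, $h_{\ell r}=1$ if $\ell\in r$ and $0$ otherwise, has full row rank. Each route $r$ has a weight $\kappa_r>0$. **Weighted proportionally fair policy.** A state is $\bm n=(n_r)_{r\in\mathcal R}\in\mathbb Z_+^R$ ($n_r$ = number of flows on route $r$). In state $\bm n$ each flow on route $r$ gets rate $x_r=x_r(\bm n)$, where $(x_r)$ maximizes $\sum_r\kappa_rn_r\log x_r$ subject to $\sum_{r:\ell\in r}n_rx_r\le C_\ell$ for all $\ell$ and $x_r\ge0$, with $x_r=0$ when $n_r=0$. **Flow count process.** Flows arrive on route $r$ as independent Poisson processes of rate $\lambda_r$; file sizes on route $r$ are i.i.d. exponential with rate $\mu_r>0$, independent across routes. With $\bm e^{(r)}$ the standard basis vectors of $\mathbb R^R$, the flow count process is the continuous-time Markov chain on $\mathbb Z_+^R$ with transitions $\bm n\to\bm n+\bm e^{(r)}$ at rate $\lambda_r$ and $\bm n\to\bm n-\bm e^{(r)}$ at rate $n_rx_r\mu_r$. **Heavy traffic.** Fix $\bm\lambda^{(0)}$ with all $\lambda_r^{(0)}>0$ on the boundary of the capacity region: with $\rho_r^{(0)}=\lambda_r^{(0)}/\mu_r$, $\sum_{r:\ell\in r}\rho_r^{(0)}=C_\ell$ for $\ell$ in a nonempty set $\mathcal L_s\subseteq\mathcal L$ of critically loaded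 links and $\sum_{r:\ell\in r}\rho_r^{(0)}<C_\ell$ for $\ell\notin\mathcal L_s$; $L_s=|\mathcal L_s|$. The $\epsilon$-th system has $\bm\lambda^{(\epsilon)}=(1-\epsilon)\bm\lambda^{(0)}$, everything else being independent of $\epsilon$. For $0<\epsilon<1$ the flow count process has a unique stationary distribution. *)

theory Defs
  imports "HOL-Probability.Probability" "HOL-Library.Landau_Symbols"
begin

section \<open>Continuous-time Markov chains on a countable state space\<close>

text \<open>
  A continuous-time Markov chain is represented by its transition function: \<open>P t i\<close> is the law
  at time \<open>t \<ge> 0\<close> of the chain started in state \<open>i\<close>. The number \<open>q i j\<close> is the jump rate from
  \<open>i\<close> to \<open>j\<close>; values of \<open>q\<close> on the diagonal are ignored. The derivatives at \<open>0\<close> are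
  one-sided. If the total jump rates are bounded, as for the flow count process below (where
  capacities bound the departure rates), \<open>q\<close> determines \<open>P t\<close> uniquely for \<open>t \<ge> 0\<close>.
\<close>

definition markov_transition_function ::
  "('s \<Rightarrow> 's \<Rightarrow> real) \<Rightarrow> (real \<Rightarrow> 's \<Rightarrow> 's pmf) \<Rightarrow> bool" where
  "markov_transition_function q P \<longleftrightarrow>
     (\<forall>i. P 0 i = return_pmf i) \<and>
     (\<forall>s\<ge>0. \<forall>t\<ge>0. \<forall>i. P (s + t) i = bind_pmf (P s i) (P t)) \<and>
     (\<forall>i j. i \<noteq> j \<longrightarrow>
        ((\<lambda>t. pmf (P t i) j) has_real_derivative q i j) (at 0 within {0..})) \<and>
     (\<forall>i. ((\<lambda>t. pmf (P t i) i) has_real_derivative - (\<Sum>\<^sub>\<infinity>j\<in>-{i}. q i j)) (at 0 within {0..}))"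

definition stationary_distribution :: "('s \<Rightarrow> 's \<Rightarrow> real) \<Rightarrow> 's pmf \<Rightarrow> bool" where
  "stationary_distribution q \<pi> \<longleftrightarrow>
     (\<exists>P. markov_transition_function q P \<and> (\<forall>t\<ge>0. bind_pmf \<pi> (P t) = \<pi>))"


section \<open>Bandwidth sharing networks\<close>

text \<open>
  Links and routes are the elements of finite types \<open>'l\<close> and \<open>'r\<close>; \<open>route r\<close> is the set of
  links on route \<open>r\<close>. A state \<open>n :: 'r \<Rightarrow> nat\<close> counts the flows on each route.
\<close>

definition routing_matrix :: "('r::finite \<Rightarrow> 'l::finite set) \<Rightarrow> real ^ 'r ^ 'l" where
  "routing_matrix route = (\<chi> l r. if l \<in> route r then 1 else 0)"

definition feasible_rates ::
  "('r::finite \<Rightarrow> 'l set) \<Rightarrow> ('l \<Rightarrow> real) \<Rightarrow> ('r \<Rightarrow> nat) \<Rightarrow> ('r \<Rightarrow> real) \<Rightarrow> bool" where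
  "feasible_rates route C n x \<longleftrightarrow>
     (\<forall>r. x r \<ge> 0) \<and> (\<forall>l. (\<Sum>r | l \<in> route r. real (n r) * x r) \<le> C l)"

text \<open>
  The library has \<open>ln 0 = 0\<close>, whereas the utility needs \<open>log 0 = -\<infinity>\<close>, so the objective is
  extended-real valued. Since \<open>0 * (-\<infinity>) = 0\<close> in \<open>ereal\<close>, routes without flows contribute \<open>0\<close>.
\<close>

definition log_utility :: "real \<Rightarrow> ereal" where
  "log_utility y = (if y > 0 then ereal (ln y) else -\<infinity>)"

definition weighted_log_utility ::
  "('r::finite \<Rightarrow> real) \<Rightarrow> ('r \<Rightarrow> nat) \<Rightarrow> ('r \<Rightarrow> real) \<Rightarrow> ereal" where
  "weighted_log_utility \<kappa> n x = (\<Sum>r\<in>UNIV. ereal (\<kappa> r * real (n r)) * log_utility (x r))"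

text \<open>
  \<open>x n r\<close> is the rate of each single flow on route \<open>r\<close> in state \<open>n\<close>.
\<close>

definition weighted_proportionally_fair ::
  "('r::finite \<Rightarrow> 'l set) \<Rightarrow> ('l \<Rightarrow> real) \<Rightarrow> ('r \<Rightarrow> real) \<Rightarrow> (('r \<Rightarrow> nat) \<Rightarrow> 'r \<Rightarrow> real) \<Rightarrow> bool" where
  "weighted_proportionally_fair route C \<kappa> x \<longleftrightarrow>
     (\<forall>n. is_arg_max (weighted_log_utility \<kappa> n) (feasible_rates route C n) (x n) \<and>
          (\<forall>r. n r = 0 \<longrightarrow> x n r = 0))"

text \<open>
  The second summand is the departure \<open>n \<rightarrow> n - e\<^sub>r\<close>, written as \<open>n = m + e\<^sub>r\<close> to avoid truncated
  subtraction.
\<close>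

definition flow_count_rates ::
  "('r::finite \<Rightarrow> real) \<Rightarrow> ('r \<Rightarrow> real) \<Rightarrow> (('r \<Rightarrow> nat) \<Rightarrow> 'r \<Rightarrow> real)
     \<Rightarrow> ('r \<Rightarrow> nat) \<Rightarrow> ('r \<Rightarrow> nat) \<Rightarrow> real" where
  "flow_count_rates lam \<mu> x n m =
     (\<Sum>r\<in>UNIV. (if m = n(r := n r + 1) then lam r else 0) +
               (if n = m(r := m r + 1) then real (n r) * x n r * \<mu> r else 0))"

end

theory Submission
  imports Defs
begin

text \<open>
  Rescale the state to \<open>z\<^sub>r = sqrt (\<kappa>\<^sub>r / \<lambda>\<^sub>r) n\<^sub>r\<close>. With the prices \<open>p\<close> of the fair allocation (its Lagrange
  multipliers), the drift of \<open>\<bar>z\<bar>\<^sup>2\<close> is at most \<open>- c d\<^sup>2 / (1 + \<bar>z\<bar>) - \<epsilon> c \<bar>z\<bar>\<close> up to a constant, where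
  \<open>d\<close> is the distance of \<open>z\<close> to the point with the same critical prices in the cone of invariant
  states. The test functions \<open>(1 + \<bar>z\<bar>\<^sup>2)\<^sup>2\<close> and \<open>dist(z, cone)\<^sup>4\<close> then give
  \<open>E d\<^sup>3 = o(\<epsilon>\<^sup>-\<^sup>2)\<close>, which is the state space collapse that is needed. Finally let \<open>y\<close> be the orthogonal
  projection of \<open>z\<close> to the span of the critical link vectors. Stationarity of \<open>\<bar>y\<bar>\<^sup>2\<close> expresses
  \<open>\<epsilon> E \<Sum> \<kappa>\<^sub>r n\<^sub>r\<close> as a trace between \<open>L\<^sub>s min \<kappa>\<close> and \<open>L\<^sub>s max \<kappa>\<close>, up to an error
  \<open>E [d (\<epsilon> + unused critical capacity)]\<close>: by complementary slackness a link with unused capacity has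
  price zero, so its coordinate of \<open>y\<close> is \<open>O(d)\<close>. As the mean unused capacity is \<open>O(\<epsilon>)\<close>, truncating \<open>d\<close> at
  \<open>o(1 / \<epsilon>)\<close> shows that the error vanishes.
\<close>

section \<open>Markov chains with bounded jump rates\<close>

text \<open>The obstacle is that the dissipation is only of order \<open>gap^2 / size\<close>. Since
  \<open>size\<close> may be of order 1 / \<epsilon>, the pull towards the cone weakens in heavy
  traffic, and no moment bound for the gap d that is uniform in \<epsilon> comes out. The final
  error allows for this: truncating d at level t costs O(\<epsilon> t) + O(E d^3 / t^2), and t may
  be a power of 1 / \<epsilon> just below the first, so E d^3 = O(1 / \<epsilon>^a) with any a < 2
  is enough. The first test function bounds E[\<open>size\<close> d^2], hence E d^3, by O(1 /
  \<epsilon>^2), exactly the borderline; the second one supplies the missing power. Two distances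
  coexist for a reason. The gap d is tied to the prices, so it is what the dissipation controls and
  what complementary slackness needs, but nothing is known about how the chosen prices vary over a
  jump. The distance to the cone can be expanded over a jump by keeping the closest point fixed.
  \<open>perp_le_gap\<close> and \<open>gap_perp\<close> translate between the two.\<close>

lemma expectation_bind_pmf:
  fixes f :: "'b \<Rightarrow> real"
  assumes "\<And>y. \<bar>f y\<bar> \<le> B"
  shows "measure_pmf.expectation (bind_pmf M N) f =
    measure_pmf.expectation M (\<lambda>x. measure_pmf.expectation (N x) f)"
proof -
  have int: "integrable (measure_pmf p) g" if "\<And>y. \<bar>g y\<bar> \<le> b" for p :: "'c pmf" and g :: "'c \<Rightarrow> real" and b
    using that by (intro measure_pmf.integrable_const_bound[where B = b]) auto
  \<comment> \<open>For nonnegative functions the identity is inherited from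
    \<open>nn_integral\<close> over \<open>bind_pmf\<close>; a bounded \<open>f\<close> is reduced
    to this case below by adding \<open>B\<close>.\<close>
  have nonneg_case: "measure_pmf.expectation (bind_pmf M N) g =
      measure_pmf.expectation M (\<lambda>x. measure_pmf.expectation (N x) g)"
    if g: "\<And>y. 0 \<le> g y" "\<And>y. g y \<le> b" for g :: "'b \<Rightarrow> real" and b
  proof -
    have g': "\<bar>g y\<bar> \<le> b" for y using g[of y] by simp
    have eg: "\<bar>measure_pmf.expectation (N x) g\<bar> \<le> b" for x
    proof -
      have "0 \<le> measure_pmf.expectation (N x) g" using g by (intro Bochner_Integration.integral_nonneg) auto
      moreover have "measure_pmf.expectation (N x) g \<le> b"
        by (rule measure_pmf.integral_le_const) (use int[OF g'] g in auto)
      ultimately show ?thesis by simp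
    qed
    have "ennreal (measure_pmf.expectation (bind_pmf M N) g) = (\<integral>\<^sup>+y. ennreal (g y) \<partial>bind_pmf M N)"
      using g by (intro nn_integral_eq_integral[symmetric] int[OF g']) auto
    also have "\<dots> = (\<integral>\<^sup>+x. \<integral>\<^sup>+y. ennreal (g y) \<partial>N x \<partial>M)" by simp
    also have "\<dots> = (\<integral>\<^sup>+x. ennreal (measure_pmf.expectation (N x) g) \<partial>M)"
      using g by (intro nn_integral_cong nn_integral_eq_integral int[OF g']) auto
    also have "\<dots> = ennreal (measure_pmf.expectation M (\<lambda>x. measure_pmf.expectation (N x) g))"
      using g by (intro nn_integral_eq_integral int[OF eg]) (auto intro!: Bochner_Integration.integral_nonneg)
    finally show ?thesis
      using g by (subst (asm) ennreal_inj) (auto intro!: Bochner_Integration.integral_nonneg)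
  qed
  have i: "integrable (measure_pmf p) f" for p by (rule int[OF assms])
  have shift: "measure_pmf.expectation p (\<lambda>y. f y + B) = measure_pmf.expectation p f + B" for p
    by (simp add: i)
  have "\<bar>measure_pmf.expectation p f\<bar> \<le> B" for p
  proof -
    have "measure_pmf.expectation p f \<le> B" 
      by (rule measure_pmf.integral_le_const) (use i assms in \<open>auto simp: abs_le_iff\<close>)
    moreover have "- B \<le> measure_pmf.expectation p f"
    proof (rule measure_pmf.integral_ge_const)
      show "AE x in measure_pmf p. - B \<le> f x" using assms by (auto simp: abs_le_iff minus_le_iff)
    qed (rule i)
    ultimately show ?thesis by simp
  qed
  then have i2: "integrable (measure_pmf M) (\<lambda>x. measure_pmf.expectation (N x) f)"
    by (intro int) auto
  have "measure_pmf.expectation (bind_pmf M N) (\<lambda>y. f y + B) =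
      measure_pmf.expectation M (\<lambda>x. measure_pmf.expectation (N x) (\<lambda>y. f y + B))"
  proof (rule nonneg_case)
    show "0 \<le> f y + B" "f y + B \<le> 2 * B" for y using assms[of y] by auto
  qed
  then show ?thesis unfolding shift using i2 by simp
qed

text \<open>Summing over the support of \<open>q i\<close> makes this a finite sum under
  \<open>finite_jumps\<close>, so no question of convergence arises.\<close>

definition generator :: "('s \<Rightarrow> 's \<Rightarrow> real) \<Rightarrow> ('s \<Rightarrow> real) \<Rightarrow> 's \<Rightarrow> real" where
  "generator q f i = (\<Sum>j | q i j \<noteq> 0. q i j * (f j - f i))"

locale bounded_rates =
  fixes q :: "'s \<Rightarrow> 's \<Rightarrow> real" and \<Lambda> :: real
  assumes rate_nonneg: "q i j \<ge> 0"
    and no_loop: "q i i = 0"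
    and finite_jumps: "finite {j. q i j \<noteq> 0}"
    and total_rate_le: "(\<Sum>j | q i j \<noteq> 0. q i j) \<le> \<Lambda>"
begin

lemma exit_rate: "(\<Sum>\<^sub>\<infinity>j\<in>-{i}. q i j) = (\<Sum>j | q i j \<noteq> 0. q i j)"
proof -
  have "(\<Sum>\<^sub>\<infinity>j\<in>-{i}. q i j) = (\<Sum>\<^sub>\<infinity>j\<in>{j. q i j \<noteq> 0}. q i j)"
    by (rule infsum_cong_neutral) (auto simp: no_loop)
  then show ?thesis using finite_jumps by simp
qed

text \<open>The one-sided derivatives are restated along sequences because dominated convergence is
  applied to sequences below.\<close>

lemma difference_quotient_tendsto:
  assumes P: "markov_transition_function q P"
    and t: "t \<longlonglongrightarrow> 0" "\<And>k. t k > (0::real)"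
  shows "i \<noteq> j \<Longrightarrow> (\<lambda>k. pmf (P (t k) i) j / t k) \<longlonglongrightarrow> q i j"
    and "(\<lambda>k. (1 - pmf (P (t k) i) i) / t k) \<longlonglongrightarrow> (\<Sum>j | q i j \<noteq> 0. q i j)"
proof -
  have F: "filterlim t (at 0 within {0..}) sequentially"
    using t by (auto simp: filterlim_at less_imp_le less_imp_neq[THEN not_sym] intro!: always_eventually)
  have P0: "P 0 i = return_pmf i"
    using P by (auto simp: markov_transition_function_def)
  show "(\<lambda>k. pmf (P (t k) i) j / t k) \<longlonglongrightarrow> q i j" if "i \<noteq> j"
  proof -
    have "((\<lambda>s. (pmf (P s i) j - pmf (P 0 i) j) / (s - 0)) \<longlongrightarrow> q i j) (at 0 within {0..})"
      using P that by (intro has_field_derivativeD) (auto simp: markov_transition_function_def)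
    from filterlim_compose[OF this F] show ?thesis using that by (simp add: P0)
  qed
  have "((\<lambda>s. (pmf (P s i) i - pmf (P 0 i) i) / (s - 0)) \<longlongrightarrow> - (\<Sum>j | q i j \<noteq> 0. q i j)) (at 0 within {0..})"
    using P by (intro has_field_derivativeD) (auto simp: markov_transition_function_def exit_rate)
  from tendsto_minus[OF filterlim_compose[OF this F]]
  show "(\<lambda>k. (1 - pmf (P (t k) i) i) / t k) \<longlonglongrightarrow> (\<Sum>j | q i j \<noteq> 0. q i j)"
    by (simp add: P0 minus_divide_left)
qed

text \<open>Being in \<open>i\<close> at each of the times \<open>s, 2 * s, ..., n * s\<close> is
  one way of being in \<open>i\<close> at the last one: the Chapman-Kolmogorov sum is reduced to its
  term for the intermediate state \<open>i\<close>.\<close>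

lemma holding_probability_power:
  assumes P: "markov_transition_function q P" and "s \<ge> 0"
  shows "pmf (P (real n * s) i) i \<ge> pmf (P s i) i ^ n"
proof (induction n)
  case 0
  then show ?case using P by (auto simp: markov_transition_function_def)
next
  case (Suc n)
  have "P (s + real n * s) i = bind_pmf (P s i) (P (real n * s))"
    using P assms(2) by (auto simp: markov_transition_function_def)
  then have eq: "pmf (P (s + real n * s) i) i
      = measure_pmf.expectation (P s i) (\<lambda>j. pmf (P (real n * s) j) i)"
    by (simp add: pmf_bind)
  have "pmf (P s i) i ^ Suc n \<le> pmf (P s i) i * pmf (P (real n * s) i) i"
    using Suc by (simp add: mult_left_mono)
  also have "\<dots> = measure_pmf.expectation (P s i) (\<lambda>j. indicat_real {i} j * pmf (P (real n * s) i) i)"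
    by (simp add: measure_pmf_single)
  also have "\<dots> \<le> measure_pmf.expectation (P s i) (\<lambda>j. pmf (P (real n * s) j) i)"
    by (intro integral_mono measure_pmf.integrable_const_bound[where B = 1])
       (auto simp: indicator_def pmf_le_1)
  finally show ?case using eq by (simp add: algebra_simps)
qed

text \<open>The derivative at 0 is information for each state separately, whereas domination needs a
  bound uniform in the state. Splitting \<open>[0, t]\<close> into \<open>k + 1\<close> equal steps
  and applying Bernoulli's inequality to \<open>holding_probability_power\<close> bounds the exit
  probability by \<open>t\<close> times a difference quotient at 0, which tends to the exit
  rate.\<close>

lemma exit_probability_le:
  assumes P: "markov_transition_function q P" and "t \<ge> 0"
  shows "1 - pmf (P t i) i \<le> \<Lambda> * t"
proof (cases "t = 0")
  case True
  then show ?thesis using P by (auto simp: markov_transition_function_def)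
next
  case False
  with assms have t: "t > 0" by simp
  let ?s = "\<lambda>k. t / real (Suc k)"
  have lim0: "?s \<longlonglongrightarrow> 0"
    by (rule lim_const_over_n[THEN LIMSEQ_Suc])
  have lim: "(\<lambda>k. t * ((1 - pmf (P (?s k) i) i) / ?s k)) \<longlonglongrightarrow> t * (\<Sum>j | q i j \<noteq> 0. q i j)"
    by (intro tendsto_mult tendsto_const difference_quotient_tendsto(2)[OF P lim0]) (use t in auto)
  have "1 - pmf (P t i) i \<le> t * ((1 - pmf (P (?s k) i) i) / ?s k)" for k
  proof -
    let ?p = "pmf (P (?s k) i) i"
    have "1 + real (Suc k) * (?p - 1) \<le> (1 + (?p - 1)) ^ Suc k"
      by (rule Bernoulli_inequality) simp
    also have "\<dots> \<le> pmf (P t i) i"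
      using holding_probability_power[OF P, of "?s k" i "Suc k"] t
      by (simp del: of_nat_Suc)
    finally have "1 - pmf (P t i) i \<le> real (Suc k) * (1 - ?p)"
      by (simp add: algebra_simps)
    also have "\<dots> = t * ((1 - ?p) / ?s k)" using t by (simp add: field_simps)
    finally show ?thesis .
  qed
  then have "1 - pmf (P t i) i \<le> t * (\<Sum>j | q i j \<noteq> 0. q i j)"
    by (intro LIMSEQ_le_const[OF lim]) auto
  also have "\<dots> \<le> t * \<Lambda>" using t total_rate_le by (intro mult_left_mono) auto
  finally show ?thesis by (simp add: mult.commute)
qed

text \<open>Off \<open>J\<close> the increment of \<open>f\<close> is at most \<open>2 * B\<close>,
  and the mass there is what \<open>J\<close> leaves. With \<open>J = {i}\<close> this dominates the
  difference quotients of a semigroup; with \<open>J\<close> also containing the jump targets it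
  identifies their limit.\<close>

lemma expectation_increment_bound:
  assumes f: "\<And>j. \<bar>f j\<bar> \<le> (B::real)" and J: "finite J" "i \<in> J"
  shows "\<bar>measure_pmf.expectation p f - f i - (\<Sum>j\<in>J. pmf p j * (f j - f i))\<bar>
     \<le> 2 * B * (1 - (\<Sum>j\<in>J. pmf p j))"
proof -
  have int: "integrable (measure_pmf p) g" if "\<And>y. \<bar>g y\<bar> \<le> b" for g :: "'a \<Rightarrow> real" and b and p :: "'a pmf"
    using that by (intro measure_pmf.integrable_const_bound[where B = b]) auto
  have i1: "integrable (measure_pmf p) f" by (rule int[OF f])
  have B0: "0 \<le> B" using f[of i] by auto
  have fi: "\<bar>f j - f i\<bar> \<le> 2 * B" for j using f[of j] f[of i] by auto
  have i2: "integrable (measure_pmf p) (\<lambda>j. indicat_real J j * (f j - f i))"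
    by (rule int[where b = "2 * B"]) (use fi B0 in \<open>auto simp: indicator_def\<close>)
  have i3: "integrable (measure_pmf p) (\<lambda>j. indicat_real (-J) j * (f j - f i))"
    by (rule int[where b = "2 * B"]) (use fi B0 in \<open>auto simp: indicator_def\<close>)
  have e2: "measure_pmf.expectation p (\<lambda>j. indicat_real J j * (f j - f i)) = (\<Sum>j\<in>J. pmf p j * (f j - f i))"
    by (subst integral_measure_pmf_real[OF J(1)]) (auto simp: indicator_def mult.commute)
  have "measure_pmf.expectation p f - f i = measure_pmf.expectation p (\<lambda>j. f j - f i)"
    using i1 by simp
  also have "(\<lambda>j. f j - f i) = (\<lambda>j. indicat_real J j * (f j - f i) + indicat_real (-J) j * (f j - f i))"
    by (auto simp: indicator_def)
  also have "measure_pmf.expectation p \<dots> = (\<Sum>j\<in>J. pmf p j * (f j - f i)) +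
      measure_pmf.expectation p (\<lambda>j. indicat_real (-J) j * (f j - f i))"
    using i2 i3 e2 by simp
  finally have "\<bar>measure_pmf.expectation p f - f i - (\<Sum>j\<in>J. pmf p j * (f j - f i))\<bar> =
      \<bar>measure_pmf.expectation p (\<lambda>j. indicat_real (-J) j * (f j - f i))\<bar>" by simp
  also have "\<dots> \<le> measure_pmf.expectation p (\<lambda>j. \<bar>indicat_real (-J) j * (f j - f i)\<bar>)"
    by (rule integral_abs_bound)
  also have "\<dots> \<le> measure_pmf.expectation p (\<lambda>j. 2 * B * indicat_real (-J) j)"
    by (intro integral_mono integrable_abs i3 int[where b = "2 * B"])
       (use fi B0 in \<open>auto simp: indicator_def\<close>)
  also have "\<dots> = 2 * B * measure_pmf.prob p (- J)" by simp
  also have "measure_pmf.prob p (- J) = 1 - measure_pmf.prob p J"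
    using measure_pmf.prob_compl[of J p] by (simp add: Compl_eq_Diff_UNIV)
  also have "measure_pmf.prob p J = (\<Sum>j\<in>J. pmf p j)"
    by (rule measure_measure_pmf_finite[OF J(1)])
  finally show ?thesis .
qed

text \<open>By invariance the difference quotients of the semigroup applied to \<open>f\<close> have
  mean zero under \<open>\<pi>\<close>. They converge pointwise to the generator and are bounded by
  \<open>2 * B * \<Lambda>\<close> through \<open>exit_probability_le\<close>, so the limit may be
  taken under the expectation.\<close>

lemma stationary_generator_bounded:
  assumes st: "stationary_distribution q \<pi>" and f: "\<And>j. \<bar>f j\<bar> \<le> B"
  shows "measure_pmf.expectation \<pi> (generator q f) = 0"
proof -
  obtain P where P: "markov_transition_function q P" and inv: "\<And>t. t \<ge> 0 \<Longrightarrow> bind_pmf \<pi> (P t) = \<pi>"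
    using st by (auto simp: stationary_distribution_def)
  have int: "integrable (measure_pmf p) g" if "\<And>y. \<bar>g y\<bar> \<le> b" for g :: "'s \<Rightarrow> real" and b and p
    using that by (intro measure_pmf.integrable_const_bound[where B = b]) auto
  have B0: "0 \<le> B" using f[of undefined] by auto
  let ?t = "\<lambda>k. 1 / real (Suc k)"
  let ?D = "\<lambda>k i. (measure_pmf.expectation (P (?t k) i) f - f i) / ?t k"
  have t0: "?t \<longlonglongrightarrow> 0" by (rule lim_const_over_n[THEN LIMSEQ_Suc])
  have ef: "\<bar>measure_pmf.expectation p f\<bar> \<le> B" for p
  proof -
    have "\<bar>measure_pmf.expectation p f\<bar> \<le> measure_pmf.expectation p (\<lambda>x. \<bar>f x\<bar>)"
      by (rule integral_abs_bound)
    also have "\<dots> \<le> B"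
      by (rule measure_pmf.integral_le_const) (use int[OF f] f in auto)
    finally show ?thesis .
  qed
  have zero: "measure_pmf.expectation \<pi> (?D k) = 0" for k
  proof -
    have "measure_pmf.expectation \<pi> f = measure_pmf.expectation \<pi> (\<lambda>x. measure_pmf.expectation (P (?t k) x) f)"
      using expectation_bind_pmf[OF f, of \<pi> "P (?t k)"] inv[of "?t k"] by simp
    then show ?thesis
      using int[OF f] int[of "\<lambda>i. measure_pmf.expectation (P (?t k) i) f" B]
      by (simp add: ef del: of_nat_Suc)
  qed
  have lim: "(\<lambda>k. ?D k i) \<longlonglongrightarrow> generator q f i" for i
  proof -
    let ?J = "{j. q i j \<noteq> 0}"
    have iJ: "i \<notin> ?J" by (simp add: no_loop)
    let ?S = "\<lambda>k. \<Sum>j\<in>?J. pmf (P (?t k) i) j / ?t k * (f j - f i)"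
    \<comment> \<open>The rate of leaving \<open>i\<close> other than by a direct jump. It vanishes
      in the limit because the exit rate is exactly the sum of the jump rates.\<close>
    let ?R = "\<lambda>k. 2 * B * ((1 - pmf (P (?t k) i) i) / ?t k - (\<Sum>j\<in>?J. pmf (P (?t k) i) j / ?t k))"
    have l: "(\<lambda>k. pmf (P (?t k) i) j / ?t k) \<longlonglongrightarrow> q i j" if "j \<in> ?J" for j
      by (rule difference_quotient_tendsto(1)[OF P t0]) (use that iJ in auto)
    have S: "?S \<longlonglongrightarrow> generator q f i"
      unfolding generator_def by (intro tendsto_sum tendsto_mult l tendsto_const)
    have "?R \<longlonglongrightarrow> 2 * B * ((\<Sum>j | q i j \<noteq> 0. q i j) - (\<Sum>j | q i j \<noteq> 0. q i j))"
      by (intro tendsto_mult tendsto_diff tendsto_const tendsto_sum l difference_quotient_tendsto(2)[OF P t0]) auto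
    then have R: "?R \<longlonglongrightarrow> 0" by simp
    have "\<bar>?D k i - ?S k\<bar> \<le> ?R k" for k
    proof -
      let ?p = "P (?t k) i"
      have "\<bar>measure_pmf.expectation ?p f - f i - (\<Sum>j\<in>insert i ?J. pmf ?p j * (f j - f i))\<bar>
         \<le> 2 * B * (1 - (\<Sum>j\<in>insert i ?J. pmf ?p j))"
        by (rule expectation_increment_bound[OF f]) (use finite_jumps in auto)
      then have *: "\<bar>measure_pmf.expectation ?p f - f i - (\<Sum>j\<in>?J. pmf ?p j * (f j - f i))\<bar>
         \<le> 2 * B * (1 - pmf ?p i - (\<Sum>j\<in>?J. pmf ?p j))"
        using finite_jumps iJ by (simp add: algebra_simps)
      have e1: "?D k i - ?S k = (measure_pmf.expectation ?p f - f i - (\<Sum>j\<in>?J. pmf ?p j * (f j - f i))) / ?t k"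
        unfolding diff_divide_distrib sum_divide_distrib by (simp add: field_simps)
      have e2: "?R k = 2 * B * (1 - pmf ?p i - (\<Sum>j\<in>?J. pmf ?p j)) / ?t k"
        unfolding sum_divide_distrib[symmetric] by (simp add: field_simps)
      have e3: "\<bar>y / ?t k\<bar> = \<bar>y\<bar> / ?t k" for y by (simp add: abs_mult del: of_nat_Suc)
      show ?thesis
        unfolding e1 e2 e3 by (rule divide_right_mono[OF *]) simp
    qed
    then have "(\<lambda>k. ?D k i - ?S k) \<longlonglongrightarrow> 0"
      by (intro Lim_null_comparison[OF _ R]) auto
    from tendsto_add[OF this S] show ?thesis by simp
  qed
  have bound: "\<bar>?D k i\<bar> \<le> 2 * B * \<Lambda>" for k i
  proof -
    have "\<bar>measure_pmf.expectation (P (?t k) i) f - f i\<bar> \<le> 2 * B * (1 - pmf (P (?t k) i) i)"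
      using expectation_increment_bound[OF f, of "{i}" i "P (?t k) i"] by simp
    also have "\<dots> \<le> 2 * B * (\<Lambda> * ?t k)"
      using B0 exit_probability_le[OF P, of "?t k" i] by (intro mult_left_mono) auto
    finally have "\<bar>measure_pmf.expectation (P (?t k) i) f - f i\<bar> / ?t k \<le> 2 * B * \<Lambda>"
      by (subst pos_divide_le_eq) (simp_all add: mult_ac del: of_nat_Suc)
    then show ?thesis by (simp add: abs_mult del: of_nat_Suc)
  qed
  have "(\<lambda>k. measure_pmf.expectation \<pi> (?D k)) \<longlonglongrightarrow> measure_pmf.expectation \<pi> (generator q f)"
    by (rule integral_dominated_convergence[where w = "\<lambda>_. 2 * B * \<Lambda>"]) (use lim bound in auto)
  then show ?thesis using zero LIMSEQ_unique[OF tendsto_const] by fastforce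
qed


text \<open>
  Truncating \<open>f\<close> from above only decreases the drift where \<open>f\<close> is below the threshold and makes it
  nonpositive elsewhere, so no integrability of \<open>f\<close> is needed.
\<close>

lemma integrable_drift_bound:
  assumes st: "stationary_distribution q \<pi>"
    and f: "\<And>i. 0 \<le> f i" and g: "\<And>i. 0 \<le> g i" and h: "\<And>i. 0 \<le> h i"
    and int_h: "integrable (measure_pmf \<pi>) h"
    and drift: "\<And>i. generator q f i \<le> h i - g i"
  shows "integrable (measure_pmf \<pi>) g"
    and "measure_pmf.expectation \<pi> g \<le> measure_pmf.expectation \<pi> h"
proof -
  have int: "integrable (measure_pmf p) g" if "\<And>y. \<bar>g y\<bar> \<le> b" for g :: "'s \<Rightarrow> real" and b and p
    using that by (intro measure_pmf.integrable_const_bound[where B = b]) auto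
  let ?f = "\<lambda>k i. min (f i) (real k)"
  let ?g = "\<lambda>k i. if f i < real k then g i else 0"
  have fk: "\<bar>?f k i\<bar> \<le> real k" for k i using f[of i] by auto
  have gen_bound: "\<bar>generator q (?f k) i\<bar> \<le> real k * \<Lambda>" for k i
  proof -
    have "\<bar>generator q (?f k) i\<bar> \<le> (\<Sum>j | q i j \<noteq> 0. \<bar>q i j * (?f k j - ?f k i)\<bar>)"
      unfolding generator_def by (rule sum_abs)
    also have "\<dots> \<le> (\<Sum>j | q i j \<noteq> 0. q i j * real k)"
    proof (rule sum_mono)
      fix j
      have "\<bar>?f k j - ?f k i\<bar> \<le> real k" using f[of i] f[of j] by auto
      then show "\<bar>q i j * (?f k j - ?f k i)\<bar> \<le> q i j * real k"
        using rate_nonneg[of i j] by (simp add: abs_mult mult_left_mono)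
    qed
    also have "\<dots> = real k * (\<Sum>j | q i j \<noteq> 0. q i j)" by (simp add: sum_distrib_left mult.commute)
    also have "\<dots> \<le> real k * \<Lambda>" by (intro mult_left_mono total_rate_le) auto
    finally show ?thesis .
  qed
  have le: "?g k i \<le> h i - generator q (?f k) i" for k i
  proof (cases "f i < real k")
    case True
    have "generator q (?f k) i \<le> generator q f i"
      unfolding generator_def using True
      by (intro sum_mono mult_left_mono rate_nonneg) auto
    with drift[of i] True show ?thesis by simp
  next
    case False
    have "generator q (?f k) i \<le> 0"
      unfolding generator_def using False
      by (intro sum_nonpos mult_nonneg_nonpos rate_nonneg) auto
    with False h[of i] show ?thesis by simp
  qed
  have int_gen: "integrable (measure_pmf \<pi>) (generator q (?f k))" for k
    by (rule int[OF gen_bound])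
  have int_gk: "integrable (measure_pmf \<pi>) (?g k)" for k
  proof (rule Bochner_Integration.integrable_bound)
    show "integrable (measure_pmf \<pi>) (\<lambda>i. h i - generator q (?f k) i)"
      using int_h int_gen by simp
    show "AE i in \<pi>. norm (?g k i) \<le> norm (h i - generator q (?f k) i)"
      using le[of _ k] g by (intro AE_I2) (smt (verit) real_norm_def)
  qed simp
  have bound: "measure_pmf.expectation \<pi> (?g k) \<le> measure_pmf.expectation \<pi> h" for k
  proof -
    have "measure_pmf.expectation \<pi> (?g k) \<le> measure_pmf.expectation \<pi> (\<lambda>i. h i - generator q (?f k) i)"
      using int_gk int_h int_gen le by (intro integral_mono) auto
    also have "\<dots> = measure_pmf.expectation \<pi> h"
      using int_h int_gen stationary_generator_bounded[OF st fk] by simp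
    finally show ?thesis .
  qed
  have "(\<integral>\<^sup>+i. ennreal (g i) \<partial>\<pi>) = (\<integral>\<^sup>+i. (SUP k. ennreal (?g k i)) \<partial>\<pi>)"
  proof (intro nn_integral_cong antisym)
    fix i
    obtain k where "f i < real k" using reals_Archimedean2 by blast
    then show "ennreal (g i) \<le> (SUP k. ennreal (?g k i))"
      by (intro SUP_upper2[of k]) auto
    show "(SUP k. ennreal (?g k i)) \<le> ennreal (g i)"
      using g by (intro SUP_least) (auto intro: ennreal_leI)
  qed
  also have "\<dots> = (SUP k. (\<integral>\<^sup>+i. ennreal (?g k i) \<partial>\<pi>))"
    using g by (intro nn_integral_monotone_convergence_SUP) (auto simp: incseq_def le_fun_def)
  also have "\<dots> \<le> ennreal (measure_pmf.expectation \<pi> h)"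
  proof (intro SUP_least)
    fix k
    have "(\<integral>\<^sup>+i. ennreal (?g k i) \<partial>\<pi>) = ennreal (measure_pmf.expectation \<pi> (?g k))"
      using g by (intro nn_integral_eq_integral int_gk) auto
    then show "(\<integral>\<^sup>+i. ennreal (?g k i) \<partial>\<pi>) \<le> ennreal (measure_pmf.expectation \<pi> h)"
      using bound by (simp add: ennreal_leI)
  qed
  finally have nn: "(\<integral>\<^sup>+i. ennreal (g i) \<partial>\<pi>) \<le> ennreal (measure_pmf.expectation \<pi> h)" .
  then show "integrable (measure_pmf \<pi>) g"
    using g by (intro integrableI_nonneg) (auto simp: less_top[symmetric] top_unique)
  then show "measure_pmf.expectation \<pi> g \<le> measure_pmf.expectation \<pi> h"
    using nn g h by (subst (asm) nn_integral_eq_integral)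
      (auto simp: ennreal_le_iff Bochner_Integration.integral_nonneg)
qed

text \<open>Two-sided truncation never enlarges an increment, so \<open>G\<close> dominates the
  generators of all truncations at once. The absolute increments have to be bounded, not the net
  drift, since cancellation between jumps need not survive truncation.\<close>

lemma stationary_generator_zero:
  assumes st: "stationary_distribution q \<pi>"
    and int_G: "integrable (measure_pmf \<pi>) G"
    and G: "\<And>i. (\<Sum>j | q i j \<noteq> 0. q i j * \<bar>f j - f i\<bar>) \<le> G i"
  shows "measure_pmf.expectation \<pi> (generator q f) = 0"
proof -
  let ?f = "\<lambda>k i. max (- real k) (min (f i) (real k))"
  have zero: "measure_pmf.expectation \<pi> (generator q (?f k)) = 0" for k
    by (rule stationary_generator_bounded[OF st, where B = "real k"]) auto
  have lim_f: "(\<lambda>k. ?f k i) \<longlonglongrightarrow> f i" for i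
  proof -
    obtain n where n: "\<bar>f i\<bar> < real n" using reals_Archimedean2 by blast
    have "\<forall>\<^sub>F k in sequentially. ?f k i = f i"
      using eventually_ge_at_top[of n]
    proof eventually_elim
      case (elim k)
      then have "\<bar>f i\<bar> < real k" using n by linarith
      then show ?case by auto
    qed
    then show ?thesis by (rule tendsto_eventually)
  qed
  have "(\<lambda>k. measure_pmf.expectation \<pi> (generator q (?f k))) \<longlonglongrightarrow> measure_pmf.expectation \<pi> (generator q f)"
  proof (rule integral_dominated_convergence[where w = G])
    show "AE i in \<pi>. (\<lambda>k. generator q (?f k) i) \<longlonglongrightarrow> generator q f i"
      unfolding generator_def by (intro AE_I2 tendsto_sum tendsto_mult tendsto_diff tendsto_const lim_f)
    show "AE i in \<pi>. norm (generator q (?f k) i) \<le> G i" for k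
    proof (rule AE_I2)
      fix i
      have "\<bar>generator q (?f k) i\<bar> \<le> (\<Sum>j | q i j \<noteq> 0. \<bar>q i j * (?f k j - ?f k i)\<bar>)"
        unfolding generator_def by (rule sum_abs)
      also have "\<dots> \<le> (\<Sum>j | q i j \<noteq> 0. q i j * \<bar>f j - f i\<bar>)"
        using rate_nonneg by (intro sum_mono) (auto simp: abs_mult intro!: mult_left_mono)
      also note G[of i]
      finally show "norm (generator q (?f k) i) \<le> G i" by simp
    qed
  qed (use int_G in auto)
  then show ?thesis using zero LIMSEQ_unique[OF tendsto_const] by fastforce
qed

end

section \<open>Prices of a proportionally fair allocation\<close>

lemma convex_cone_hull_image_eq:
  fixes h :: "'i \<Rightarrow> 'a::euclidean_space"
  assumes "finite I"
  shows "convex_cone hull (h ` I) = {v. \<exists>q. (\<forall>i. 0 \<le> q i) \<and> v = (\<Sum>i\<in>I. q i *\<^sub>R h i)}" (is "_ = ?S")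
proof (rule hull_unique)
  show "h ` I \<subseteq> ?S"
  proof (intro image_subsetI CollectI exI conjI)
    fix i assume "i \<in> I"
    then show "h i = (\<Sum>j\<in>I. (if j = i then 1 else 0) *\<^sub>R h j)"
      using assms by (simp add: if_distrib[of "\<lambda>c. c *\<^sub>R _"] cong: if_cong)
  qed auto
  have zero: "0 \<in> ?S" by (intro CollectI exI[of _ "\<lambda>_. 0"]) auto
  have add: "x + y \<in> ?S" if xy: "x \<in> ?S" "y \<in> ?S" for x y
  proof -
    from xy obtain q q' where "\<forall>i. 0 \<le> q i" "x = (\<Sum>i\<in>I. q i *\<^sub>R h i)"
      "\<forall>i. 0 \<le> q' i" "y = (\<Sum>i\<in>I. q' i *\<^sub>R h i)" by auto
    then show ?thesis
      by (intro CollectI exI[of _ "\<lambda>i. q i + q' i"]) (auto simp: scaleR_left_distrib sum.distrib)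
  qed
  have scale: "c *\<^sub>R x \<in> ?S" if x: "x \<in> ?S" and c: "0 \<le> c" for x c
  proof -
    from x obtain q where "\<forall>i. 0 \<le> q i" "x = (\<Sum>i\<in>I. q i *\<^sub>R h i)" by auto
    with c show ?thesis
      by (intro CollectI exI[of _ "\<lambda>i. c * q i"] conjI) (simp_all add: scaleR_sum_right)
  qed
  show "convex_cone ?S"
    unfolding convex_cone_iff using zero add scale by blast
  show "?S \<subseteq> T" if T: "h ` I \<subseteq> T" "convex_cone T" for T
  proof
    fix v assume "v \<in> ?S"
    then obtain q where q: "\<forall>i. 0 \<le> q i" "v = (\<Sum>i\<in>I. q i *\<^sub>R h i)" by auto
    have "(\<Sum>i\<in>J. q i *\<^sub>R h i) \<in> T" if "finite J" "J \<subseteq> I" for J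
      using that
    proof (induction J)
      case empty
      then show ?case using T convex_cone_contains_0 by auto
    next
      case (insert i J)
      then show ?case using T q by (auto intro!: convex_cone_add convex_cone_scaleR)
    qed
    with q assms show "v \<in> T" by simp
  qed
qed

text \<open>A finitely generated cone is closed, so a vector outside it can be strictly separated;
  homogeneity of the cone then makes the separating functional nonnegative on every
  generator.\<close>

lemma Farkas:
  fixes h :: "'i \<Rightarrow> 'a::euclidean_space"
  assumes I: "finite I"
    and c: "\<And>v. (\<And>i. i \<in> I \<Longrightarrow> h i \<bullet> v \<le> 0) \<Longrightarrow> c \<bullet> v \<le> 0"
  obtains q where "\<And>i. 0 \<le> q i" "c = (\<Sum>i\<in>I. q i *\<^sub>R h i)"
proof -
  let ?K = "convex_cone hull (h ` I)"
  have "c \<in> ?K"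
  proof (rule ccontr)
    assume "c \<notin> ?K"
    moreover have "closed ?K" using I by (intro closed_convex_cone_hull) auto
    ultimately obtain a b where a: "a \<bullet> c < b" and b: "\<And>x. x \<in> ?K \<Longrightarrow> a \<bullet> x > b"
      using separating_hyperplane_closed_point[OF convex_convex_cone_hull] by blast
    have b0: "b < 0" using b[OF convex_cone_hull_contains_0] by simp
    have "a \<bullet> h i \<ge> 0" if i: "i \<in> I" for i
    proof (rule ccontr)
      assume neg: "\<not> a \<bullet> h i \<ge> 0"
      \<comment> \<open>This multiple of the generator is chosen to have inner product exactly
        \<open>b\<close> with \<open>a\<close>, against the strict inequality
        \<open>b\<close>.\<close>
      then have "(b / (a \<bullet> h i)) *\<^sub>R h i \<in> ?K"
        using b0 i by (intro convex_cone_hull_mul) (auto intro: hull_inc simp: divide_nonpos_neg)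
      from b[OF this] neg show False by simp
    qed
    then have "c \<bullet> (- a) \<le> 0"
      by (intro c) (auto simp: inner_commute)
    with a b0 show False by (simp add: inner_commute)
  qed
  then show ?thesis using that unfolding convex_cone_hull_image_eq[OF I] by auto
qed

definition route_flow :: "(('r \<Rightarrow> nat) \<Rightarrow> 'r \<Rightarrow> real) \<Rightarrow> ('r \<Rightarrow> nat) \<Rightarrow> 'r \<Rightarrow> real" where
  "route_flow x n r = real (n r) * x n r"

lemma proportionally_fair_feasible:
  assumes "weighted_proportionally_fair route C \<kappa> x"
  shows "0 \<le> x n r" "(\<Sum>r | l \<in> route r. route_flow x n r) \<le> C l"
  using assms by (auto simp: weighted_proportionally_fair_def is_arg_max_def feasible_rates_def route_flow_def)

lemma weighted_log_utility_finite:
  assumes "\<And>r. n r > 0 \<Longrightarrow> y r > 0"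
  shows "weighted_log_utility \<kappa> n y = ereal (\<Sum>r\<in>UNIV. \<kappa> r * real (n r) * ln (y r))"
proof -
  have "ereal (\<kappa> r * real (n r)) * log_utility (y r) = ereal (\<kappa> r * real (n r) * ln (y r))" for r
    using assms[of r] by (cases "n r = 0") (auto simp: log_utility_def)
  then show ?thesis by (simp add: weighted_log_utility_def)
qed


text \<open>Giving every flow the same small rate is feasible and has finite utility, while rate
  zero on an occupied route has utility minus infinity and so cannot be optimal.\<close>

lemma proportionally_fair_pos:
  fixes route :: "'r::finite \<Rightarrow> 'l::finite set"
  assumes C: "\<And>l. C l > 0" and \<kappa>: "\<And>r. \<kappa> r > 0"
    and fair: "weighted_proportionally_fair route C \<kappa> x" and nr: "n r > 0"
  shows "x n r > 0"
proof (rule ccontr)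
  assume neg: "\<not> x n r > 0"
  \<comment> \<open>The denominator dominates the number of flows on any link, so the common rate
    \<open>M\<close> respects even the smallest capacity; the summand 1 keeps the denominator
    positive.\<close>
  define M where "M = Min (range C) / (1 + (\<Sum>r\<in>UNIV. real (n r)))"
  have S: "1 + (\<Sum>r\<in>UNIV. real (n r)) > 0" by (smt (verit) of_nat_0_le_iff sum_nonneg)
  have M: "M > 0" unfolding M_def using C S by (intro divide_pos_pos) auto
  have feas: "feasible_rates route C n (\<lambda>_. M)"
    unfolding feasible_rates_def
  proof (intro conjI allI)
    fix l
    have "(\<Sum>r | l \<in> route r. real (n r) * M) \<le> (\<Sum>r\<in>UNIV. real (n r) * M)"
      using M by (intro sum_mono2) auto
    also have "\<dots> \<le> (1 + (\<Sum>r\<in>UNIV. real (n r))) * M"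
      using M by (simp add: sum_distrib_right distrib_right)
    also have "\<dots> = Min (range C)" using S by (simp add: M_def)
    also have "\<dots> \<le> C l" by simp
    finally show "(\<Sum>r | l \<in> route r. real (n r) * M) \<le> C l" .
  qed (use M in auto)
  have "weighted_log_utility \<kappa> n (\<lambda>_. M) = ereal (\<Sum>r\<in>UNIV. \<kappa> r * real (n r) * ln M)"
    using M by (intro weighted_log_utility_finite)
  moreover have "weighted_log_utility \<kappa> n (x n) = -\<infinity>"
  proof -
    \<comment> \<open>One infinite negative summand decides the sum only if no summand is
      \<open>\<infinity>\<close>, which would absorb it in \<open>ereal\<close>.\<close>
    have "log_utility (x n r') < \<infinity>" for r' by (simp add: log_utility_def)
    then have t: "ereal (\<kappa> r' * real (n r')) * log_utility (x n r') \<noteq> \<infinity>" for r'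
    proof -
      have "0 \<le> \<kappa> r' * real (n r')" using \<kappa>[of r'] by simp
      then show ?thesis by (auto simp: log_utility_def dest: leD)
    qed
    have "ereal (\<kappa> r * real (n r)) * log_utility (x n r) = -\<infinity>"
      using neg nr \<kappa>[of r] by (simp add: log_utility_def)
    then show ?thesis
      unfolding weighted_log_utility_def using t
      by (subst sum.remove[of _ r]) (auto simp: sum_Pinfty)
  qed
  ultimately show False
    using fair feas by (auto simp: weighted_proportionally_fair_def is_arg_max_def dest!: spec[of _ n])
qed

text \<open>The sum is the derivative of the utility when the route flows move in direction
  \<open>v\<close>. Short moves are feasible: occupied routes keep positive flow, tight links do not
  gain load, and the other links have room. A positive derivative would therefore contradict
  optimality.\<close>

lemma proportionally_fair_first_order:
  fixes route :: "'r::finite \<Rightarrow> 'l::finite set"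
  assumes C: "\<And>l. C l > 0" and \<kappa>: "\<And>r. \<kappa> r > 0"
    and fair: "weighted_proportionally_fair route C \<kappa> x"
    and v0: "\<And>r. n r = 0 \<Longrightarrow> v r = 0"
    and v: "\<And>l. (\<Sum>r | l \<in> route r. route_flow x n r) = C l \<Longrightarrow> (\<Sum>r | l \<in> route r. v r) \<le> 0"
  shows "(\<Sum>r\<in>UNIV. \<kappa> r * real (n r) * v r / route_flow x n r) \<le> 0"
proof (rule ccontr)
  let ?\<phi> = "route_flow x n"
  assume neg: "\<not> ?thesis"
  have xpos: "x n r > 0" if "n r > 0" for r
    using proportionally_fair_pos[of C \<kappa> route x n r] C \<kappa> fair that by blast
  have \<phi>pos: "?\<phi> r > 0" if "n r > 0" for r using xpos[OF that] that by (simp add: route_flow_def)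
  \<comment> \<open>The perturbation is linear in the aggregate flows; dividing by
    \<open>n r\<close> returns to rates per flow.\<close>
  let ?y = "\<lambda>t r. if n r = 0 then 0 else (?\<phi> r + t * v r) / real (n r)"
  let ?G = "\<lambda>t. \<Sum>r\<in>UNIV. \<kappa> r * real (n r) * ln (?y t r)"
  have y0: "?y 0 = x n"
    using fair by (auto simp: fun_eq_iff route_flow_def weighted_proportionally_fair_def)
  have "\<forall>\<^sub>F t in at_right 0. ?\<phi> r + t * v r > 0" if "n r > 0" for r
  proof -
    have "((\<lambda>t. ?\<phi> r + t * v r) \<longlongrightarrow> ?\<phi> r + 0 * v r) (at_right 0)" by (intro tendsto_intros)
    then show ?thesis using \<phi>pos[OF that] by (simp add: order_tendstoD(1))
  qed
  then have ev1: "\<forall>\<^sub>F t in at_right 0. \<forall>r. n r > 0 \<longrightarrow> ?\<phi> r + t * v r > 0"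
    by (intro eventually_all_finite) auto
  have "\<forall>\<^sub>F t in at_right 0. (\<Sum>r | l \<in> route r. ?\<phi> r + t * v r) \<le> C l" for l
  proof (cases "(\<Sum>r | l \<in> route r. ?\<phi> r) = C l")
    case True
    show ?thesis
      using eventually_at_right_less[of "0::real"]
    proof eventually_elim
      case (elim t)
      then have "t * (\<Sum>r | l \<in> route r. v r) \<le> 0"
        using v[OF True] by (intro mult_nonneg_nonpos) auto
      then show ?case using True by (simp add: sum.distrib sum_distrib_left)
    qed
  next
    case False
    then have "(\<Sum>r | l \<in> route r. ?\<phi> r) < C l"
      using proportionally_fair_feasible(2)[OF fair, where l = l and n = n] by simp
    moreover have "((\<lambda>t. \<Sum>r | l \<in> route r. ?\<phi> r + t * v r) \<longlongrightarrow> (\<Sum>r | l \<in> route r. ?\<phi> r + 0 * v r)) (at_right 0)"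
      by (intro tendsto_intros)
    ultimately have "\<forall>\<^sub>F t in at_right 0. (\<Sum>r | l \<in> route r. ?\<phi> r + t * v r) < C l"
      by (intro order_tendstoD(2)) auto
    then show ?thesis by (rule eventually_mono) simp
  qed
  then have ev2: "\<forall>\<^sub>F t in at_right 0. \<forall>l. (\<Sum>r | l \<in> route r. ?\<phi> r + t * v r) \<le> C l"
    by (intro eventually_all_finite)
  have "(?G has_real_derivative (\<Sum>r\<in>UNIV. \<kappa> r * real (n r) * v r / ?\<phi> r)) (at 0)"
  proof (rule DERIV_sum)
    fix r
    show "((\<lambda>t. \<kappa> r * real (n r) * ln (?y t r)) has_real_derivative \<kappa> r * real (n r) * v r / ?\<phi> r) (at 0)"
    proof (cases "n r = 0")
      case False
      then have "?\<phi> r > 0" "real (n r) > 0" using \<phi>pos[of r] by auto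
      with False show ?thesis by (auto intro!: derivative_eq_intros simp: field_simps)
    qed simp
  qed
  from DERIV_pos_inc_right[OF this] neg obtain d where d: "d > 0" and
    inc: "\<And>t. 0 < t \<Longrightarrow> t < d \<Longrightarrow> ?G 0 < ?G (0 + t)" by (auto simp: not_le)
  have "\<forall>\<^sub>F t in at_right 0. t \<in> {0<..<d}" using d by (rule eventually_at_right_real)
  with ev1 ev2 have "\<forall>\<^sub>F t in at_right (0::real). False"
  proof eventually_elim
    case (elim t)
    have ypos: "?y t r > 0" if "n r > 0" for r using elim that by auto
    have "feasible_rates route C n (?y t)"
      unfolding feasible_rates_def
    proof (intro conjI allI)
      fix l
      have "(\<Sum>r | l \<in> route r. real (n r) * ?y t r) = (\<Sum>r | l \<in> route r. ?\<phi> r + t * v r)"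
        by (intro sum.cong) (auto simp: v0 route_flow_def)
      then show "(\<Sum>r | l \<in> route r. real (n r) * ?y t r) \<le> C l" using elim by simp
    qed (use ypos less_imp_le in auto)
    moreover have "weighted_log_utility \<kappa> n (?y t) = ereal (?G t)"
      by (rule weighted_log_utility_finite) (rule ypos)
    moreover have "weighted_log_utility \<kappa> n (x n) = ereal (?G 0)"
      unfolding y0[symmetric] by (rule weighted_log_utility_finite) (use \<phi>pos in simp)
    moreover have "?G 0 < ?G t" using inc[of t, unfolded add_0] elim greaterThanLessThan_iff by blast
    ultimately show ?case
      using fair by (auto simp: weighted_proportionally_fair_def is_arg_max_def dest!: spec[of _ n])
  qed
  then show False by (simp add: trivial_limit_at_right_real)
qed

text \<open>These are the Karush-Kuhn-Tucker conditions.
  \<open>proportionally_fair_first_order\<close> says that the gradient of the utility satisfies the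
  hypothesis of \<open>Farkas\<close> with respect to the tight links, so it is a nonnegative
  combination of them; links that are not tight get price 0, which is complementary
  slackness.\<close>

lemma proportionally_fair_prices:
  fixes route :: "'r::finite \<Rightarrow> 'l::finite set"
  assumes C: "\<And>l. C l > 0" and \<kappa>: "\<And>r. \<kappa> r > 0"
    and fair: "weighted_proportionally_fair route C \<kappa> x"
  obtains p :: "'l \<Rightarrow> real" where "\<And>l. 0 \<le> p l"
    "\<And>r. \<kappa> r * real (n r) = route_flow x n r * (\<Sum>l\<in>route r. p l)"
    "\<And>l. p l * (C l - (\<Sum>r | l \<in> route r. route_flow x n r)) = 0"
proof -
  let ?\<phi> = "route_flow x n"
  let ?T = "{l. (\<Sum>r | l \<in> route r. ?\<phi> r) = C l}"
  \<comment> \<open>Empty routes are masked out: their flow is fixed at 0, so only directions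
    vanishing there are admissible. The price equation holds for them as
    \<open>0 = 0\<close>.\<close>
  let ?h = "\<lambda>l. (\<chi> r. if l \<in> route r \<and> n r > 0 then 1 else 0) :: real ^ 'r"
  let ?c = "(\<chi> r. \<kappa> r * real (n r) / ?\<phi> r) :: real ^ 'r"
  obtain p where p: "\<And>l. 0 \<le> p l" "?c = (\<Sum>l\<in>?T. p l *\<^sub>R ?h l)"
  proof (rule Farkas[of ?T ?h ?c])
    fix v :: "real ^ 'r"
    assume v: "\<And>l. l \<in> ?T \<Longrightarrow> ?h l \<bullet> v \<le> 0"
    let ?v = "\<lambda>r. if n r = 0 then 0 else v $ r"
    have "(\<Sum>r | l \<in> route r. ?v r) = ?h l \<bullet> v" for l
      unfolding inner_vec_def
      by (simp add: sum.If_cases if_distrib[of "\<lambda>a. a * _"] sum.inter_filter[symmetric] cong: if_cong)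
        (intro sum.mono_neutral_cong_right, auto)
    then have "(\<Sum>r\<in>UNIV. \<kappa> r * real (n r) * ?v r / ?\<phi> r) \<le> 0"
      by (intro proportionally_fair_first_order[OF C \<kappa> fair]) (use v in auto)
    also have "(\<Sum>r\<in>UNIV. \<kappa> r * real (n r) * ?v r / ?\<phi> r) = ?c \<bullet> v"
      unfolding inner_vec_def by (intro sum.cong) auto
    finally show "?c \<bullet> v \<le> 0" .
  qed auto
  let ?p = "\<lambda>l. if l \<in> ?T then p l else 0"
  show ?thesis
  proof (rule that[of ?p])
    show "\<kappa> r * real (n r) = ?\<phi> r * (\<Sum>l\<in>route r. ?p l)" for r
    proof (cases "n r = 0")
      case False
      then have \<phi>: "?\<phi> r > 0"
        using proportionally_fair_pos[of C \<kappa> route x n r] C \<kappa> fair by (simp add: route_flow_def)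
      have "\<kappa> r * real (n r) / ?\<phi> r = ?c $ r" by simp
      also have "\<dots> = (\<Sum>l\<in>?T. p l * (if l \<in> route r then 1 else 0))"
        using False unfolding p(2) by simp
      also have "\<dots> = (\<Sum>l\<in>route r. ?p l)"
        by (simp add: if_distrib sum.If_cases Int_commute cong: if_cong)
      finally show ?thesis using \<phi> by (simp add: field_simps)
    qed (simp add: route_flow_def)
  qed (use p in auto)
qed

section \<open>The drift in a critically loaded network\<close>

locale critical_network =
  fixes route :: "'r::finite \<Rightarrow> 'l::finite set"
    and C :: "'l \<Rightarrow> real"
    and \<kappa> \<mu> lam0 :: "'r \<Rightarrow> real"
    and x :: "('r \<Rightarrow> nat) \<Rightarrow> 'r \<Rightarrow> real"
    and Ls :: "'l set"
  assumes capacity_pos: "\<And>l. C l > 0"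
    and route_nonempty: "\<And>r. route r \<noteq> {}"
    and full_row_rank: "rank (routing_matrix route) = CARD('l)"
    and weight_pos: "\<And>r. \<kappa> r > 0"
    and service_rate_pos: "\<And>r. \<mu> r > 0"
    and arrival_rate_pos: "\<And>r. lam0 r > 0"
    and critical: "\<And>l. l \<in> Ls \<Longrightarrow> (\<Sum>r | l \<in> route r. lam0 r / \<mu> r) = C l"
    and noncritical: "\<And>l. l \<notin> Ls \<Longrightarrow> (\<Sum>r | l \<in> route r. lam0 r / \<mu> r) < C l"
    and fair: "weighted_proportionally_fair route C \<kappa> x"
begin

abbreviation "\<phi> \<equiv> route_flow x"

text \<open>
  The scaling makes \<open>\<bar>z\<bar>\<^sup>2 = \<Sum> \<kappa>\<^sub>r n\<^sub>r\<^sup>2 / \<lambda>\<^sub>r\<close> the fluid Lyapunov function, turns the invariant states into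
  the cone of the vectors \<open>load l\<close> with \<open>l \<in> Ls\<close>, and gives \<open>\<xi> \<bullet> z = \<Sum> \<kappa>\<^sub>r n\<^sub>r\<close>.
\<close>

definition \<sigma> :: "'r \<Rightarrow> real" where "\<sigma> r = sqrt (\<kappa> r / lam0 r)"

definition state :: "('r \<Rightarrow> nat) \<Rightarrow> real ^ 'r" where
  "state n = (\<chi> r. \<sigma> r * real (n r))"

text \<open>\<open>load l \<bullet> state n\<close> is the sum of \<open>n r / \<mu> r\<close> over
  the routes through \<open>l\<close>, that is, the expected work for link \<open>l\<close> held by
  the flows present.\<close>

definition load :: "'l \<Rightarrow> real ^ 'r" where
  "load l = (\<chi> r. if l \<in> route r then 1 / (\<sigma> r * \<mu> r) else 0)"

definition \<xi> :: "real ^ 'r" where "\<xi> = (\<chi> r. \<kappa> r / \<sigma> r)"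

definition unused :: "('r \<Rightarrow> nat) \<Rightarrow> 'l \<Rightarrow> real" where
  "unused n l = C l - (\<Sum>r | l \<in> route r. \<phi> n r)"

definition drift :: "real \<Rightarrow> ('r \<Rightarrow> nat) \<Rightarrow> real ^ 'r" where
  "drift \<epsilon> n = (\<chi> r. \<sigma> r * ((1 - \<epsilon>) * lam0 r - \<mu> r * \<phi> n r))"

lemma \<sigma>_pos: "\<sigma> r > 0"
  using weight_pos[of r] arrival_rate_pos[of r] by (simp add: \<sigma>_def)

lemma \<sigma>_square: "\<sigma> r * \<sigma> r = \<kappa> r / lam0 r"
  using weight_pos[of r] arrival_rate_pos[of r] by (simp add: \<sigma>_def)

lemma \<xi>_state: "\<xi> \<bullet> state n = (\<Sum>r\<in>UNIV. \<kappa> r * real (n r))"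
  unfolding inner_vec_def using \<sigma>_pos
  by (intro sum.cong) (auto simp: \<xi>_def state_def less_imp_neq[THEN not_sym])

lemma inner_load: "load l \<bullet> v = (\<Sum>r | l \<in> route r. v $ r / (\<sigma> r * \<mu> r))"
  unfolding inner_vec_def load_def
  by (intro sum.mono_neutral_cong_right) auto

lemma \<xi>_load: "l \<in> Ls \<Longrightarrow> \<xi> \<bullet> load l = C l"
proof -
  assume "l \<in> Ls"
  have "\<kappa> r / \<sigma> r / (\<sigma> r * \<mu> r) = lam0 r / \<mu> r" for r
  proof -
    have "\<kappa> r / \<sigma> r / (\<sigma> r * \<mu> r) = \<kappa> r / (\<sigma> r * \<sigma> r) / \<mu> r" by simp
    then show ?thesis using weight_pos[of r] unfolding \<sigma>_square by simp
  qed
  then show ?thesis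
    using critical[OF \<open>l \<in> Ls\<close>] unfolding inner_commute[of \<xi>] inner_load by (simp add: \<xi>_def)
qed

lemma load_drift: "l \<in> Ls \<Longrightarrow> load l \<bullet> drift \<epsilon> n = unused n l - \<epsilon> * C l"
proof -
  assume l: "l \<in> Ls"
  have "\<sigma> r * ((1 - \<epsilon>) * lam0 r - \<mu> r * \<phi> n r) / (\<sigma> r * \<mu> r) = (1 - \<epsilon>) * (lam0 r / \<mu> r) - \<phi> n r" for r
    using \<sigma>_pos[of r] service_rate_pos[of r] by (simp add: field_simps)
  then have "load l \<bullet> drift \<epsilon> n = (\<Sum>r | l \<in> route r. (1 - \<epsilon>) * (lam0 r / \<mu> r) - \<phi> n r)"
    by (simp add: inner_load drift_def)
  also have "\<dots> = (1 - \<epsilon>) * C l - (\<Sum>r | l \<in> route r. \<phi> n r)"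
    by (simp only: sum_subtractf sum_distrib_left[symmetric] critical[OF l])
  finally show ?thesis by (simp add: unused_def algebra_simps)
qed

lemma \<phi>_nonneg: "0 \<le> \<phi> n r"
  using proportionally_fair_feasible(1)[OF fair] by (simp add: route_flow_def)

lemma \<phi>_zero: "n r = 0 \<Longrightarrow> \<phi> n r = 0"
  by (simp add: route_flow_def)

lemma unused_nonneg: "0 \<le> unused n l"
  using proportionally_fair_feasible(2)[OF fair, where l = l and n = n] by (simp add: unused_def)

lemma unused_le: "unused n l \<le> C l"
  by (simp add: unused_def sum_nonneg \<phi>_nonneg)

lemma \<phi>_le: "\<phi> n r \<le> sum C UNIV"
proof -
  obtain l where l: "l \<in> route r" using route_nonempty by blast
  have "\<phi> n r \<le> (\<Sum>r | l \<in> route r. \<phi> n r)"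
    using l by (intro member_le_sum) (auto simp: \<phi>_nonneg)
  also have "\<dots> \<le> C l" using unused_nonneg[of n l] by (simp add: unused_def)
  also have "\<dots> \<le> sum C UNIV" by (intro member_le_sum) (auto simp: capacity_pos less_imp_le)
  finally show ?thesis .
qed

lemma drift_bounded:
  obtains B where "0 \<le> B" "\<And>\<epsilon> n. 0 \<le> \<epsilon> \<Longrightarrow> \<epsilon> \<le> 1 \<Longrightarrow> norm (drift \<epsilon> n) \<le> B"
proof
  let ?B = "\<Sum>r\<in>UNIV. \<sigma> r * (lam0 r + \<mu> r * sum C UNIV)"
  have C0: "0 \<le> sum C UNIV" by (intro sum_nonneg) (auto simp: capacity_pos less_imp_le)
  show "0 \<le> ?B"
    by (rule sum_nonneg) (simp add: C0 \<sigma>_pos arrival_rate_pos service_rate_pos less_imp_le)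
  fix \<epsilon> :: real and n assume \<epsilon>: "0 \<le> \<epsilon>" "\<epsilon> \<le> 1"
  have "norm (drift \<epsilon> n) \<le> (\<Sum>r\<in>UNIV. \<bar>drift \<epsilon> n $ r\<bar>)"
    by (rule norm_le_l1_cart)
  also have "\<dots> \<le> ?B"
  proof (rule sum_mono)
    fix r
    have "\<bar>(1 - \<epsilon>) * lam0 r - \<mu> r * \<phi> n r\<bar> \<le> \<bar>(1 - \<epsilon>) * lam0 r\<bar> + \<bar>\<mu> r * \<phi> n r\<bar>" by simp
    also have "\<dots> \<le> lam0 r + \<mu> r * sum C UNIV"
      using \<epsilon> arrival_rate_pos[of r] service_rate_pos[of r] \<phi>_nonneg[of n r] \<phi>_le[of n r]
      by (intro add_mono) (auto simp: abs_mult intro!: mult_left_mono mult_left_le_one_le)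
    finally show "\<bar>drift \<epsilon> n $ r\<bar> \<le> \<sigma> r * (lam0 r + \<mu> r * sum C UNIV)"
      using \<sigma>_pos[of r] by (simp add: drift_def abs_mult)
  qed
  finally show "norm (drift \<epsilon> n) \<le> ?B" .
qed

text \<open>Multipliers need not be unique when some routes are empty, so one system of prices is
  fixed for each state; everything below uses only the three properties.\<close>

definition price :: "('r \<Rightarrow> nat) \<Rightarrow> 'l \<Rightarrow> real" where
  "price n = (SOME p. (\<forall>l. 0 \<le> p l) \<and> (\<forall>r. \<kappa> r * real (n r) = \<phi> n r * (\<Sum>l\<in>route r. p l)) \<and>
     (\<forall>l. p l * unused n l = 0))"

lemma price_nonneg: "0 \<le> price n l"
  and price_flow: "\<kappa> r * real (n r) = \<phi> n r * (\<Sum>l\<in>route r. price n l)"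
  and price_unused: "price n l * unused n l = 0"
proof -
  have ex: "\<exists>p. (\<forall>l. 0 \<le> p l) \<and> (\<forall>r. \<kappa> r * real (n r) = \<phi> n r * (\<Sum>l\<in>route r. p l)) \<and>
     (\<forall>l. p l * unused n l = 0)"
    unfolding unused_def using proportionally_fair_prices[OF capacity_pos weight_pos fair] by metis
  from someI_ex[OF ex] show "0 \<le> price n l"
    "\<kappa> r * real (n r) = \<phi> n r * (\<Sum>l\<in>route r. price n l)" "price n l * unused n l = 0"
    unfolding price_def[symmetric] by blast+
qed

lemma sum_routes: "(\<Sum>r\<in>UNIV. y r * (\<Sum>l\<in>route r. p l)) = (\<Sum>l\<in>UNIV. p l * (\<Sum>r | l \<in> route r. y r))"
  for y :: "'r \<Rightarrow> real"
proof -
  have "(\<Sum>r\<in>UNIV. y r * (\<Sum>l\<in>route r. p l)) = (\<Sum>r\<in>UNIV. \<Sum>l\<in>UNIV. if l \<in> route r then y r * p l else 0)"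
    by (intro sum.cong) (auto simp: sum_distrib_left sum.If_cases)
  also have "\<dots> = (\<Sum>l\<in>UNIV. \<Sum>r\<in>UNIV. if l \<in> route r then y r * p l else 0)"
    by (rule sum.swap)
  also have "\<dots> = (\<Sum>l\<in>UNIV. p l * (\<Sum>r | l \<in> route r. y r))"
    by (intro sum.cong) (auto simp: sum_distrib_left sum.If_cases mult.commute)
  finally show ?thesis .
qed

text \<open>By \<open>price_flow\<close>, this is the scaled state that would result if every route
  received exactly its critical load \<open>lam0 r / \<mu> r\<close> and only the prices of critical
  links counted.\<close>

definition anchor :: "('r \<Rightarrow> nat) \<Rightarrow> real ^ 'r" where
  "anchor n = (\<Sum>l\<in>Ls. price n l *\<^sub>R load l)"

definition gap :: "('r \<Rightarrow> nat) \<Rightarrow> real" where "gap n = norm (state n - anchor n)"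

definition size :: "('r \<Rightarrow> nat) \<Rightarrow> real" where "size n = 1 + norm (state n)"

lemma size_ge_1: "1 \<le> size n" by (simp add: size_def)

lemma total_price: "(\<Sum>l\<in>UNIV. price n l * C l) = \<xi> \<bullet> state n"
proof -
  have "\<xi> \<bullet> state n = (\<Sum>l\<in>UNIV. price n l * (\<Sum>r | l \<in> route r. \<phi> n r))"
    unfolding \<xi>_state sum_routes[symmetric] by (simp add: price_flow)
  also have "\<dots> = (\<Sum>l\<in>UNIV. price n l * C l)"
  proof (rule sum.cong)
    fix l
    show "price n l * (\<Sum>r | l \<in> route r. \<phi> n r) = price n l * C l"
      using price_unused[of n l] by (cases "price n l = 0") (simp_all add: unused_def)
  qed simp
  finally show ?thesis by simp
qed

lemma price_sum_bound:
  obtains c where "c > 0" "\<And>n. (\<Sum>l\<in>UNIV. price n l) \<le> c * size n"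
proof
  let ?m = "Min (range C)"
  have m: "?m > 0" using capacity_pos by (auto simp: Min_gr_iff)
  show "(1 + norm \<xi>) / ?m > 0" using m by (intro divide_pos_pos) (auto intro: add_pos_nonneg)
  fix n
  have "?m * (\<Sum>l\<in>UNIV. price n l) \<le> (\<Sum>l\<in>UNIV. price n l * C l)"
    unfolding sum_distrib_left mult.commute[of ?m]
    by (intro sum_mono mult_left_mono price_nonneg) simp
  also have "\<dots> \<le> norm \<xi> * norm (state n)" unfolding total_price by (rule norm_cauchy_schwarz)
  also have "\<dots> \<le> (1 + norm \<xi>) * size n" by (auto simp: size_def intro!: mult_mono)
  finally show "(\<Sum>l\<in>UNIV. price n l) \<le> (1 + norm \<xi>) / ?m * size n"
    using m by (simp add: field_simps)
qed

definition slack :: "'l \<Rightarrow> real" where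
  "slack l = C l - (\<Sum>r | l \<in> route r. lam0 r / \<mu> r)"

text \<open>Minus the drift of \<open>\<bar>z\<bar>\<^sup>2 / 2\<close> at \<open>\<epsilon> = 0\<close>, without the second-order terms; see \<open>state_drift\<close>.\<close>

definition dissipation :: "('r \<Rightarrow> nat) \<Rightarrow> real" where
  "dissipation n = (\<Sum>r\<in>UNIV. (\<Sum>l\<in>route r. price n l) * (\<phi> n r - lam0 r / \<mu> r)\<^sup>2 / (lam0 r / \<mu> r))
     + (\<Sum>l\<in>UNIV. price n l * slack l)"

lemma state_drift: "state n \<bullet> drift \<epsilon> n = - dissipation n - \<epsilon> * (\<xi> \<bullet> state n)"
proof -
  let ?B = "\<lambda>r. \<Sum>l\<in>route r. price n l" and ?\<rho> = "\<lambda>r. lam0 r / \<mu> r"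
  have "state n $ r * drift \<epsilon> n $ r = (?\<rho> r - \<phi> n r) * ?B r
      - ?B r * (\<phi> n r - ?\<rho> r)\<^sup>2 / ?\<rho> r - \<epsilon> * (\<kappa> r * real (n r))" for r
  proof -
    have pos: "lam0 r > 0" "\<mu> r > 0" using arrival_rate_pos service_rate_pos by auto
    have "state n $ r * drift \<epsilon> n $ r = (\<sigma> r * \<sigma> r) * real (n r) * ((1 - \<epsilon>) * lam0 r - \<mu> r * \<phi> n r)"
      by (simp add: state_def drift_def)
    also have "\<dots> = (\<kappa> r * real (n r)) * (1 - \<epsilon> - \<phi> n r / ?\<rho> r)"
      unfolding \<sigma>_square using pos by (simp add: field_simps)
    also have "\<dots> = \<phi> n r * ?B r * (1 - \<phi> n r / ?\<rho> r) - \<epsilon> * (\<kappa> r * real (n r))"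
      unfolding price_flow by (simp add: algebra_simps)
    also have "\<phi> n r * ?B r * (1 - \<phi> n r / ?\<rho> r) = (?\<rho> r - \<phi> n r) * ?B r
      - ?B r * (\<phi> n r - ?\<rho> r)\<^sup>2 / ?\<rho> r"
      using pos by (simp add: field_simps power2_eq_square)
    finally show ?thesis .
  qed
  then have "state n \<bullet> drift \<epsilon> n = (\<Sum>r\<in>UNIV. (?\<rho> r - \<phi> n r) * ?B r)
      - (\<Sum>r\<in>UNIV. ?B r * (\<phi> n r - ?\<rho> r)\<^sup>2 / ?\<rho> r) - \<epsilon> * (\<xi> \<bullet> state n)"
    unfolding \<xi>_state by (simp add: inner_vec_def sum_subtractf sum_distrib_left)
  also have "(\<Sum>r\<in>UNIV. (?\<rho> r - \<phi> n r) * ?B r) = (\<Sum>l\<in>UNIV. price n l * (unused n l - slack l))"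
    unfolding sum_routes by (simp add: unused_def slack_def sum_subtractf)
  also have "\<dots> = - (\<Sum>l\<in>UNIV. price n l * slack l)"
    by (simp only: right_diff_distrib price_unused) (simp add: sum_negf)
  finally show ?thesis by (simp add: dissipation_def)
qed

lemma slack_nonneg: "0 \<le> slack l" and slack_zero: "l \<in> Ls \<Longrightarrow> slack l = 0"
  using critical[of l] noncritical[of l] by (cases "l \<in> Ls"; force simp: slack_def)+

text \<open>The two summands match the two sums in \<open>dissipation\<close>: one measures the
  deviation of the flow from the critical load, the other the prices of noncritical links.\<close>

lemma gap_component:
  "(state n - anchor n) $ r =
     \<sigma> r / \<kappa> r * ((\<Sum>l\<in>route r. price n l) * (\<phi> n r - lam0 r / \<mu> r)
       + lam0 r / \<mu> r * (\<Sum>l\<in>route r - Ls. price n l))"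
proof -
  have pos: "lam0 r > 0" "\<mu> r > 0" "\<kappa> r > 0" "\<sigma> r > 0"
    using arrival_rate_pos service_rate_pos weight_pos \<sigma>_pos by auto
  let ?B = "\<Sum>l\<in>route r. price n l" and ?N = "\<Sum>l\<in>route r - Ls. price n l"
  have "anchor n $ r = (\<Sum>l\<in>Ls. if l \<in> route r then price n l * (1 / (\<sigma> r * \<mu> r)) else 0)"
    unfolding anchor_def sum_component by (intro sum.cong) (auto simp: load_def)
  also have "\<dots> = (\<Sum>l\<in>route r \<inter> Ls. price n l) * (1 / (\<sigma> r * \<mu> r))"
    unfolding sum_distrib_right by (intro sum.mono_neutral_cong_right) auto
  also have "(\<Sum>l\<in>route r \<inter> Ls. price n l) = ?B - ?N"
  proof -
    have "?B = (\<Sum>l\<in>(route r \<inter> Ls) \<union> (route r - Ls). price n l)" by (rule arg_cong[of _ _ "sum _"]) auto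
    also have "\<dots> = (\<Sum>l\<in>route r \<inter> Ls. price n l) + ?N" by (intro sum.union_disjoint) auto
    finally show ?thesis by simp
  qed
  also have "1 / (\<sigma> r * \<mu> r) = \<sigma> r / \<kappa> r * (lam0 r / \<mu> r)"
  proof -
    have "\<kappa> r = \<sigma> r * \<sigma> r * lam0 r" unfolding \<sigma>_square using pos by simp
    then show ?thesis using pos by (simp add: field_simps)
  qed
  finally have a: "anchor n $ r = \<sigma> r / \<kappa> r * (lam0 r / \<mu> r * (?B - ?N))" by (simp add: mult_ac)
  have "state n $ r = \<sigma> r / \<kappa> r * (\<kappa> r * real (n r))" using pos by (simp add: state_def)
  then have s: "state n $ r = \<sigma> r / \<kappa> r * (\<phi> n r * ?B)" unfolding price_flow .
  show ?thesis unfolding vector_minus_component a s by (simp add: algebra_simps)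
qed

text \<open>Squaring a component of the gap produces one more price factor than the corresponding
  term of \<open>dissipation\<close> has. Prices are O(\<open>size\<close>), and this extra factor
  is the division by \<open>size n\<close>.\<close>

lemma gap_dissipation:
  obtains c where "c > 0" "\<And>n. c * (gap n)\<^sup>2 / size n \<le> dissipation n"
proof -
  obtain c where c: "c > 0" "\<And>n. (\<Sum>l\<in>UNIV. price n l) \<le> c * size n" using price_sum_bound by blast
  define \<rho> where "\<rho> r = lam0 r / \<mu> r" for r
  have \<rho>: "\<rho> r > 0" for r using arrival_rate_pos service_rate_pos by (simp add: \<rho>_def)
  \<comment> \<open>The smallest slack of a noncritical link; the element 1 covers the case in which
    all links are critical.\<close>
  define s where "s = Min (insert 1 (slack ` (- Ls)))"
  have s: "s > 0" unfolding s_def using noncritical by (auto simp: Min_gr_iff slack_def)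
  have s_le: "s \<le> slack l" if "l \<notin> Ls" for l unfolding s_def using that by (intro Min_le) auto
  \<comment> \<open>Twice the sum of the constants in \<open>q1\<close> and \<open>q2\<close> below,
    from (a + b)^2 \<le> 2 a^2 + 2 b^2, rescaled by the factor in
    \<open>gap_component\<close>.\<close>
  define K where "K r = 2 * c * (\<sigma> r / \<kappa> r)\<^sup>2 * (\<rho> r + (\<rho> r)\<^sup>2 / s)" for r
  have K: "K r > 0" for r
    unfolding K_def using c \<rho>[of r] s \<sigma>_pos[of r] weight_pos[of r] by (intro mult_pos_pos add_pos_pos) auto
  have K0: "sum K UNIV > 0" using K by (intro sum_pos) auto
  have d0: "0 \<le> (\<Sum>l\<in>route r. price n l) * (\<phi> n r - \<rho> r)\<^sup>2 / \<rho> r" for r n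
    using \<rho>[of r] by (intro divide_nonneg_pos mult_nonneg_nonneg sum_nonneg price_nonneg) auto
  have s0: "0 \<le> (\<Sum>l\<in>UNIV. price n l * slack l)" for n
    by (intro sum_nonneg mult_nonneg_nonneg price_nonneg slack_nonneg)
  have comp: "((state n - anchor n) $ r)\<^sup>2 \<le> K r * size n * dissipation n" for n r
  proof -
    let ?B = "\<Sum>l\<in>route r. price n l" and ?N = "\<Sum>l\<in>route r - Ls. price n l"
    have B: "0 \<le> ?B" "?B \<le> c * size n"
      using c(2)[of n] sum_mono2[of UNIV "route r" "price n"] by (auto intro!: sum_nonneg simp: price_nonneg)
    have N: "0 \<le> ?N" "?N \<le> c * size n"
      using c(2)[of n] sum_mono2[of UNIV "route r - Ls" "price n"] by (auto intro!: sum_nonneg simp: price_nonneg)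
    have cs: "0 \<le> c * size n" using c(1) size_ge_1[of n] by simp
    have d1: "?B * (\<phi> n r - \<rho> r)\<^sup>2 / \<rho> r \<le> dissipation n"
    proof -
      have "?B * (\<phi> n r - \<rho> r)\<^sup>2 / \<rho> r \<le> (\<Sum>r\<in>UNIV. (\<Sum>l\<in>route r. price n l) * (\<phi> n r - \<rho> r)\<^sup>2 / \<rho> r)"
        using d0 by (intro member_le_sum[where f = "\<lambda>r. (\<Sum>l\<in>route r. price n l) * (\<phi> n r - \<rho> r)\<^sup>2 / \<rho> r"]) auto
      then show ?thesis using s0[of n] by (simp add: dissipation_def \<rho>_def)
    qed
    have d2: "?N * s \<le> dissipation n"
    proof -
      have "?N * s \<le> (\<Sum>l\<in>route r - Ls. price n l * slack l)"
        unfolding sum_distrib_right by (intro sum_mono mult_left_mono price_nonneg s_le) auto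
      also have "\<dots> \<le> (\<Sum>l\<in>UNIV. price n l * slack l)"
        by (intro sum_mono2) (auto simp: price_nonneg slack_nonneg)
      also have "\<dots> \<le> dissipation n"
        using sum_nonneg[of UNIV "\<lambda>r. (\<Sum>l\<in>route r. price n l) * (\<phi> n r - \<rho> r)\<^sup>2 / \<rho> r"] d0
        by (simp add: dissipation_def \<rho>_def)
      finally show ?thesis .
    qed
    have q1: "(?B * (\<phi> n r - \<rho> r))\<^sup>2 \<le> c * size n * (\<rho> r * dissipation n)"
    proof -
      have "(?B * (\<phi> n r - \<rho> r))\<^sup>2 = ?B * (\<rho> r * (?B * (\<phi> n r - \<rho> r)\<^sup>2 / \<rho> r))"
        using \<rho>[of r] by (simp add: power2_eq_square)
      also have "\<dots> \<le> c * size n * (\<rho> r * dissipation n)"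
        using B d1 \<rho>[of r] d0[where r = r and n = n] cs by (intro mult_mono) auto
      finally show ?thesis .
    qed
    have q2: "(\<rho> r * ?N)\<^sup>2 \<le> c * size n * ((\<rho> r)\<^sup>2 / s * dissipation n)"
    proof -
      have "(\<rho> r * ?N)\<^sup>2 = ?N * ((\<rho> r)\<^sup>2 / s * (?N * s))"
        using s by (simp add: power2_eq_square)
      also have "\<dots> \<le> c * size n * ((\<rho> r)\<^sup>2 / s * dissipation n)"
        using N d2 s cs by (intro mult_mono mult_left_mono) auto
      finally show ?thesis .
    qed
    have "(?B * (\<phi> n r - \<rho> r) + \<rho> r * ?N)\<^sup>2 \<le> 2 * (?B * (\<phi> n r - \<rho> r))\<^sup>2 + 2 * (\<rho> r * ?N)\<^sup>2"
      using sum_squares_bound[of "?B * (\<phi> n r - \<rho> r)" "\<rho> r * ?N"] by (simp add: power2_sum)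
    also have "\<dots> \<le> 2 * c * size n * dissipation n * (\<rho> r + (\<rho> r)\<^sup>2 / s)"
    proof -
      have "2 * c * size n * dissipation n * (\<rho> r + (\<rho> r)\<^sup>2 / s)
        = 2 * (c * size n * (\<rho> r * dissipation n)) + 2 * (c * size n * ((\<rho> r)\<^sup>2 / s * dissipation n))"
        by (simp add: algebra_simps)
      then show ?thesis using q1 q2 by linarith
    qed
    finally have "(\<sigma> r / \<kappa> r)\<^sup>2 * (?B * (\<phi> n r - \<rho> r) + \<rho> r * ?N)\<^sup>2
        \<le> (\<sigma> r / \<kappa> r)\<^sup>2 * (2 * c * size n * dissipation n * (\<rho> r + (\<rho> r)\<^sup>2 / s))"
      by (rule mult_left_mono) simp
    then show ?thesis
      unfolding gap_component \<rho>_def[symmetric] power_mult_distrib by (simp add: K_def mult_ac)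
  qed
  have bound: "(gap n)\<^sup>2 \<le> sum K UNIV * size n * dissipation n" for n
  proof -
    have "(gap n)\<^sup>2 = (\<Sum>r\<in>UNIV. ((state n - anchor n) $ r)\<^sup>2)"
      unfolding gap_def power2_norm_eq_inner inner_vec_def by (simp add: power2_eq_square)
    also have "\<dots> \<le> (\<Sum>r\<in>UNIV. K r * size n * dissipation n)" by (intro sum_mono comp)
    finally show ?thesis by (simp add: sum_distrib_right)
  qed
  show ?thesis
  proof (rule that[of "1 / sum K UNIV"])
    show "1 / sum K UNIV * (gap n)\<^sup>2 / size n \<le> dissipation n" for n
      using bound[of n] K0 size_ge_1[of n] by (simp add: field_simps)
  qed (use K0 in simp)
qed

end

text \<open>The residual \<open>z - y\<close> is orthogonal to the span, so Pythagoras splits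
  \<open>z - w\<close>. With \<open>w\<close> the anchor, the projection is within
  \<open>gap\<close> of both the state and the anchor.\<close>

lemma orthonormal_projection:
  fixes B :: "'a::euclidean_space set" and z :: 'a
  assumes B: "pairwise orthogonal B" "\<And>b. b \<in> B \<Longrightarrow> norm b = 1" "finite B"
    and w: "w \<in> span B"
  defines "y \<equiv> (\<Sum>b\<in>B. (z \<bullet> b) *\<^sub>R b)"
  shows "y \<in> span B" "norm (z - y) \<le> norm (z - w)" "norm (y - w) \<le> norm (z - w)"
proof -
  show y: "y \<in> span B" unfolding y_def by (intro span_sum span_scale span_base)
  have "(z - y) \<bullet> b = 0" if "b \<in> B" for b
  proof -
    have "y \<bullet> b = (\<Sum>c\<in>B. (z \<bullet> c) * (c \<bullet> b))" by (simp add: y_def inner_sum_left)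
    also have "\<dots> = (\<Sum>c\<in>B. if c = b then z \<bullet> b else 0)"
    proof (intro sum.cong refl)
      fix c assume "c \<in> B"
      then show "(z \<bullet> c) * (c \<bullet> b) = (if c = b then z \<bullet> b else 0)"
        using B(1) B(2)[OF that] that by (auto simp: pairwise_def orthogonal_def norm_eq_1)
    qed
    also have "\<dots> = z \<bullet> b" using B(3) that by simp
    finally show ?thesis by (simp add: inner_diff_left)
  qed
  then have "orthogonal (z - y) v" if "v \<in> span B" for v
    by (intro orthogonal_to_span[OF that]) (simp add: orthogonal_def)
  then have "orthogonal (z - y) (y - w)" using y w by (simp add: span_diff)
  from norm_add_Pythagorean[OF this]
  have "(norm (z - w))\<^sup>2 = (norm (z - y))\<^sup>2 + (norm (y - w))\<^sup>2" by simp
  then have "(norm (z - y))\<^sup>2 \<le> (norm (z - w))\<^sup>2" "(norm (y - w))\<^sup>2 \<le> (norm (z - w))\<^sup>2"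
    by simp_all
  then show "norm (z - y) \<le> norm (z - w)" "norm (y - w) \<le> norm (z - w)"
    by (simp_all only: power2_le_imp_le[OF _ norm_ge_zero])
qed

section \<open>The span of the critical loads and the cone of invariant states\<close>

context critical_network
begin

text \<open>This is where full row rank enters: the routing matrix is surjective, and rescaled
  preimages of the unit vectors are dual to the loads. They read off the coefficients in a
  combination of loads.\<close>

lemma dual_loads:
  obtains d :: "'l \<Rightarrow> real ^ 'r" where "\<And>k l. load l \<bullet> d k = (if k = l then 1 else 0)"
proof -
  have "surj ((*v) (routing_matrix route))"
    using full_row_rank full_rank_surjective by blast
  then have "\<exists>y. routing_matrix route *v y = axis k 1" for k
    unfolding surj_def by metis
  then obtain y where y: "\<And>k. routing_matrix route *v y k = axis k 1" by metis
  let ?d = "\<lambda>k. (\<chi> r. \<sigma> r * \<mu> r * (y k $ r)) :: real ^ 'r"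
  have "load l \<bullet> ?d k = (if k = l then 1 else 0)" for k l
  proof -
    have nz: "\<sigma> r * \<mu> r \<noteq> 0" for r using \<sigma>_pos[of r] service_rate_pos[of r] by simp
    have "load l \<bullet> ?d k = (\<Sum>r | l \<in> route r. y k $ r)"
      unfolding inner_load using nz by simp
    also have "\<dots> = (routing_matrix route *v y k) $ l"
      by (simp add: routing_matrix_def matrix_vector_mult_def if_distrib[of "\<lambda>a. a * _"] sum.If_cases cong: if_cong)
    also have "\<dots> = (if k = l then 1 else 0)" by (simp add: y axis_def)
    finally show ?thesis .
  qed
  then show ?thesis by (rule that)
qed

lemma dual_sum:
  assumes d: "\<And>k l. load l \<bullet> d k = (if k = l then 1 else 0)" and "k \<in> Ls"
  shows "d k \<bullet> (\<Sum>l\<in>Ls. q l *\<^sub>R load l) = q k"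
proof -
  have "d k \<bullet> (\<Sum>l\<in>Ls. q l *\<^sub>R load l) = (\<Sum>l\<in>Ls. if k = l then q l else 0)"
    unfolding inner_sum_right by (intro sum.cong) (simp_all add: inner_commute[of "d k"] d)
  then show ?thesis using assms(2) by simp
qed

lemma span_loads:
  assumes d: "\<And>k l. load l \<bullet> d k = (if k = l then 1 else 0)" and "y \<in> span (load ` Ls)"
  shows "y = (\<Sum>l\<in>Ls. (d l \<bullet> y) *\<^sub>R load l)"
  using assms(2)
proof (induction rule: span_induct_alt)
  case base
  then show ?case by simp
next
  case (step c b y)
  then obtain k where k: "k \<in> Ls" "b = load k" by auto
  have "(\<Sum>l\<in>Ls. (d l \<bullet> (c *\<^sub>R b + y)) *\<^sub>R load l)
      = (\<Sum>l\<in>Ls. c *\<^sub>R ((d l \<bullet> b) *\<^sub>R load l)) + (\<Sum>l\<in>Ls. (d l \<bullet> y) *\<^sub>R load l)"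
    by (simp add: inner_add_right scaleR_left_distrib sum.distrib)
  also have "(\<Sum>l\<in>Ls. c *\<^sub>R ((d l \<bullet> b) *\<^sub>R load l)) = (\<Sum>l\<in>Ls. if l = k then c *\<^sub>R load l else 0)"
    by (intro sum.cong) (auto simp: k inner_commute[of "d _"] d)
  finally show ?case using step.IH k by simp
qed

text \<open>The origin of the factor \<open>card Ls\<close> in the result: it is the trace of the
  projection onto this span.\<close>

lemma dim_loads: "dim (span (load ` Ls)) = card Ls"
proof -
  obtain d where d: "\<And>k l. load l \<bullet> d k = (if k = l then 1 else 0)" by (rule dual_loads) blast
  have inj: "inj_on load Ls"
    by (rule inj_onI) (metis d zero_neq_one)
  have "independent (load ` Ls)"
  proof (rule real_vector.independent_if_scalars_zero)
    fix f v assume 0: "(\<Sum>v\<in>load ` Ls. f v *\<^sub>R v) = 0" and v: "v \<in> load ` Ls"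
    then obtain k where k: "k \<in> Ls" "v = load k" by auto
    have "0 = d k \<bullet> (\<Sum>l\<in>Ls. f (load l) *\<^sub>R load l)"
      using 0 by (simp add: sum.reindex[OF inj])
    also have "\<dots> = f v" using dual_sum[of d, OF d k(1)] k by simp
    finally show "f v = 0" by simp
  qed simp
  then show ?thesis
    using inj by (metis dim_span_eq_card_independent card_image)
qed

text \<open>The coefficients carry no sign condition: they are nonnegative when applied to the cone,
  but arbitrary when applied to the projection onto the span.\<close>

lemma loads_drift:
  "(\<Sum>l\<in>Ls. q l *\<^sub>R load l) \<bullet> drift \<epsilon> n =
     (\<Sum>l\<in>Ls. q l * unused n l) - \<epsilon> * (\<xi> \<bullet> (\<Sum>l\<in>Ls. q l *\<^sub>R load l))"
proof -
  have "(\<Sum>l\<in>Ls. q l *\<^sub>R load l) \<bullet> drift \<epsilon> n = (\<Sum>l\<in>Ls. q l * unused n l - \<epsilon> * (q l * C l))"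
    unfolding inner_sum_left by (intro sum.cong) (auto simp: load_drift algebra_simps)
  also have "\<dots> = (\<Sum>l\<in>Ls. q l * unused n l) - \<epsilon> * (\<Sum>l\<in>Ls. q l * C l)"
    by (simp add: sum_subtractf sum_distrib_left)
  also have "(\<Sum>l\<in>Ls. q l * C l) = \<xi> \<bullet> (\<Sum>l\<in>Ls. q l *\<^sub>R load l)"
    unfolding inner_sum_right by (intro sum.cong) (auto simp: \<xi>_load)
  finally show ?thesis .
qed

definition collapse :: "(real ^ 'r) set" where
  "collapse = convex_cone hull (load ` Ls)"

lemma collapse_eq: "collapse = {v. \<exists>q. (\<forall>l. 0 \<le> q l) \<and> v = (\<Sum>l\<in>Ls. q l *\<^sub>R load l)}"
  unfolding collapse_def by (rule convex_cone_hull_image_eq) simp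

lemma collapse_closed: "closed collapse"
  unfolding collapse_def by (rule closed_convex_cone_hull) simp

lemma anchor_collapse: "anchor n \<in> collapse"
  unfolding collapse_eq anchor_def using price_nonneg by auto

text \<open>Written through \<open>closest_point\<close> because the vector from the closest point
  to \<open>z\<close> serves as the gradient direction.\<close>

definition perp :: "real ^ 'r \<Rightarrow> real" where
  "perp z = norm (z - closest_point collapse z)"

lemma perp_nonneg: "0 \<le> perp z" by (simp add: perp_def)

lemma closest_collapse: "closest_point collapse z \<in> collapse"
  using closest_point_in_set[OF collapse_closed] anchor_collapse by blast

lemma perp_le: "a \<in> collapse \<Longrightarrow> perp z \<le> norm (z - a)"
  using closest_point_le[OF collapse_closed] by (simp add: perp_def dist_norm)

lemma perp_le_gap: "perp (state n) \<le> gap n"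
  unfolding gap_def by (rule perp_le[OF anchor_collapse])

lemma perp_drift:
  assumes "0 \<le> \<epsilon>"
  shows "(state n - closest_point collapse (state n)) \<bullet> drift \<epsilon> n
    \<le> - dissipation n + \<epsilon> * (norm \<xi> * perp (state n))"
proof -
  let ?a = "closest_point collapse (state n)"
  obtain q where q: "\<And>l. 0 \<le> q l" "?a = (\<Sum>l\<in>Ls. q l *\<^sub>R load l)"
    using closest_collapse[of "state n"] unfolding collapse_eq by auto
  have "0 \<le> (\<Sum>l\<in>Ls. q l * unused n l)"
    by (intro sum_nonneg mult_nonneg_nonneg q unused_nonneg)
  then have "?a \<bullet> drift \<epsilon> n \<ge> - \<epsilon> * (\<xi> \<bullet> ?a)"
    unfolding q(2) loads_drift by simp
  then have "(state n - ?a) \<bullet> drift \<epsilon> n \<le> - dissipation n - \<epsilon> * (\<xi> \<bullet> (state n - ?a))"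
    by (simp add: inner_diff_left inner_diff_right state_drift algebra_simps)
  also have "- (\<xi> \<bullet> (state n - ?a)) \<le> norm \<xi> * perp (state n)"
    using norm_cauchy_schwarz[of "- \<xi>" "state n - ?a"] by (simp add: perp_def)
  then have "- dissipation n - \<epsilon> * (\<xi> \<bullet> (state n - ?a)) \<le> - dissipation n + \<epsilon> * (norm \<xi> * perp (state n))"
    using mult_left_mono[OF _ assms] by fastforce
  finally show ?thesis .
qed

lemma gap_le_size:
  obtains c where "c > 0" "\<And>n. gap n \<le> c * size n"
proof -
  obtain c where c: "c > 0" "\<And>n. (\<Sum>l\<in>UNIV. price n l) \<le> c * size n" using price_sum_bound by blast
  let ?M = "Max (range (\<lambda>l. norm (load l)))"
  have M: "norm (load l) \<le> ?M" for l by simp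
  have M0: "0 \<le> ?M" using M norm_ge_zero order_trans by blast
  show ?thesis
  proof (rule that[of "1 + c * ?M"])
    show "0 < 1 + c * ?M" using c M0 by (simp add: add_pos_nonneg)
    fix n
    have "norm (anchor n) \<le> (\<Sum>l\<in>Ls. norm (price n l *\<^sub>R load l))"
      unfolding anchor_def by (rule norm_sum)
    also have "\<dots> \<le> (\<Sum>l\<in>Ls. price n l * ?M)"
      using price_nonneg M by (intro sum_mono) (auto intro!: mult_left_mono)
    also have "\<dots> \<le> (\<Sum>l\<in>UNIV. price n l * ?M)"
      using price_nonneg M0 by (intro sum_mono2) auto
    also have "\<dots> \<le> c * size n * ?M"
      unfolding sum_distrib_right[symmetric] using c M0 by (intro mult_right_mono) auto
    finally have "norm (anchor n) \<le> c * ?M * size n" by (simp add: mult_ac)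
    then show "gap n \<le> (1 + c * ?M) * size n"
      using norm_triangle_ineq4[of "state n" "anchor n"] by (simp add: gap_def size_def algebra_simps)
  qed
qed

text \<open>\<open>perp_drift\<close> at \<epsilon> = 0 bounds the dissipation by
  \<open>perp\<close> times the norm of the drift, which is bounded, and
  \<open>gap_dissipation\<close> bounds it from below. This is a converse to
  \<open>perp_le_gap\<close>, at the price of a factor \<open>size\<close>.\<close>

lemma gap_perp:
  obtains c where "c > 0" "\<And>n. (gap n)\<^sup>2 \<le> c * size n * perp (state n)"
proof -
  obtain a where a: "a > 0" "\<And>n. a * (gap n)\<^sup>2 / size n \<le> dissipation n" using gap_dissipation by blast
  obtain B where B: "0 \<le> B" "\<And>\<epsilon> n. 0 \<le> \<epsilon> \<Longrightarrow> \<epsilon> \<le> 1 \<Longrightarrow> norm (drift \<epsilon> n) \<le> B"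
    using drift_bounded by blast
  show ?thesis
  proof (rule that[of "(B + 1) / a"])
    show "(B + 1) / a > 0" using a B by simp
    fix n
    let ?v = "state n - closest_point collapse (state n)"
    have "a * (gap n)\<^sup>2 / size n \<le> dissipation n" by (rule a)
    also have "\<dots> \<le> (- ?v) \<bullet> drift 0 n"
      unfolding inner_minus_left using perp_drift[of 0 n] by simp
    also have "\<dots> \<le> norm (- ?v) * norm (drift 0 n)" by (rule norm_cauchy_schwarz)
    also have "\<dots> \<le> perp (state n) * (B + 1)"
      unfolding norm_minus_cancel perp_def[symmetric]
      using B(2)[of 0 n] by (intro mult_left_mono) (auto simp: perp_nonneg)
    finally show "(gap n)\<^sup>2 \<le> (B + 1) / a * size n * perp (state n)"
      using a(1) size_ge_1[of n] by (simp add: field_simps)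
  qed
qed

text \<open>The coordinates of the projection are taken with the dual vectors, so the constant
  depends on these and on \<open>\<xi>\<close> but not on the orthonormal basis
  \<open>B\<close>.\<close>

lemma projected_drift:
  obtains c where "c > 0" "\<And>B \<epsilon> n. pairwise orthogonal B \<Longrightarrow> (\<And>b. b \<in> B \<Longrightarrow> norm b = 1) \<Longrightarrow> finite B \<Longrightarrow>
      span B = span (load ` Ls) \<Longrightarrow> 0 \<le> \<epsilon> \<Longrightarrow>
      \<bar>(\<Sum>b\<in>B. (state n \<bullet> b) *\<^sub>R b) \<bullet> drift \<epsilon> n + \<epsilon> * (\<xi> \<bullet> state n)\<bar> \<le>
        c * gap n * (\<epsilon> + (\<Sum>l\<in>Ls. unused n l))"
proof -
  obtain d where d: "\<And>k l. load l \<bullet> d k = (if k = l then 1 else 0)" by (rule dual_loads) blast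
  define M where "M = Max (range (\<lambda>l. norm (d l)))"
  have M: "norm (d l) \<le> M" for l by (simp add: M_def)
  have M0: "0 \<le> M" using M norm_ge_zero order_trans by blast
  show ?thesis
  proof (rule that[of "1 + norm \<xi> + M"])
    show "0 < 1 + norm \<xi> + M" using M0 norm_ge_zero[of \<xi>] by linarith
    fix B :: "(real ^ 'r) set" and \<epsilon> :: real and n
    assume B: "pairwise orthogonal B" "\<And>b. b \<in> B \<Longrightarrow> norm b = 1" "finite B"
      and sp: "span B = span (load ` Ls)" and \<epsilon>: "0 \<le> \<epsilon>"
    define y where "y = (\<Sum>b\<in>B. (state n \<bullet> b) *\<^sub>R b)"
    have "anchor n \<in> span B"
      unfolding sp anchor_def by (intro span_sum span_scale span_base) auto
    note pr = orthonormal_projection[OF B this, of "state n", folded y_def gap_def]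
    let ?q = "\<lambda>l. d l \<bullet> y"
    have y: "y = (\<Sum>l\<in>Ls. ?q l *\<^sub>R load l)"
      by (rule span_loads[OF d]) (use pr(1) sp in auto)
    have "?q l * unused n l = (d l \<bullet> (y - anchor n)) * unused n l" if "l \<in> Ls" for l
    proof -
      have "d l \<bullet> anchor n = price n l" unfolding anchor_def by (rule dual_sum[OF d that])
      then show ?thesis using price_unused[of n l] by (simp add: inner_diff_right algebra_simps)
    qed
    then have "(\<Sum>l\<in>Ls. ?q l * unused n l) = (\<Sum>l\<in>Ls. (d l \<bullet> (y - anchor n)) * unused n l)"
      by (rule sum.cong[OF refl])
    also have "\<bar>\<dots>\<bar> \<le> (\<Sum>l\<in>Ls. \<bar>d l \<bullet> (y - anchor n)\<bar> * unused n l)"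
      using unused_nonneg by (intro order_trans[OF sum_abs] sum_mono) (simp add: abs_mult)
    also have "\<dots> \<le> (\<Sum>l\<in>Ls. M * gap n * unused n l)"
    proof (intro sum_mono mult_right_mono unused_nonneg)
      fix l
      have "\<bar>d l \<bullet> (y - anchor n)\<bar> \<le> norm (d l) * norm (y - anchor n)" by (rule Cauchy_Schwarz_ineq2)
      also have "\<dots> \<le> M * gap n" using M pr(3) M0 by (intro mult_mono) auto
      finally show "\<bar>d l \<bullet> (y - anchor n)\<bar> \<le> M * gap n" .
    qed
    finally have e1: "\<bar>\<Sum>l\<in>Ls. ?q l * unused n l\<bar> \<le> M * gap n * (\<Sum>l\<in>Ls. unused n l)"
 
      unfolding sum_distrib_left .
    have "\<bar>\<xi> \<bullet> (state n - y)\<bar> \<le> norm \<xi> * norm (state n - y)" by (rule Cauchy_Schwarz_ineq2)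
    also have "\<dots> \<le> norm \<xi> * gap n" using pr(2) by (intro mult_left_mono) auto
    finally have e2: "\<epsilon> * \<bar>\<xi> \<bullet> (state n - y)\<bar> \<le> \<epsilon> * (norm \<xi> * gap n)"
      using \<epsilon> by (intro mult_left_mono)
    have "y \<bullet> drift \<epsilon> n = (\<Sum>l\<in>Ls. ?q l * unused n l) - \<epsilon> * (\<xi> \<bullet> y)"
      using loads_drift[of ?q \<epsilon> n] unfolding y[symmetric] .
    then have "y \<bullet> drift \<epsilon> n + \<epsilon> * (\<xi> \<bullet> state n) = (\<Sum>l\<in>Ls. ?q l * unused n l) + \<epsilon> * (\<xi> \<bullet> (state n - y))"
      by (simp add: inner_diff_right right_diff_distrib)
    then have "\<bar>y \<bullet> drift \<epsilon> n + \<epsilon> * (\<xi> \<bullet> state n)\<bar> \<le>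
        \<bar>\<Sum>l\<in>Ls. ?q l * unused n l\<bar> + \<epsilon> * \<bar>\<xi> \<bullet> (state n - y)\<bar>"
      using \<epsilon> abs_triangle_ineq[of "\<Sum>l\<in>Ls. ?q l * unused n l" "\<epsilon> * (\<xi> \<bullet> (state n - y))"]
      by (simp only: abs_mult abs_of_nonneg)
    also have "\<dots> \<le> M * gap n * (\<Sum>l\<in>Ls. unused n l) + \<epsilon> * (norm \<xi> * gap n)"
      using e1 e2 by (rule add_mono)
    also have "\<dots> \<le> (1 + norm \<xi> + M) * gap n * (\<Sum>l\<in>Ls. unused n l) + (1 + norm \<xi> + M) * gap n * \<epsilon>"
    proof (intro add_mono)
      have g: "0 \<le> gap n" "0 \<le> (\<Sum>l\<in>Ls. unused n l)"
        by (auto simp: gap_def intro: sum_nonneg unused_nonneg)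
      show "M * gap n * (\<Sum>l\<in>Ls. unused n l) \<le> (1 + norm \<xi> + M) * gap n * (\<Sum>l\<in>Ls. unused n l)"
        using g by (intro mult_right_mono) auto
      have "norm \<xi> * gap n * \<epsilon> \<le> (1 + norm \<xi> + M) * gap n * \<epsilon>"
        using g \<epsilon> M0 by (intro mult_right_mono) auto
      then show "\<epsilon> * (norm \<xi> * gap n) \<le> (1 + norm \<xi> + M) * gap n * \<epsilon>" by (simp add: mult_ac)
    qed
    finally show "\<bar>(\<Sum>b\<in>B. (state n \<bullet> b) *\<^sub>R b) \<bullet> drift \<epsilon> n + \<epsilon> * (\<xi> \<bullet> state n)\<bar> \<le>
        (1 + norm \<xi> + M) * gap n * (\<epsilon> + (\<Sum>l\<in>Ls. unused n l))"
      unfolding y_def[symmetric] by (simp only: distrib_left add.commute)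
  qed
qed

end

text \<open>Departures are indexed by their target \<open>n(r := n r - 1)\<close>. On an empty route
  truncated subtraction makes that target \<open>n\<close> itself, which is harmless because the
  route flow is 0. Indexing by routes also avoids any question of coinciding targets.\<close>

lemma flow_count_rates_jumps:
  fixes F :: "('r::finite \<Rightarrow> nat) \<Rightarrow> real" and lam \<mu> :: "'r \<Rightarrow> real" and x :: "('r \<Rightarrow> nat) \<Rightarrow> 'r \<Rightarrow> real"
  defines "q \<equiv> flow_count_rates lam \<mu> x"
  shows "finite {m. q n m \<noteq> 0}"
    and "(\<Sum>m | q n m \<noteq> 0. q n m * F m) =
      (\<Sum>r\<in>UNIV. lam r * F (n(r := n r + 1)) + route_flow x n r * \<mu> r * F (n(r := n r - 1)))"
proof -
  let ?up = "\<lambda>r. n(r := n r + 1)" and ?dn = "\<lambda>r. n(r := n r - 1)"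
  let ?A = "range ?up \<union> range ?dn"
  let ?c = "\<lambda>r. route_flow x n r * \<mu> r"
  have q: "q n m = (\<Sum>r\<in>UNIV. (if m = ?up r then lam r else 0) + (if m = ?dn r then ?c r else 0))" for m
  proof -
    have "(if n = m(r := m r + 1) then real (n r) * x n r * \<mu> r else 0) = (if m = ?dn r then ?c r else 0)" for r
    proof (cases "n r = 0")
      case False
      then have "n = m(r := m r + 1) \<longleftrightarrow> m = ?dn r"
        by (metis Suc_eq_plus1 Suc_pred' add_diff_cancel_right' fun_upd_same fun_upd_triv fun_upd_upd gr0I)
      then show ?thesis by (simp add: route_flow_def)
    next
      case True
      then have "real (n r) * x n r * \<mu> r = 0" "?c r = 0" by (simp_all add: route_flow_def)
      then show ?thesis by (simp only: if_cancel)
    qed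
    then show ?thesis unfolding q_def flow_count_rates_def by simp
  qed
  have sub: "{m. q n m \<noteq> 0} \<subseteq> ?A"
  proof
    fix m assume "m \<in> {m. q n m \<noteq> 0}"
    then have "q n m \<noteq> 0" by simp
    then obtain r where "(if m = ?up r then lam r else 0) + (if m = ?dn r then ?c r else 0) \<noteq> 0"
      unfolding q by (meson sum.not_neutral_contains_not_neutral)
    then show "m \<in> ?A" by (auto split: if_splits)
  qed
  then show "finite {m. q n m \<noteq> 0}" by (rule finite_subset) simp
  have "(\<Sum>m | q n m \<noteq> 0. q n m * F m) = (\<Sum>m\<in>?A. q n m * F m)"
    using sub by (intro sum.mono_neutral_left) auto
  also have "\<dots> = (\<Sum>m\<in>?A. \<Sum>r\<in>UNIV. (if m = ?up r then lam r * F m else 0) + (if m = ?dn r then ?c r * F m else 0))"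
    unfolding q sum_distrib_right by (intro sum.cong refl) (simp add: distrib_right)
  also have "\<dots> = (\<Sum>r\<in>UNIV. \<Sum>m\<in>?A. (if m = ?up r then lam r * F m else 0) + (if m = ?dn r then ?c r * F m else 0))"
    by (rule sum.swap)
  also have "\<dots> = (\<Sum>r\<in>UNIV. lam r * F (?up r) + ?c r * F (?dn r))"
    by (intro sum.cong refl) (simp add: sum.distrib)
  finally show "(\<Sum>m | q n m \<noteq> 0. q n m * F m) = (\<Sum>r\<in>UNIV. lam r * F (?up r) + ?c r * F (?dn r))" .
qed

section \<open>The generator of the flow count process on functions of the scaled state\<close>

context critical_network
begin

definition rates :: "real \<Rightarrow> ('r \<Rightarrow> nat) \<Rightarrow> ('r \<Rightarrow> nat) \<Rightarrow> real" where
  "rates \<epsilon> = flow_count_rates (\<lambda>r. (1 - \<epsilon>) * lam0 r) \<mu> x"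

definition \<Lambda> :: real where "\<Lambda> = (\<Sum>r\<in>UNIV. lam0 r + \<mu> r * sum C UNIV)"

definition jump_size :: real where "jump_size = sum \<sigma> UNIV"

lemma flow_rate_bounds:
  assumes "0 \<le> \<epsilon>" "\<epsilon> \<le> 1"
  shows "0 \<le> (1 - \<epsilon>) * lam0 r" "0 \<le> \<phi> n r * \<mu> r"
    "(\<Sum>r\<in>UNIV. (1 - \<epsilon>) * lam0 r + \<phi> n r * \<mu> r) \<le> \<Lambda>"
proof -
  show "0 \<le> (1 - \<epsilon>) * lam0 r" for r using assms arrival_rate_pos[of r] by simp
  show "0 \<le> \<phi> n r * \<mu> r" using \<phi>_nonneg service_rate_pos[of r] by simp
  show "(\<Sum>r\<in>UNIV. (1 - \<epsilon>) * lam0 r + \<phi> n r * \<mu> r) \<le> \<Lambda>"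
    unfolding \<Lambda>_def
  proof (intro sum_mono add_mono)
    fix r
    show "(1 - \<epsilon>) * lam0 r \<le> lam0 r"
      using assms arrival_rate_pos[of r] by (intro mult_left_le_one_le) auto
    show "\<phi> n r * \<mu> r \<le> \<mu> r * sum C UNIV"
      using \<phi>_le[of n r] service_rate_pos[of r] by (simp add: mult.commute)
  qed
qed

lemma \<Lambda>_nonneg: "0 \<le> \<Lambda>"
proof -
  have "0 \<le> sum C UNIV" by (intro sum_nonneg) (auto simp: capacity_pos less_imp_le)
  then show ?thesis
    unfolding \<Lambda>_def by (intro sum_nonneg) (simp add: arrival_rate_pos service_rate_pos less_imp_le)
qed

lemma rates_bounded:
  assumes \<epsilon>: "0 \<le> \<epsilon>" "\<epsilon> \<le> 1"
  shows "bounded_rates (rates \<epsilon>) \<Lambda>"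
proof
  fix n m
  have if_nonneg: "0 \<le> (if b then c else 0)" if "0 \<le> c" for b and c :: real
    using that by simp
  show "0 \<le> rates \<epsilon> n m"
    unfolding rates_def flow_count_rates_def
    by (intro sum_nonneg add_nonneg_nonneg if_nonneg flow_rate_bounds(1)[OF \<epsilon>]
      flow_rate_bounds(2)[OF \<epsilon>, unfolded route_flow_def])
  have "n \<noteq> n(r := n r + 1)" for r by (auto simp: fun_eq_iff)
  then show "rates \<epsilon> n n = 0" unfolding rates_def flow_count_rates_def by simp
  show "finite {m. rates \<epsilon> n m \<noteq> 0}"
    unfolding rates_def by (rule flow_count_rates_jumps)
  have "(\<Sum>m | rates \<epsilon> n m \<noteq> 0. rates \<epsilon> n m) = (\<Sum>r\<in>UNIV. (1 - \<epsilon>) * lam0 r + \<phi> n r * \<mu> r)"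
    using flow_count_rates_jumps(2)[of "\<lambda>r. (1 - \<epsilon>) * lam0 r" \<mu> x n "\<lambda>_. 1"] by (simp add: rates_def)
  then show "(\<Sum>m | rates \<epsilon> n m \<noteq> 0. rates \<epsilon> n m) \<le> \<Lambda>"
    using flow_rate_bounds(3)[OF \<epsilon>] by simp
qed

lemma norm_jump: "norm (\<sigma> r *\<^sub>R axis r 1 :: real ^ 'r) \<le> jump_size"
proof -
  have "\<sigma> r \<le> jump_size"
    unfolding jump_size_def using \<sigma>_pos by (intro member_le_sum) (auto intro: less_imp_le)
  then show ?thesis using \<sigma>_pos[of r] by simp
qed

lemma state_up: "state (n(r := n r + 1)) = state n + \<sigma> r *\<^sub>R axis r 1"
  by (auto simp: vec_eq_iff state_def axis_def algebra_simps)

lemma state_down: "n r \<noteq> 0 \<Longrightarrow> state (n(r := n r - 1)) = state n + - (\<sigma> r *\<^sub>R axis r 1)"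
  by (auto simp: vec_eq_iff state_def axis_def of_nat_diff algebra_simps)

text \<open>For an empty route the right-hand side evaluates \<open>H\<close> at a vector with a
  negative coordinate; its coefficient \<open>\<phi> n r\<close> is 0 there.\<close>

lemma rates_sum:
  "(\<Sum>m | rates \<epsilon> n m \<noteq> 0. rates \<epsilon> n m * H (state m)) =
    (\<Sum>r\<in>UNIV. (1 - \<epsilon>) * lam0 r * H (state n + \<sigma> r *\<^sub>R axis r 1)
       + \<phi> n r * \<mu> r * H (state n + - (\<sigma> r *\<^sub>R axis r 1)))"
proof -
  have "\<phi> n r * \<mu> r * H (state (n(r := n r - 1))) = \<phi> n r * \<mu> r * H (state n + - (\<sigma> r *\<^sub>R axis r 1))" for r
    by (cases "n r = 0") (auto simp only: state_down \<phi>_zero mult_zero_left)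
  then show ?thesis
    unfolding rates_def
    by (subst flow_count_rates_jumps(2)[where F = "\<lambda>m. H (state m)"]) (simp only: state_up)
qed

lemma generator_rates:
  "generator (rates \<epsilon>) (\<lambda>m. F (state m)) n =
    (\<Sum>r\<in>UNIV. (1 - \<epsilon>) * lam0 r * (F (state n + \<sigma> r *\<^sub>R axis r 1) - F (state n))
       + \<phi> n r * \<mu> r * (F (state n + - (\<sigma> r *\<^sub>R axis r 1)) - F (state n)))"
  unfolding generator_def by (rule rates_sum[where H = "\<lambda>z. F z - F (state n)"])

lemma inner_drift:
  "g \<bullet> drift \<epsilon> n = (\<Sum>r\<in>UNIV. ((1 - \<epsilon>) * lam0 r - \<phi> n r * \<mu> r) * (g \<bullet> (\<sigma> r *\<^sub>R axis r 1)))"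
  unfolding inner_vec_def[of g "drift \<epsilon> n"]
  by (intro sum.cong) (auto simp: drift_def inner_axis algebra_simps)

text \<open>Jump rates are nonnegative, so an upper expansion of \<open>F\<close> suffices; keeping
  the closest point fixed yields exactly such a one-sided expansion for \<open>perp\<close>.\<close>

lemma generator_le:
  assumes \<epsilon>: "0 \<le> \<epsilon>" "\<epsilon> \<le> 1" and R: "0 \<le> R"
    and step: "\<And>s. norm s \<le> jump_size \<Longrightarrow> F (state n + s) \<le> F (state n) + g \<bullet> s + R"
  shows "generator (rates \<epsilon>) (\<lambda>m. F (state m)) n \<le> g \<bullet> drift \<epsilon> n + \<Lambda> * R"
proof -
  let ?a = "\<lambda>r. (1 - \<epsilon>) * lam0 r" and ?b = "\<lambda>r. \<phi> n r * \<mu> r" and ?s = "\<lambda>r. \<sigma> r *\<^sub>R axis r 1 :: real ^ 'r"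
  have "generator (rates \<epsilon>) (\<lambda>m. F (state m)) n \<le>
      (\<Sum>r\<in>UNIV. ?a r * (g \<bullet> ?s r + R) + ?b r * (g \<bullet> (- ?s r) + R))"
    unfolding generator_rates
  proof (intro sum_mono add_mono mult_left_mono flow_rate_bounds[OF \<epsilon>])
    fix r
    show "F (state n + ?s r) - F (state n) \<le> g \<bullet> ?s r + R"
      using step[of "?s r"] norm_jump[of r] by simp
    show "F (state n + - ?s r) - F (state n) \<le> g \<bullet> (- ?s r) + R"
      using step[of "- ?s r"] norm_jump[of r] by simp
  qed
  also have "\<dots> = (\<Sum>r\<in>UNIV. (?a r - ?b r) * (g \<bullet> ?s r) + (?a r + ?b r) * R)"
    by (intro sum.cong refl) (simp add: algebra_simps)
  also have "\<dots> = g \<bullet> drift \<epsilon> n + (\<Sum>r\<in>UNIV. ?a r + ?b r) * R"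
    unfolding inner_drift sum.distrib sum_distrib_right[symmetric] by simp
  also have "\<dots> \<le> g \<bullet> drift \<epsilon> n + \<Lambda> * R"
    using flow_rate_bounds(3)[OF \<epsilon>] R by (intro add_left_mono mult_right_mono) auto
  finally show ?thesis .
qed

lemma jump_abs_le:
  assumes \<epsilon>: "0 \<le> \<epsilon>" "\<epsilon> \<le> 1" and R: "0 \<le> R"
    and step: "\<And>s. norm s \<le> jump_size \<Longrightarrow> \<bar>F (state n + s) - F (state n)\<bar> \<le> R"
  shows "(\<Sum>m | rates \<epsilon> n m \<noteq> 0. rates \<epsilon> n m * \<bar>F (state m) - F (state n)\<bar>) \<le> \<Lambda> * R"
proof -
  let ?a = "\<lambda>r. (1 - \<epsilon>) * lam0 r" and ?b = "\<lambda>r. \<phi> n r * \<mu> r" and ?s = "\<lambda>r. \<sigma> r *\<^sub>R axis r 1 :: real ^ 'r"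
  have "(\<Sum>m | rates \<epsilon> n m \<noteq> 0. rates \<epsilon> n m * \<bar>F (state m) - F (state n)\<bar>)
      \<le> (\<Sum>r\<in>UNIV. ?a r * R + ?b r * R)"
    unfolding rates_sum[where H = "\<lambda>z. \<bar>F z - F (state n)\<bar>"]
  proof (intro sum_mono add_mono mult_left_mono flow_rate_bounds[OF \<epsilon>])
    fix r
    show "\<bar>F (state n + ?s r) - F (state n)\<bar> \<le> R" by (rule step[OF norm_jump])
    show "\<bar>F (state n + - ?s r) - F (state n)\<bar> \<le> R"
      by (rule step) (simp only: norm_minus_cancel norm_jump)
  qed
  also have "\<dots> = (\<Sum>r\<in>UNIV. ?a r + ?b r) * R" by (simp add: sum_distrib_right distrib_right)
  also have "\<dots> \<le> \<Lambda> * R"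
    using flow_rate_bounds(3)[OF \<epsilon>] R by (intro mult_right_mono) auto
  finally show ?thesis .
qed

text \<open>Each route jumps by plus or minus the same vector: the linear part sees the difference
  of the two rates, the even part \<open>Q\<close> their sum.\<close>

lemma generator_quadratic:
  assumes step: "\<And>s. F (state n + s) = F (state n) + g \<bullet> s + Q s" and Q: "\<And>s. Q (- s) = Q s"
  shows "generator (rates \<epsilon>) (\<lambda>m. F (state m)) n =
    g \<bullet> drift \<epsilon> n + (\<Sum>r\<in>UNIV. ((1 - \<epsilon>) * lam0 r + \<phi> n r * \<mu> r) * Q (\<sigma> r *\<^sub>R axis r 1))"
  unfolding generator_rates inner_drift sum.distrib[symmetric] step Q
  by (intro sum.cong refl) (simp add: algebra_simps)

section \<open>Stationary moments\<close>

lemma \<xi>_state_ge: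
  obtains c where "c > 0" "\<And>n. c * norm (state n) \<le> \<xi> \<bullet> state n"
proof
  let ?m = "Min (range (\<lambda>r. \<xi> $ r))"
  show pos: "?m > 0" using weight_pos \<sigma>_pos by (auto simp: Min_gr_iff \<xi>_def)
  have m: "0 \<le> ?m" by (rule less_imp_le[OF pos])
  fix n
  have "?m * norm (state n) \<le> ?m * (\<Sum>r\<in>UNIV. \<bar>state n $ r\<bar>)"
    using m by (intro mult_left_mono norm_le_l1_cart)
  also have "\<dots> \<le> (\<Sum>r\<in>UNIV. \<xi> $ r * state n $ r)"
    unfolding sum_distrib_left
  proof (rule sum_mono)
    fix r
    have s: "0 \<le> state n $ r" using \<sigma>_pos[of r] by (simp add: state_def)
    then show "?m * \<bar>state n $ r\<bar> \<le> \<xi> $ r * state n $ r"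
      by (auto intro!: mult_right_mono)
  qed
  finally show "?m * norm (state n) \<le> \<xi> \<bullet> state n" by (simp add: inner_vec_def)
qed

lemma jump_size_nonneg: "0 \<le> jump_size"
  unfolding jump_size_def using \<sigma>_pos by (intro sum_nonneg) (auto intro: less_imp_le)

lemma inner_increment_le:
  fixes z s :: "real ^ 'r"
  assumes "norm s \<le> S"
  shows "\<bar>2 * (z \<bullet> s) + (norm s)\<^sup>2\<bar> \<le> 2 * norm z * S + S\<^sup>2"
proof -
  have "\<bar>z \<bullet> s\<bar> \<le> norm z * norm s" by (rule Cauchy_Schwarz_ineq2)
  also have "\<dots> \<le> norm z * S" using assms by (intro mult_left_mono) auto
  finally have "\<bar>z \<bullet> s\<bar> \<le> norm z * S" .
  moreover have "(norm s)\<^sup>2 \<le> S\<^sup>2" using assms by (intro power_mono) auto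
  moreover have "0 \<le> (norm s)\<^sup>2" by simp
  ultimately show ?thesis by linarith
qed

lemma norm_add_square: "(norm (z + s))\<^sup>2 = (norm z)\<^sup>2 + (2 * (z \<bullet> s) + (norm s)\<^sup>2)" for z s :: "real ^ 'r"
  by (simp add: power2_norm_eq_inner inner_add_left inner_add_right inner_commute)

text \<open>The gradient of the test function is \<open>4 * (1 + (norm z)^2)\<close> times
  \<open>z\<close>, so \<open>state_drift\<close> is multiplied by order \<open>size^2\<close>: the
  dissipation \<open>gap^2 / size\<close> becomes \<open>size * gap^2\<close> and the \<epsilon>
  term becomes \<open>\<epsilon> * size^3\<close>. The second-order terms are
  O(\<open>size^2\<close>).\<close>

lemma quartic_drift:
  obtains a K where "a > 0" "K > 0"
    "\<And>\<epsilon> n. 0 < \<epsilon> \<Longrightarrow> \<epsilon> < 1 \<Longrightarrow> generator (rates \<epsilon>) (\<lambda>n. (1 + (norm (state n))\<^sup>2)\<^sup>2) n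
       \<le> K / \<epsilon>\<^sup>2 - a * (size n * (gap n)\<^sup>2 + \<epsilon> * size n ^ 3)"
proof -
  obtain a where a: "a > 0" "\<And>n. a * (gap n)\<^sup>2 / size n \<le> dissipation n" using gap_dissipation by blast
  obtain b where b: "b > 0" "\<And>n. b * norm (state n) \<le> \<xi> \<bullet> state n" using \<xi>_state_ge by blast
  define S where "S = jump_size"
  have S: "0 \<le> S" unfolding S_def by (rule jump_size_nonneg)
  define r0 where "r0 = 2 * S\<^sup>2 + (2 * S + S\<^sup>2)\<^sup>2"
  have r0: "0 \<le> r0" unfolding r0_def by simp
  \<comment> \<open>Collects the terms in \<open>size^2\<close>: those of second order, and
    \<open>2 * b * \<epsilon> * size^2\<close>, which appears on replacing
    \<open>norm (state n)\<close> by \<open>size n - 1\<close>.\<close>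
  define k where "k = 2 * b + \<Lambda> * r0 + 1"
  have k: "k > 0" unfolding k_def using b \<Lambda>_nonneg r0 by (smt (verit) mult_nonneg_nonneg)
  define a' where "a' = min (2 * a) b"
  have a': "a' > 0" "a' \<le> 2 * a" "a' \<le> b" unfolding a'_def using a b by auto
  show ?thesis
  proof (rule that[of a' "k ^ 3 / b\<^sup>2"])
    show "0 < a'" by (rule a')
    show "0 < k ^ 3 / b\<^sup>2" using k b by simp
    fix \<epsilon> :: real and n assume \<epsilon>: "0 < \<epsilon>" "\<epsilon> < 1"
    let ?z = "state n" and ?m = "size n"
    let ?w = "1 + (norm ?z)\<^sup>2"
    have m1: "1 \<le> ?m" by (rule size_ge_1)
    have zm: "norm ?z = ?m - 1" by (simp add: size_def)
    have w_le: "?w \<le> ?m\<^sup>2" by (simp add: size_def power2_eq_square algebra_simps)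
    have w_ge: "?m\<^sup>2 \<le> 2 * ?w"
      using sum_squares_bound[of 1 "norm ?z"] by (simp add: size_def power2_sum)
    have R: "2 * ?w * S\<^sup>2 + (2 * norm ?z * S + S\<^sup>2)\<^sup>2 \<le> r0 * ?m\<^sup>2"
    proof -
      have "2 * norm ?z * S + S\<^sup>2 \<le> (2 * S + S\<^sup>2) * ?m"
      proof -
        have "0 \<le> S\<^sup>2 * (?m - 1) + 2 * S" using m1 S by simp
        then show ?thesis unfolding zm by (simp add: algebra_simps)
      qed
      then have "(2 * norm ?z * S + S\<^sup>2)\<^sup>2 \<le> (2 * S + S\<^sup>2)\<^sup>2 * ?m\<^sup>2"
        unfolding power_mult_distrib[symmetric] using S by (intro power_mono) auto
      moreover have "2 * ?w * S\<^sup>2 \<le> 2 * S\<^sup>2 * ?m\<^sup>2"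
        using mult_right_mono[OF w_le, of "2 * S\<^sup>2"] by (simp only: mult_ac) simp
      ultimately show ?thesis unfolding r0_def distrib_right by linarith
    qed
    have step: "(1 + (norm (?z + s))\<^sup>2)\<^sup>2 \<le> ?w\<^sup>2 + ((4 * ?w) *\<^sub>R ?z) \<bullet> s + r0 * ?m\<^sup>2"
      if s: "norm s \<le> jump_size" for s
    proof -
      let ?e = "2 * (?z \<bullet> s) + (norm s)\<^sup>2"
      have "(1 + (norm (?z + s))\<^sup>2)\<^sup>2 = ?w\<^sup>2 + 4 * ?w * (?z \<bullet> s) + (2 * ?w * (norm s)\<^sup>2 + ?e\<^sup>2)"
        unfolding norm_add_square by (simp add: power2_eq_square algebra_simps)
      also have "?e\<^sup>2 \<le> (2 * norm ?z * S + S\<^sup>2)\<^sup>2"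
        using inner_increment_le[of s S ?z] s by (intro abs_le_square_iff[THEN iffD1]) (auto simp: S_def)
      also have "2 * ?w * (norm s)\<^sup>2 \<le> 2 * ?w * S\<^sup>2"
        using s by (intro mult_left_mono power_mono) (auto simp: S_def)
      also note R
      finally show ?thesis by simp
    qed
    have G1: "generator (rates \<epsilon>) (\<lambda>n. (1 + (norm (state n))\<^sup>2)\<^sup>2) n
        \<le> ((4 * ?w) *\<^sub>R ?z) \<bullet> drift \<epsilon> n + \<Lambda> * (r0 * ?m\<^sup>2)"
      by (rule generator_le[where F = "\<lambda>z. (1 + (norm z)\<^sup>2)\<^sup>2"]) (use \<epsilon> r0 step in auto)
    have G2: "((4 * ?w) *\<^sub>R ?z) \<bullet> drift \<epsilon> n = - (4 * ?w * (dissipation n + \<epsilon> * (\<xi> \<bullet> ?z)))"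
      by (simp add: state_drift algebra_simps)
    have G3: "2 * ?m\<^sup>2 * (a * (gap n)\<^sup>2 / ?m + \<epsilon> * (b * norm ?z)) \<le> 4 * ?w * (dissipation n + \<epsilon> * (\<xi> \<bullet> ?z))"
    proof (rule mult_mono)
      show "2 * ?m\<^sup>2 \<le> 4 * ?w" using w_ge by simp
      show "a * (gap n)\<^sup>2 / ?m + \<epsilon> * (b * norm ?z) \<le> dissipation n + \<epsilon> * (\<xi> \<bullet> ?z)"
        using a(2) b(2) \<epsilon> by (intro add_mono mult_left_mono) auto
    qed (use a b m1 \<epsilon> in auto)
    have G4: "2 * ?m\<^sup>2 * (a * (gap n)\<^sup>2 / ?m + \<epsilon> * (b * norm ?z))
        = 2 * a * (?m * (gap n)\<^sup>2) + 2 * b * (\<epsilon> * ?m ^ 3) - 2 * b * \<epsilon> * ?m\<^sup>2"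
      unfolding zm using m1 by (simp add: field_simps power2_eq_square power3_eq_cube)
    have "generator (rates \<epsilon>) (\<lambda>n. (1 + (norm (state n))\<^sup>2)\<^sup>2) n
      \<le> - (2 * a * (?m * (gap n)\<^sup>2)) - 2 * b * (\<epsilon> * ?m ^ 3) + (2 * b * \<epsilon> * ?m\<^sup>2 + \<Lambda> * (r0 * ?m\<^sup>2))"
      using G1 G3 unfolding G2 G4 by linarith
    also have "2 * b * \<epsilon> * ?m\<^sup>2 + \<Lambda> * (r0 * ?m\<^sup>2) \<le> k * ?m\<^sup>2"
    proof -
      have "2 * b * \<epsilon> \<le> 2 * b" using \<epsilon> b by simp
      then have "2 * b * \<epsilon> + \<Lambda> * r0 \<le> k" unfolding k_def by simp
      then have "(2 * b * \<epsilon> + \<Lambda> * r0) * ?m\<^sup>2 \<le> k * ?m\<^sup>2" by (rule mult_right_mono) simp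
      then show ?thesis by (simp add: distrib_right mult.assoc)
    qed
    \<comment> \<open>Half of the cubic term pays for the quadratic one: it dominates for
      \<open>?m\<close> above \<open>k / (b * \<epsilon>)\<close>, and below that threshold the
      quadratic term is O(1 / \<epsilon>^2).\<close>
    also have "k * ?m\<^sup>2 \<le> b * (\<epsilon> * ?m ^ 3) + k ^ 3 / b\<^sup>2 / \<epsilon>\<^sup>2"
    proof (cases "k \<le> b * \<epsilon> * ?m")
      case True
      then have "k * ?m\<^sup>2 \<le> b * \<epsilon> * ?m * ?m\<^sup>2" by (intro mult_right_mono) auto
      then have "k * ?m\<^sup>2 \<le> b * (\<epsilon> * ?m ^ 3)" by (simp add: power2_eq_square power3_eq_cube mult_ac)
      moreover have "0 \<le> k ^ 3 / b\<^sup>2 / \<epsilon>\<^sup>2" using k by simp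
      ultimately show ?thesis by simp
    next
      case False
      then have "?m \<le> k / (b * \<epsilon>)" using b \<epsilon> by (simp add: field_simps)
      then have "k * ?m\<^sup>2 \<le> k * (k / (b * \<epsilon>))\<^sup>2"
        using k m1 by (intro mult_left_mono power_mono) auto
      also have "\<dots> = k ^ 3 / b\<^sup>2 / \<epsilon>\<^sup>2" by (simp add: power_divide power2_eq_square power3_eq_cube mult_ac)
      finally have "k * ?m\<^sup>2 \<le> k ^ 3 / b\<^sup>2 / \<epsilon>\<^sup>2" .
      moreover have "0 \<le> b * (\<epsilon> * ?m ^ 3)" using b \<epsilon> m1 by simp
      ultimately show ?thesis by linarith
    qed
    finally have G5: "generator (rates \<epsilon>) (\<lambda>n. (1 + (norm (state n))\<^sup>2)\<^sup>2) n
      \<le> k ^ 3 / b\<^sup>2 / \<epsilon>\<^sup>2 - (2 * a * (?m * (gap n)\<^sup>2) + b * (\<epsilon> * ?m ^ 3))"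
      by linarith
    have "a' * (?m * (gap n)\<^sup>2 + \<epsilon> * ?m ^ 3) \<le> 2 * a * (?m * (gap n)\<^sup>2) + b * (\<epsilon> * ?m ^ 3)"
      unfolding distrib_left using a' m1 \<epsilon> by (intro add_mono mult_right_mono) auto
    with G5 show "generator (rates \<epsilon>) (\<lambda>n. (1 + (norm (state n))\<^sup>2)\<^sup>2) n
       \<le> k ^ 3 / b\<^sup>2 / \<epsilon>\<^sup>2 - a' * (?m * (gap n)\<^sup>2 + \<epsilon> * ?m ^ 3)" by linarith
  qed
qed

text \<open>Keeping the closest point of \<open>state n\<close> fixed, \<open>perp\<close> after a
  jump \<open>s\<close> is at most \<open>norm (v + s)\<close>, whose fourth power has gradient
  \<open>4 * perp^2\<close> times \<open>v\<close>. The gain \<open>perp^2 * gap^2 / size\<close> is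
  turned into a pure gap term by \<open>perp >= gap^2 / (c * size)\<close>, which is
  \<open>gap_perp\<close>.\<close>

lemma perp_quartic_drift:
  obtains a K where "a > 0" "K > 0"
    "\<And>\<epsilon> n. 0 < \<epsilon> \<Longrightarrow> \<epsilon> < 1 \<Longrightarrow> generator (rates \<epsilon>) (\<lambda>n. perp (state n) ^ 4) n
       \<le> K * (\<epsilon> * perp (state n) ^ 3 + (perp (state n))\<^sup>2 + 1) - a * (gap n ^ 6 / size n ^ 3)"
proof -
  obtain a where a: "a > 0" "\<And>n. a * (gap n)\<^sup>2 / size n \<le> dissipation n" using gap_dissipation by blast
  obtain c where c: "c > 0" "\<And>n. (gap n)\<^sup>2 \<le> c * size n * perp (state n)" using gap_perp by blast
  define S where "S = jump_size"
  have S: "0 \<le> S" unfolding S_def by (rule jump_size_nonneg)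
  \<comment> \<open>In the second-order terms, 10 = 2 + 8: the 2 comes from
    \<open>2 * T^2 * S^2\<close>, the 8 from
    \<open>(2 * T * S + S^2)^2 <= 8 * S^2 * T^2 + 2 * S^4\<close>.\<close>
  define K where "K = 4 * norm \<xi> + \<Lambda> * (10 * S\<^sup>2 + 2 * S ^ 4) + 1"
  have K: "4 * norm \<xi> \<le> K" "\<Lambda> * (10 * S\<^sup>2) \<le> K" "\<Lambda> * (2 * S ^ 4) \<le> K" "0 < K"
    unfolding K_def using \<Lambda>_nonneg by (auto simp: distrib_left intro!: add_nonneg_pos)
  show ?thesis
  proof (rule that[of "4 * a / c\<^sup>2" K])
    show "0 < 4 * a / c\<^sup>2" using a c by simp
    show "0 < K" by (rule K)
    fix \<epsilon> :: real and n assume \<epsilon>: "0 < \<epsilon>" "\<epsilon> < 1"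
    let ?z = "state n" and ?m = "size n"
    define v where "v = ?z - closest_point collapse ?z"
    define T where "T = perp ?z"
    have T: "T = norm v" "0 \<le> T" by (simp_all add: T_def v_def perp_def)
    have m1: "1 \<le> ?m" by (rule size_ge_1)
    have step: "perp (?z + s) ^ 4 \<le> perp ?z ^ 4 + ((4 * T\<^sup>2) *\<^sub>R v) \<bullet> s + (10 * S\<^sup>2 * T\<^sup>2 + 2 * S ^ 4)"
      if s: "norm s \<le> jump_size" for s
    proof -
      let ?e = "2 * (v \<bullet> s) + (norm s)\<^sup>2"
      have "perp (?z + s) \<le> norm (v + s)"
        using perp_le[OF closest_collapse, of "?z + s" ?z] by (simp add: v_def algebra_simps)
      then have "perp (?z + s) ^ 4 \<le> norm (v + s) ^ 4"
        by (intro power_mono perp_nonneg)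
      also have "\<dots> = ((norm (v + s))\<^sup>2)\<^sup>2" by simp
      also have "\<dots> = T ^ 4 + 4 * T\<^sup>2 * (v \<bullet> s) + (2 * T\<^sup>2 * (norm s)\<^sup>2 + ?e\<^sup>2)"
        unfolding norm_add_square T(1)[symmetric] by (simp add: power2_eq_square power4_eq_xxxx algebra_simps)
      also have "?e\<^sup>2 \<le> (2 * T * S + S\<^sup>2)\<^sup>2"
        using inner_increment_le[of s S v] s S T(2)
        by (intro abs_le_square_iff[THEN iffD1]) (auto simp: S_def T(1)[symmetric])
      also have "(2 * T * S + S\<^sup>2)\<^sup>2 \<le> 2 * (2 * T * S)\<^sup>2 + 2 * (S\<^sup>2)\<^sup>2"
        using sum_squares_bound[of "2 * T * S" "S\<^sup>2"] by (simp only: power2_sum)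
      also have "\<dots> = 8 * S\<^sup>2 * T\<^sup>2 + 2 * S ^ 4"
        by (simp add: power2_eq_square power4_eq_xxxx)
      also have "2 * T\<^sup>2 * (norm s)\<^sup>2 \<le> 2 * T\<^sup>2 * S\<^sup>2"
        using s by (intro mult_left_mono power_mono) (auto simp: S_def)
      finally show ?thesis by (simp add: T_def[symmetric] mult_ac)
    qed
    have "generator (rates \<epsilon>) (\<lambda>n. perp (state n) ^ 4) n
        \<le> ((4 * T\<^sup>2) *\<^sub>R v) \<bullet> drift \<epsilon> n + \<Lambda> * (10 * S\<^sup>2 * T\<^sup>2 + 2 * S ^ 4)"
      by (rule generator_le[where F = "\<lambda>z. perp z ^ 4"]) (use \<epsilon> step in auto)
    also have "((4 * T\<^sup>2) *\<^sub>R v) \<bullet> drift \<epsilon> n \<le> 4 * T\<^sup>2 * (- (a * (gap n)\<^sup>2 / ?m) + \<epsilon> * (norm \<xi> * T))"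
      unfolding inner_scaleR_left
      using perp_drift[of \<epsilon> n] a(2)[of n] \<epsilon> by (intro mult_left_mono) (auto simp: v_def T_def)
    also have "\<dots> = 4 * norm \<xi> * (\<epsilon> * T ^ 3) - 4 * a * (T\<^sup>2 * (gap n)\<^sup>2 / ?m)"
      by (simp add: power2_eq_square power3_eq_cube algebra_simps)
    also have "gap n ^ 6 / ?m ^ 3 / c\<^sup>2 \<le> T\<^sup>2 * (gap n)\<^sup>2 / ?m"
    proof -
      have "((gap n)\<^sup>2)\<^sup>2 \<le> (c * ?m * T)\<^sup>2"
        using c(2)[of n] by (intro power_mono) (auto simp: T_def)
      then have "((gap n)\<^sup>2)\<^sup>2 * (gap n)\<^sup>2 \<le> (c * ?m * T)\<^sup>2 * (gap n)\<^sup>2"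
        by (rule mult_right_mono) simp
      then show ?thesis
        using c(1) m1 by (simp add: field_simps power2_eq_square eval_nat_numeral)
    qed
    then have "4 * norm \<xi> * (\<epsilon> * T ^ 3) - 4 * a * (T\<^sup>2 * (gap n)\<^sup>2 / ?m)
        \<le> 4 * norm \<xi> * (\<epsilon> * T ^ 3) - 4 * a * (gap n ^ 6 / ?m ^ 3 / c\<^sup>2)"
      using a by (intro diff_left_mono mult_left_mono) auto
    also have "4 * norm \<xi> * (\<epsilon> * T ^ 3) - 4 * a * (gap n ^ 6 / ?m ^ 3 / c\<^sup>2) + \<Lambda> * (10 * S\<^sup>2 * T\<^sup>2 + 2 * S ^ 4)
        \<le> K * (\<epsilon> * T ^ 3 + T\<^sup>2 + 1) - 4 * a / c\<^sup>2 * (gap n ^ 6 / ?m ^ 3)"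
    proof -
      have "4 * norm \<xi> * (\<epsilon> * T ^ 3) \<le> K * (\<epsilon> * T ^ 3)"
        using K \<epsilon> T(2) by (intro mult_right_mono) auto
      moreover have "\<Lambda> * (10 * S\<^sup>2) * T\<^sup>2 \<le> K * T\<^sup>2" using K by (intro mult_right_mono) auto
      ultimately show ?thesis using K(3) by (simp add: distrib_left mult_ac)
    qed
    finally show "generator (rates \<epsilon>) (\<lambda>n. perp (state n) ^ 4) n
       \<le> K * (\<epsilon> * perp (state n) ^ 3 + (perp (state n))\<^sup>2 + 1) - 4 * a / c\<^sup>2 * (gap n ^ 6 / ?m ^ 3)"
      by (simp add: T_def)
  qed
qed

section \<open>State space collapse: stationary moments of \<open>size\<close> and
  \<open>gap\<close>\<close>

lemma gap_nonneg: "0 \<le> gap n" by (simp add: gap_def)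

lemma integrable_size_power:
  assumes "integrable (measure_pmf \<pi>) (\<lambda>n. size n ^ 3)" and "\<And>n. \<bar>f n\<bar> \<le> K * size n ^ 3"
  shows "integrable (measure_pmf \<pi>) f"
proof (rule Bochner_Integration.integrable_bound)
  show "integrable (measure_pmf \<pi>) (\<lambda>n. K * size n ^ 3)" using assms(1) by simp
  show "AE n in \<pi>. norm (f n) \<le> norm (K * size n ^ 3)"
    using assms(2) by (intro AE_I2) (smt (verit) real_norm_def)
qed simp

lemma size_moments:
  obtains K where "K > 0"
    "\<And>\<epsilon> \<pi>. 0 < \<epsilon> \<Longrightarrow> \<epsilon> < 1 \<Longrightarrow> stationary_distribution (rates \<epsilon>) \<pi> \<Longrightarrow>
       integrable (measure_pmf \<pi>) (\<lambda>n. size n ^ 3) \<and>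
       measure_pmf.expectation \<pi> (\<lambda>n. size n * (gap n)\<^sup>2) \<le> K / \<epsilon>\<^sup>2"
proof -
  obtain a K where a: "a > 0" "K > 0" and drift:
    "\<And>\<epsilon> n. 0 < \<epsilon> \<Longrightarrow> \<epsilon> < 1 \<Longrightarrow> generator (rates \<epsilon>) (\<lambda>n. (1 + (norm (state n))\<^sup>2)\<^sup>2) n
       \<le> K / \<epsilon>\<^sup>2 - a * (size n * (gap n)\<^sup>2 + \<epsilon> * size n ^ 3)"
    using quartic_drift by blast
  show ?thesis
  proof (rule that[of "K / a"])
    show "K / a > 0" using a by simp
    fix \<epsilon> :: real and \<pi>
    assume \<epsilon>: "0 < \<epsilon>" "\<epsilon> < 1" and st: "stationary_distribution (rates \<epsilon>) \<pi>"
    interpret bounded_rates "rates \<epsilon>" \<Lambda> using \<epsilon> by (intro rates_bounded) auto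
    let ?g = "\<lambda>n. a * (size n * (gap n)\<^sup>2 + \<epsilon> * size n ^ 3)"
    have s0: "0 \<le> size n" for n using size_ge_1[of n] by simp
    have g0: "0 \<le> ?g n" for n
      using a \<epsilon> s0[of n] by (intro mult_nonneg_nonneg add_nonneg_nonneg) auto
    note db = integrable_drift_bound[OF st _ g0 _ _ drift[OF \<epsilon>]]
    have int: "integrable (measure_pmf \<pi>) ?g"
      by (rule db(1)) (use a in auto)
    have E: "measure_pmf.expectation \<pi> ?g \<le> measure_pmf.expectation \<pi> (\<lambda>_. K / \<epsilon>\<^sup>2)"
      by (rule db(2)) (use a in auto)
    have int3: "integrable (measure_pmf \<pi>) (\<lambda>n. size n ^ 3)"
    proof (rule Bochner_Integration.integrable_bound)
      show "integrable (measure_pmf \<pi>) (\<lambda>n. ?g n / (a * \<epsilon>))"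
        using int by (rule integrable_divide)
      have "size n ^ 3 \<le> ?g n / (a * \<epsilon>)" for n
        using a \<epsilon> s0[of n] by (simp add: field_simps)
      then show "AE n in \<pi>. norm (size n ^ 3) \<le> norm (?g n / (a * \<epsilon>))"
        using s0 g0 a \<epsilon> by (intro AE_I2) (smt (verit) real_norm_def zero_le_power)
    qed simp
    moreover have "measure_pmf.expectation \<pi> (\<lambda>n. size n * (gap n)\<^sup>2) \<le> K / a / \<epsilon>\<^sup>2"
    proof -
      obtain c where c: "c > 0" "\<And>n. gap n \<le> c * size n" using gap_le_size by blast
      have i: "integrable (measure_pmf \<pi>) (\<lambda>n. size n * (gap n)\<^sup>2)"
      proof (rule integrable_size_power[OF int3, where K = "c\<^sup>2"])
        fix n
        have "size n * (gap n)\<^sup>2 \<le> size n * (c * size n)\<^sup>2"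
          using c(2)[of n] gap_nonneg s0[of n] by (intro mult_left_mono power_mono) auto
        then show "\<bar>size n * (gap n)\<^sup>2\<bar> \<le> c\<^sup>2 * size n ^ 3"
          using s0[of n] by (simp add: power2_eq_square power3_eq_cube mult_ac)
      qed
      have "a * measure_pmf.expectation \<pi> (\<lambda>n. size n * (gap n)\<^sup>2)
          = measure_pmf.expectation \<pi> (\<lambda>n. a * (size n * (gap n)\<^sup>2))" by simp
      also have "\<dots> \<le> measure_pmf.expectation \<pi> ?g"
        using i int a \<epsilon> s0 by (intro integral_mono) auto
      also have "\<dots> \<le> K / \<epsilon>\<^sup>2" using E by simp
      finally have "measure_pmf.expectation \<pi> (\<lambda>n. size n * (gap n)\<^sup>2) \<le> K / \<epsilon>\<^sup>2 / a"
        by (subst pos_le_divide_eq[OF a(1)]) (simp only: mult.commute)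
      then show ?thesis by (simp add: mult.commute)
    qed
    ultimately show "integrable (measure_pmf \<pi>) (\<lambda>n. size n ^ 3) \<and>
       measure_pmf.expectation \<pi> (\<lambda>n. size n * (gap n)\<^sup>2) \<le> K / a / \<epsilon>\<^sup>2" by blast
  qed
qed

lemma square_le_cube:
  fixes t \<tau> :: real
  assumes "0 \<le> t" "0 < \<tau>"
  shows "t\<^sup>2 \<le> \<tau>\<^sup>2 + t ^ 3 / \<tau>"
proof (cases "t \<le> \<tau>")
  case True
  then have "t\<^sup>2 \<le> \<tau>\<^sup>2" using assms by (intro power_mono) auto
  moreover have "0 \<le> t ^ 3 / \<tau>" using assms by simp
  ultimately show ?thesis by simp
next
  case False
  then have "t\<^sup>2 * \<tau> \<le> t\<^sup>2 * t" by (intro mult_left_mono) auto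
  then have "t\<^sup>2 \<le> t ^ 3 / \<tau>" using assms by (simp add: field_simps power2_eq_square power3_eq_cube)
  then show ?thesis by (simp add: add_increasing)
qed

text \<open>Split at \<open>g = u * m\<close>: below it one factor \<open>g\<close> is replaced by
  \<open>u * m\<close>, above it the quotient \<open>(g / (u * m))^3\<close> is at least 1. With
  \<open>g\<close> the gap and \<open>m\<close> the size, the right-hand side combines the
  quantities controlled by the two test functions, and \<open>u\<close> balances them.\<close>

lemma cube_le_interpolation:
  fixes g m u :: real
  assumes "0 \<le> g" "0 < m" "0 < u"
  shows "g ^ 3 \<le> g ^ 6 / m ^ 3 / u ^ 3 + u * (m * g\<^sup>2)"
proof (cases "g \<le> u * m")
  case True
  then have "g * g\<^sup>2 \<le> u * m * g\<^sup>2" by (intro mult_right_mono) auto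
  moreover have "0 \<le> g ^ 6 / m ^ 3 / u ^ 3" using assms by simp
  ultimately show ?thesis by (simp add: power2_eq_square power3_eq_cube mult_ac)
next
  case False
  then have "(u * m) ^ 3 \<le> g ^ 3" using assms by (intro power_mono) auto
  then have "g ^ 3 * (u * m) ^ 3 \<le> g ^ 3 * g ^ 3" using assms by (intro mult_left_mono) auto
  then have "g ^ 3 * (m ^ 3 * u ^ 3) \<le> g ^ 6"
    by (simp add: power_mult_distrib mult_ac flip: power_add)
  then have "g ^ 3 \<le> g ^ 6 / m ^ 3 / u ^ 3" using assms by (simp add: field_simps)
  moreover have "0 \<le> u * (m * g\<^sup>2)" using assms by simp
  ultimately show ?thesis by simp
qed

text \<open>
  Writing \<open>\<epsilon> = \<delta>\<^sup>1\<^sup>8\<close> makes all fractional powers of \<open>\<epsilon>\<close> below integral powers of \<open>\<delta>\<close>.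
\<close>

lemma gap_third_moment:
  obtains K where "K > 0"
    "\<And>\<delta> \<pi>. 0 < \<delta> \<Longrightarrow> \<delta> < 1 \<Longrightarrow> stationary_distribution (rates (\<delta> ^ 18)) \<pi> \<Longrightarrow>
       integrable (measure_pmf \<pi>) (\<lambda>n. gap n ^ 3) \<and>
       measure_pmf.expectation \<pi> (\<lambda>n. gap n ^ 3) \<le> K / \<delta> ^ 33"
proof -
  obtain a K where a: "a > 0" "K > 0" and drift:
    "\<And>\<epsilon> n. 0 < \<epsilon> \<Longrightarrow> \<epsilon> < 1 \<Longrightarrow> generator (rates \<epsilon>) (\<lambda>n. perp (state n) ^ 4) n
       \<le> K * (\<epsilon> * perp (state n) ^ 3 + (perp (state n))\<^sup>2 + 1) - a * (gap n ^ 6 / size n ^ 3)"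
    using perp_quartic_drift by blast
  obtain M where M: "M > 0" and mom:
    "\<And>\<epsilon> \<pi>. 0 < \<epsilon> \<Longrightarrow> \<epsilon> < 1 \<Longrightarrow> stationary_distribution (rates \<epsilon>) \<pi> \<Longrightarrow>
       integrable (measure_pmf \<pi>) (\<lambda>n. size n ^ 3) \<and>
       measure_pmf.expectation \<pi> (\<lambda>n. size n * (gap n)\<^sup>2) \<le> M / \<epsilon>\<^sup>2"
    using size_moments by blast
  obtain c where c: "c > 0" "\<And>n. gap n \<le> c * size n" using gap_le_size by blast
  define K' where "K' = K * (2 * c * M + 2) / a + M"
  show ?thesis
  proof (rule that[of K'])
    show "K' > 0" unfolding K'_def using a M c by (intro add_nonneg_pos) auto
    fix \<delta> :: real and \<pi>
    assume \<delta>: "0 < \<delta>" "\<delta> < 1" and st: "stationary_distribution (rates (\<delta> ^ 18)) \<pi>"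
    have \<epsilon>: "0 < \<delta> ^ 18" "\<delta> ^ 18 < 1" using \<delta> by (simp_all add: power_less_one_iff)
    interpret bounded_rates "rates (\<delta> ^ 18)" \<Lambda> using \<epsilon> by (intro rates_bounded) auto
    have int3: "integrable (measure_pmf \<pi>) (\<lambda>n. size n ^ 3)"
      and E2: "measure_pmf.expectation \<pi> (\<lambda>n. size n * (gap n)\<^sup>2) \<le> M / \<delta> ^ 36"
      using mom[OF \<epsilon> st] by (simp_all flip: power_mult)
    have s1: "1 \<le> size n" and s0: "0 \<le> size n" for n using size_ge_1[of n] by simp_all
    have int_sg: "integrable (measure_pmf \<pi>) (\<lambda>n. size n * (gap n)\<^sup>2)"
    proof (rule integrable_size_power[OF int3, where K = "c\<^sup>2"])
      fix n
      have "size n * (gap n)\<^sup>2 \<le> size n * (c * size n)\<^sup>2"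
        using c(2)[of n] gap_nonneg s0[of n] by (intro mult_left_mono power_mono) auto
      then show "\<bar>size n * (gap n)\<^sup>2\<bar> \<le> c\<^sup>2 * size n ^ 3"
        using s0[of n] by (simp add: power2_eq_square power3_eq_cube mult_ac)
    qed
    have int_g3: "integrable (measure_pmf \<pi>) (\<lambda>n. gap n ^ 3)"
    proof (rule integrable_size_power[OF int3, where K = "c ^ 3"])
      fix n
      have "gap n ^ 3 \<le> (c * size n) ^ 3" using c(2)[of n] gap_nonneg by (intro power_mono) auto
      then show "\<bar>gap n ^ 3\<bar> \<le> c ^ 3 * size n ^ 3" using gap_nonneg[of n] by (simp add: power_mult_distrib)
    qed
    let ?T = "\<lambda>n. perp (state n)"
    let ?h = "\<lambda>n. K * (2 * c / \<delta> ^ 24 * (\<delta> ^ 36 * (size n * (gap n)\<^sup>2)) + 2 / \<delta> ^ 24)"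
    have h: "K * (\<delta> ^ 18 * ?T n ^ 3 + (?T n)\<^sup>2 + 1) \<le> ?h n" for n
    proof (rule mult_left_mono)
      let ?y = "c * (size n * (gap n)\<^sup>2)"
      have "?T n ^ 3 \<le> gap n ^ 3" by (intro power_mono perp_le_gap perp_nonneg)
      also have "\<dots> = gap n * (gap n)\<^sup>2" by (simp add: power2_eq_square power3_eq_cube)
      also have "\<dots> \<le> c * size n * (gap n)\<^sup>2" using c(2) by (intro mult_right_mono) auto
      finally have T3: "?T n ^ 3 \<le> ?y" by simp
      have y0: "0 \<le> ?y" using c s0[of n] by simp
      \<comment> \<open>The level \<open>1 / \<delta> ^ 12\<close> balances the two terms: its
        square is of order \<open>1 / \<delta> ^ 24\<close>, and so is the mean of
        \<open>\<delta> ^ 12 * ?y\<close>, because the mean of \<open>?y\<close> is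
        O(\<open>1 / \<delta> ^ 36\<close>).\<close>
      have "(?T n)\<^sup>2 \<le> (1 / \<delta> ^ 12)\<^sup>2 + ?T n ^ 3 / (1 / \<delta> ^ 12)"
        using \<delta> by (intro square_le_cube perp_nonneg) auto
      also have "\<dots> \<le> 1 / \<delta> ^ 24 + \<delta> ^ 12 * ?y"
        using T3 \<delta> by (simp add: power_divide flip: power_mult)
      finally have T2: "(?T n)\<^sup>2 \<le> 1 / \<delta> ^ 24 + \<delta> ^ 12 * ?y" .
      have "\<delta> ^ 18 * ?T n ^ 3 \<le> \<delta> ^ 18 * ?y" using T3 \<delta> by (intro mult_left_mono) auto
      also have "\<dots> \<le> \<delta> ^ 12 * ?y"
        using \<delta> y0 by (intro mult_right_mono power_decreasing) auto
      finally have "\<delta> ^ 18 * ?T n ^ 3 + (?T n)\<^sup>2 + 1 \<le> 2 * (\<delta> ^ 12 * ?y) + 1 / \<delta> ^ 24 + 1"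
        using T2 by simp
      also have "\<dots> \<le> 2 * (\<delta> ^ 12 * ?y) + 2 / \<delta> ^ 24"
        using \<delta> by (simp add: power_le_one field_simps)
      also have "\<delta> ^ 12 = \<delta> ^ 36 / \<delta> ^ 24" using \<delta> by (simp flip: power_diff)
      finally show "\<delta> ^ 18 * ?T n ^ 3 + (?T n)\<^sup>2 + 1
          \<le> 2 * c / \<delta> ^ 24 * (\<delta> ^ 36 * (size n * (gap n)\<^sup>2)) + 2 / \<delta> ^ 24" by (simp add: mult_ac)
    qed (use a in simp)
    let ?g = "\<lambda>n. a * (gap n ^ 6 / size n ^ 3)"
    have g0: "0 \<le> ?g n" for n using a s0[of n] by simp
    have h0: "0 \<le> ?h n" for n using a c \<delta> s0[of n] by simp
    have int_h: "integrable (measure_pmf \<pi>) ?h" using int_sg by simp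
    have dr: "generator (rates (\<delta> ^ 18)) (\<lambda>n. perp (state n) ^ 4) n \<le> ?h n - ?g n" for n
      using drift[OF \<epsilon>, of n] h[of n] by simp
    have p0: "0 \<le> perp (state n) ^ 4" for n by simp
    note db = integrable_drift_bound[OF st p0 g0 h0 int_h dr]
    have "measure_pmf.expectation \<pi> ?h =
        K * (2 * c / \<delta> ^ 24 * (\<delta> ^ 36 * measure_pmf.expectation \<pi> (\<lambda>n. size n * (gap n)\<^sup>2)) + 2 / \<delta> ^ 24)"
      using int_sg by simp
    also have "\<dots> \<le> K * (2 * c / \<delta> ^ 24 * M + 2 / \<delta> ^ 24)"
      using a c \<delta> E2 by (intro mult_left_mono add_right_mono) (auto simp: field_simps)
    also have "\<dots> = K * (2 * c * M + 2) / \<delta> ^ 24" by (simp add: add_divide_distrib algebra_simps)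
    finally have Eg: "measure_pmf.expectation \<pi> ?g \<le> K * (2 * c * M + 2) / \<delta> ^ 24" using db(2) by simp
    have int_g6: "integrable (measure_pmf \<pi>) (\<lambda>n. gap n ^ 6 / size n ^ 3)"
      using integrable_divide[OF db(1), of a] a by simp
    have E6: "measure_pmf.expectation \<pi> (\<lambda>n. gap n ^ 6 / size n ^ 3) \<le> K * (2 * c * M + 2) / a / \<delta> ^ 24"
    proof -
      have "a * measure_pmf.expectation \<pi> (\<lambda>n. gap n ^ 6 / size n ^ 3) \<le> K * (2 * c * M + 2) / \<delta> ^ 24"
        using Eg by (simp only: integral_mult_right_zero)
      then have "measure_pmf.expectation \<pi> (\<lambda>n. gap n ^ 6 / size n ^ 3) \<le> K * (2 * c * M + 2) / \<delta> ^ 24 / a"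
        by (subst pos_le_divide_eq[OF a(1)]) (simp only: mult.commute)
      then show ?thesis by (simp only: divide_divide_eq_left mult.commute)
    qed
    \<comment> \<open>The choice \<open>u = \<delta> ^ 3\<close> balances the exponents: 24 + 9 = 33
      for the sixth-power term and 36 - 3 = 33 for the other. As \<epsilon>^2 is
      \<open>\<delta> ^ 36\<close>, this beats the borderline by three powers of \<delta>.\<close>
    have "measure_pmf.expectation \<pi> (\<lambda>n. gap n ^ 3) \<le>
        measure_pmf.expectation \<pi> (\<lambda>n. gap n ^ 6 / size n ^ 3 / (\<delta> ^ 3) ^ 3 + \<delta> ^ 3 * (size n * (gap n)\<^sup>2))"
      using int_g3 int_g6 int_sg \<delta> s1
      by (intro integral_mono cube_le_interpolation gap_nonneg Bochner_Integration.integrable_add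
          integrable_divide integrable_mult_right) (auto intro: less_le_trans[OF zero_less_one])
    also have "\<dots> = measure_pmf.expectation \<pi> (\<lambda>n. gap n ^ 6 / size n ^ 3) / (\<delta> ^ 3) ^ 3
        + \<delta> ^ 3 * measure_pmf.expectation \<pi> (\<lambda>n. size n * (gap n)\<^sup>2)"
      using int_g6 int_sg by (simp del: divide_divide_eq_left)
    also have "\<dots> \<le> K * (2 * c * M + 2) / a / \<delta> ^ 24 / (\<delta> ^ 3) ^ 3 + \<delta> ^ 3 * (M / \<delta> ^ 36)"
      using E6 E2 \<delta> by (intro add_mono divide_right_mono mult_left_mono) auto
    also have "\<dots> = K' / \<delta> ^ 33"
    proof -
      have p: "\<delta> ^ 36 = \<delta> ^ 3 * \<delta> ^ 33" "\<delta> ^ 24 * (\<delta> ^ 3) ^ 3 = \<delta> ^ 33" by simp_all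
      have "X / \<delta> ^ 24 / (\<delta> ^ 3) ^ 3 = X / \<delta> ^ 33" for X
        unfolding divide_divide_eq_left p ..
      moreover have "\<delta> ^ 3 * (M / \<delta> ^ 36) = M / \<delta> ^ 33"
        unfolding p(1) times_divide_eq_right using \<delta> by (intro mult_divide_mult_cancel_left) simp
      ultimately show ?thesis by (simp only: K'_def add_divide_distrib)
    qed
    finally show "integrable (measure_pmf \<pi>) (\<lambda>n. gap n ^ 3) \<and>
       measure_pmf.expectation \<pi> (\<lambda>n. gap n ^ 3) \<le> K' / \<delta> ^ 33" using int_g3 by blast
  qed
qed

section \<open>Stationary identities and the heavy traffic bounds\<close>

lemma expectation_drift:
  assumes \<epsilon>: "0 < \<epsilon>" "\<epsilon> < 1" and st: "stationary_distribution (rates \<epsilon>) \<pi>"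
  shows "measure_pmf.expectation \<pi> (\<lambda>n. v \<bullet> drift \<epsilon> n) = 0"
proof -
  interpret bounded_rates "rates \<epsilon>" \<Lambda> using \<epsilon> by (intro rates_bounded) auto
  have g: "generator (rates \<epsilon>) (\<lambda>n. v \<bullet> state n) n = v \<bullet> drift \<epsilon> n" for n
    using generator_quadratic[of "\<lambda>z. v \<bullet> z" n v "\<lambda>_. 0" \<epsilon>] by (simp add: inner_add_right)
  have "measure_pmf.expectation \<pi> (generator (rates \<epsilon>) (\<lambda>n. v \<bullet> state n)) = 0"
  \<comment> \<open>A linear function is unbounded but its jumps are bounded, so a constant
    \<open>G\<close> dominates and no moment of \<open>\<pi>\<close> has to be known.\<close>
  proof (rule stationary_generator_zero[OF st, where G = "\<lambda>_. \<Lambda> * (norm v * jump_size)"])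
    fix n
    have "\<bar>v \<bullet> s\<bar> \<le> norm v * jump_size" if "norm s \<le> jump_size" for s
      using Cauchy_Schwarz_ineq2[of v s] mult_left_mono[OF that norm_ge_zero[of v]] by linarith
    then show "(\<Sum>m | rates \<epsilon> n m \<noteq> 0. rates \<epsilon> n m * \<bar>v \<bullet> state m - v \<bullet> state n\<bar>) \<le> \<Lambda> * (norm v * jump_size)"
      using \<epsilon> jump_size_nonneg
      by (intro jump_abs_le[where F = "\<lambda>z. v \<bullet> z"]) (auto simp: inner_add_right)
  qed simp
  then show ?thesis unfolding g .
qed

lemma integrable_flow: "integrable (measure_pmf \<pi>) (\<lambda>n. \<phi> n r)"
  by (rule measure_pmf.integrable_const_bound[where B = "sum C UNIV"]) (auto simp: \<phi>_nonneg \<phi>_le)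

lemma integrable_unused: "integrable (measure_pmf \<pi>) (\<lambda>n. unused n l)"
  by (rule measure_pmf.integrable_const_bound[where B = "C l"]) (auto simp: unused_nonneg unused_le)

text \<open>Balance of work at a critical link: in the mean, \<open>load_drift\<close>
  vanishes.\<close>

lemma expectation_unused:
  assumes \<epsilon>: "0 < \<epsilon>" "\<epsilon> < 1" and st: "stationary_distribution (rates \<epsilon>) \<pi>" and l: "l \<in> Ls"
  shows "measure_pmf.expectation \<pi> (\<lambda>n. unused n l) = \<epsilon> * C l"
  using expectation_drift[OF \<epsilon> st, of "load l"] integrable_unused[of \<pi> l]
  by (simp add: load_drift[OF l])

lemma expectation_flow:
  assumes \<epsilon>: "0 < \<epsilon>" "\<epsilon> < 1" and st: "stationary_distribution (rates \<epsilon>) \<pi>"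
  shows "measure_pmf.expectation \<pi> (\<lambda>n. \<phi> n r * \<mu> r) = (1 - \<epsilon>) * lam0 r"
proof -
  have "axis r (1 / \<sigma> r) \<bullet> drift \<epsilon> n = (1 - \<epsilon>) * lam0 r - \<phi> n r * \<mu> r" for n
    using \<sigma>_pos[of r] by (simp add: inner_axis' drift_def field_simps)
  then have "measure_pmf.expectation \<pi> (\<lambda>n. (1 - \<epsilon>) * lam0 r - \<phi> n r * \<mu> r) = 0"
    using expectation_drift[OF \<epsilon> st, of "axis r (1 / \<sigma> r)"] by simp
  then show ?thesis using integrable_flow[of \<pi> r] by simp
qed

lemma le_truncated_cube:
  fixes g t :: real
  assumes "0 \<le> g" "0 < t"
  shows "g \<le> t + g ^ 3 / t\<^sup>2"
proof (cases "g \<le> t")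
  case True
  moreover have "0 \<le> g ^ 3 / t\<^sup>2" using assms by simp
  ultimately show ?thesis by simp
next
  case False
  then have "g * t\<^sup>2 \<le> g * g\<^sup>2" using assms by (intro mult_left_mono power_mono) auto
  then have "g \<le> g ^ 3 / t\<^sup>2" using assms by (simp add: field_simps power2_eq_square power3_eq_cube)
  then show ?thesis using assms by simp
qed

lemma expectation_gap_unused:
  obtains K where "K > 0"
    "\<And>\<delta> \<pi>. 0 < \<delta> \<Longrightarrow> \<delta> < 1 \<Longrightarrow> stationary_distribution (rates (\<delta> ^ 18)) \<pi> \<Longrightarrow>
       integrable (measure_pmf \<pi>) (\<lambda>n. gap n * (\<delta> ^ 18 + (\<Sum>l\<in>Ls. unused n l))) \<and>
       measure_pmf.expectation \<pi> (\<lambda>n. gap n * (\<delta> ^ 18 + (\<Sum>l\<in>Ls. unused n l))) \<le> K * \<delta>"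
proof -
  obtain K where K: "K > 0" and mom:
    "\<And>\<delta> \<pi>. 0 < \<delta> \<Longrightarrow> \<delta> < 1 \<Longrightarrow> stationary_distribution (rates (\<delta> ^ 18)) \<pi> \<Longrightarrow>
       integrable (measure_pmf \<pi>) (\<lambda>n. gap n ^ 3) \<and>
       measure_pmf.expectation \<pi> (\<lambda>n. gap n ^ 3) \<le> K / \<delta> ^ 33"
    using gap_third_moment by blast
  define c where "c = 1 + sum C Ls"
  have c: "c > 0" unfolding c_def using capacity_pos by (intro add_pos_nonneg sum_nonneg) (auto intro: less_imp_le)
  show ?thesis
  proof (rule that[of "c + c * K"])
    show "0 < c + c * K" using c K by (intro add_pos_pos mult_pos_pos)
    fix \<delta> :: real and \<pi>
    assume \<delta>: "0 < \<delta>" "\<delta> < 1" and st: "stationary_distribution (rates (\<delta> ^ 18)) \<pi>"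
    have \<epsilon>: "0 < \<delta> ^ 18" "\<delta> ^ 18 < 1" using \<delta> by (simp_all add: power_less_one_iff)
    have int3: "integrable (measure_pmf \<pi>) (\<lambda>n. gap n ^ 3)"
      and E3: "measure_pmf.expectation \<pi> (\<lambda>n. gap n ^ 3) \<le> K / \<delta> ^ 33"
      using mom[OF \<delta> st] by simp_all
    define V where "V n = \<delta> ^ 18 + (\<Sum>l\<in>Ls. unused n l)" for n
    have V0: "0 \<le> V n" for n unfolding V_def using \<delta> by (intro add_nonneg_nonneg sum_nonneg unused_nonneg) auto
    have Vc: "V n \<le> c" for n unfolding V_def c_def using \<epsilon> by (intro add_mono sum_mono unused_le) auto
    have intV: "integrable (measure_pmf \<pi>) V" unfolding V_def using integrable_unused by simp
    have EV: "measure_pmf.expectation \<pi> V = \<delta> ^ 18 * c"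
      unfolding V_def using integrable_unused
      by (simp add: expectation_unused[OF \<epsilon> st] c_def sum_distrib_left distrib_left)
    \<comment> \<open>The exponent 17 makes both errors of order \<delta>:
      \<open>t * \<delta> ^ 18 = \<delta>\<close> and
      \<open>1 / (t^2 * \<delta> ^ 33) = \<delta>\<close>.\<close>
    define t where "t = 1 / \<delta> ^ 17"
    have t: "0 < t" using \<delta> by (simp add: t_def)
    have le: "gap n * V n \<le> t * V n + c / t\<^sup>2 * gap n ^ 3" for n
    proof -
      have "gap n * V n \<le> (t + gap n ^ 3 / t\<^sup>2) * V n"
        by (intro mult_right_mono le_truncated_cube gap_nonneg t V0)
      also have "\<dots> = t * V n + gap n ^ 3 / t\<^sup>2 * V n" by (rule distrib_right)
      also have "gap n ^ 3 / t\<^sup>2 * V n \<le> gap n ^ 3 / t\<^sup>2 * c"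
        using gap_nonneg[of n] t by (intro mult_left_mono Vc) auto
      finally show ?thesis by (simp add: mult.commute)
    qed
    have intR: "integrable (measure_pmf \<pi>) (\<lambda>n. t * V n + c / t\<^sup>2 * gap n ^ 3)"
      using intV int3 by simp
    have int: "integrable (measure_pmf \<pi>) (\<lambda>n. gap n * V n)"
    proof (rule Bochner_Integration.integrable_bound[OF intR])
      show "AE n in \<pi>. norm (gap n * V n) \<le> norm (t * V n + c / t\<^sup>2 * gap n ^ 3)"
      proof (rule AE_I2)
        fix n
        have "0 \<le> gap n * V n" by (intro mult_nonneg_nonneg gap_nonneg V0)
        with le[of n] show "norm (gap n * V n) \<le> norm (t * V n + c / t\<^sup>2 * gap n ^ 3)" by simp
      qed
    qed simp
    have "measure_pmf.expectation \<pi> (\<lambda>n. gap n * V n) \<le>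
        measure_pmf.expectation \<pi> (\<lambda>n. t * V n + c / t\<^sup>2 * gap n ^ 3)"
      by (intro integral_mono int intR le)
    also have "\<dots> = t * (\<delta> ^ 18 * c) + c / t\<^sup>2 * measure_pmf.expectation \<pi> (\<lambda>n. gap n ^ 3)"
      using intV int3 by (simp add: EV)
    also have "\<dots> \<le> t * (\<delta> ^ 18 * c) + c / t\<^sup>2 * (K / \<delta> ^ 33)"
      using c t by (intro add_left_mono mult_left_mono E3) auto
    also have "\<dots> = (c + c * K) * \<delta>"
    proof -
      have p: "\<delta> ^ 18 = \<delta> ^ 17 * \<delta>" "(\<delta> ^ 17)\<^sup>2 = \<delta> ^ 33 * \<delta>"
        by (simp_all flip: power_Suc2 power_mult)
      have "t * (\<delta> ^ 18 * c) = c * \<delta>" unfolding t_def p(1) using \<delta> by simp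
      moreover have "c / t\<^sup>2 * (K / \<delta> ^ 33) = c * K * \<delta>"
        unfolding t_def power_divide p(2) using \<delta> by simp
      ultimately show ?thesis by (simp add: distrib_right)
    qed
    finally show "integrable (measure_pmf \<pi>) (\<lambda>n. gap n * (\<delta> ^ 18 + (\<Sum>l\<in>Ls. unused n l))) \<and>
       measure_pmf.expectation \<pi> (\<lambda>n. gap n * (\<delta> ^ 18 + (\<Sum>l\<in>Ls. unused n l))) \<le> (c + c * K) * \<delta>"
      using int by (simp add: V_def)
  qed
qed

text \<open>The test function is the sum of \<open>(z \<bullet> b)^2\<close>, the squared norm of
  the projection if \<open>B\<close> is orthonormal. In the mean, departures balance arrivals on
  each route (\<open>expectation_flow\<close>), so the second-order term of route \<open>r\<close>
  has weight \<open>2 * (1 - \<epsilon>) * lam0 r * (\<sigma> r)^2\<close>, and the choice of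
  \<open>\<sigma>\<close> turns this into \<open>2 * (1 - \<epsilon>) * \<kappa> r\<close>.\<close>

lemma expectation_projected_drift:
  assumes \<epsilon>: "0 < \<epsilon>" "\<epsilon> < 1" and st: "stationary_distribution (rates \<epsilon>) \<pi>"
    and int3: "integrable (measure_pmf \<pi>) (\<lambda>n. size n ^ 3)"
    and B: "\<And>b. b \<in> B \<Longrightarrow> norm b = 1" "finite (B :: (real ^ 'r) set)"
  shows "integrable (measure_pmf \<pi>) (\<lambda>n. (\<Sum>b\<in>B. (state n \<bullet> b) *\<^sub>R b) \<bullet> drift \<epsilon> n)"
    and "measure_pmf.expectation \<pi> (\<lambda>n. (\<Sum>b\<in>B. (state n \<bullet> b) *\<^sub>R b) \<bullet> drift \<epsilon> n)
      = - (1 - \<epsilon>) * (\<Sum>r\<in>UNIV. \<kappa> r * (\<Sum>b\<in>B. (b $ r)\<^sup>2))"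
proof -
  interpret bounded_rates "rates \<epsilon>" \<Lambda> using \<epsilon> by (intro rates_bounded) auto
  let ?F = "\<lambda>z. \<Sum>b\<in>B. (z \<bullet> b)\<^sup>2"
  let ?y = "\<lambda>n. \<Sum>b\<in>B. (state n \<bullet> b) *\<^sub>R b"
  let ?S = jump_size
  have step: "?F (state n + s) = ?F (state n) + (2 *\<^sub>R ?y n) \<bullet> s + ?F s" for n s
    by (simp add: inner_add_left power2_sum sum.distrib inner_sum_right sum_distrib_left inner_commute[of _ s] mult_ac)
  define D where "D n = (\<Sum>r\<in>UNIV. ((1 - \<epsilon>) * lam0 r + \<phi> n r * \<mu> r) * ?F (\<sigma> r *\<^sub>R axis r 1))" for n
  have gen: "generator (rates \<epsilon>) (\<lambda>n. ?F (state n)) n = (2 *\<^sub>R ?y n) \<bullet> drift \<epsilon> n + D n" for n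
    unfolding D_def by (rule generator_quadratic[OF step]) (simp add: inner_minus_left)
  obtain A where A: "0 \<le> A" "\<And>\<epsilon> n. 0 \<le> \<epsilon> \<Longrightarrow> \<epsilon> \<le> 1 \<Longrightarrow> norm (drift \<epsilon> n) \<le> A"
    using drift_bounded by blast
  have s1: "1 \<le> size n" for n by (rule size_ge_1)
  have s3: "size n \<le> size n ^ 3" for n using power_increasing[of 1 3 "size n"] s1 by simp
  have s03: "0 \<le> size n ^ 3" for n using s3[of n] s1[of n] by linarith
  have y: "norm (?y n) \<le> card B * size n" for n
  proof -
    have "norm (?y n) \<le> (\<Sum>b\<in>B. norm ((state n \<bullet> b) *\<^sub>R b))" by (rule norm_sum)
    also have "\<dots> \<le> (\<Sum>b\<in>B. size n)"
    proof (rule sum_mono)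
      fix b assume "b \<in> B"
      then show "norm ((state n \<bullet> b) *\<^sub>R b) \<le> size n"
        using Cauchy_Schwarz_ineq2[of "state n" b] B(1) by (simp add: size_def)
    qed
    finally show ?thesis by simp
  qed
  show int_y: "integrable (measure_pmf \<pi>) (\<lambda>n. ?y n \<bullet> drift \<epsilon> n)"
  proof (rule integrable_size_power[OF int3])
    fix n
    have "\<bar>?y n \<bullet> drift \<epsilon> n\<bar> \<le> norm (?y n) * norm (drift \<epsilon> n)" by (rule Cauchy_Schwarz_ineq2)
    also have "\<dots> \<le> card B * size n * A"
      using y[of n] A(2)[of \<epsilon> n] \<epsilon> s1[of n] by (intro mult_mono) auto
    also have "\<dots> \<le> card B * A * size n ^ 3"
      using mult_left_mono[OF s3[of n], of "card B * A"] A(1) by (simp add: mult_ac)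
    finally show "\<bar>?y n \<bullet> drift \<epsilon> n\<bar> \<le> card B * A * size n ^ 3" .
  qed
  have F_axis: "?F (\<sigma> r *\<^sub>R axis r 1) = \<kappa> r / lam0 r * (\<Sum>b\<in>B. (b $ r)\<^sup>2)" for r
  proof -
    have "?F (\<sigma> r *\<^sub>R axis r 1) = \<sigma> r * \<sigma> r * (\<Sum>b\<in>B. (b $ r)\<^sup>2)"
      by (simp add: inner_axis' power_mult_distrib sum_distrib_left power2_eq_square mult_ac)
    then show ?thesis unfolding \<sigma>_square .
  qed
  have int_D: "integrable (measure_pmf \<pi>) D" unfolding D_def using integrable_flow by simp
  have "measure_pmf.expectation \<pi> D =
      (\<Sum>r\<in>UNIV. ((1 - \<epsilon>) * lam0 r + measure_pmf.expectation \<pi> (\<lambda>n. \<phi> n r * \<mu> r)) * ?F (\<sigma> r *\<^sub>R axis r 1))"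
    unfolding D_def using integrable_flow by (simp add: Bochner_Integration.integral_sum)
  also have "\<dots> = (\<Sum>r\<in>UNIV. 2 * (1 - \<epsilon>) * (\<kappa> r * (\<Sum>b\<in>B. (b $ r)\<^sup>2)))"
    unfolding expectation_flow[OF \<epsilon> st] F_axis
    using arrival_rate_pos by (intro sum.cong refl) (simp add: less_imp_neq[THEN not_sym])
  finally have ED: "measure_pmf.expectation \<pi> D = 2 * ((1 - \<epsilon>) * (\<Sum>r\<in>UNIV. \<kappa> r * (\<Sum>b\<in>B. (b $ r)\<^sup>2)))"
    by (simp only: sum_distrib_left[symmetric] mult.assoc)
  have "measure_pmf.expectation \<pi> (generator (rates \<epsilon>) (\<lambda>n. ?F (state n))) = 0"
  proof (rule stationary_generator_zero[OF st, where G = "\<lambda>n. \<Lambda> * (card B * (2 * ?S + ?S\<^sup>2) * size n)"])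
    show "integrable (measure_pmf \<pi>) (\<lambda>n. \<Lambda> * (card B * (2 * ?S + ?S\<^sup>2) * size n))"
    proof (intro integrable_mult_right integrable_size_power[OF int3, where K = 1])
      show "\<bar>size n\<bar> \<le> 1 * size n ^ 3" for n using s3[of n] s1[of n] by simp
    qed
    fix n
    show "(\<Sum>m | rates \<epsilon> n m \<noteq> 0. rates \<epsilon> n m * \<bar>?F (state m) - ?F (state n)\<bar>)
        \<le> \<Lambda> * (card B * (2 * ?S + ?S\<^sup>2) * size n)"
    proof (rule jump_abs_le[where F = ?F])
      show "0 \<le> card B * (2 * ?S + ?S\<^sup>2) * size n" using jump_size_nonneg s1[of n] by simp
      fix s :: "real ^ 'r" assume s: "norm s \<le> ?S"
      have "\<bar>?F (state n + s) - ?F (state n)\<bar> \<le> 2 * norm (?y n) * ?S + card B * ?S\<^sup>2"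
      proof -
        have "\<bar>?y n \<bullet> s\<bar> \<le> norm (?y n) * ?S"
          using Cauchy_Schwarz_ineq2[of "?y n" s] mult_left_mono[OF s norm_ge_zero[of "?y n"]] by linarith
        moreover have "?F s \<le> card B * ?S\<^sup>2"
        proof (rule sum_bounded_above)
          fix b assume "b \<in> B"
          then have "\<bar>s \<bullet> b\<bar> \<le> \<bar>?S\<bar>" using Cauchy_Schwarz_ineq2[of s b] B(1) s by simp
          then show "(s \<bullet> b)\<^sup>2 \<le> ?S\<^sup>2" by (simp add: abs_le_square_iff)
        qed
        moreover have "0 \<le> ?F s" by (intro sum_nonneg) auto
        ultimately show ?thesis unfolding step inner_scaleR_left by linarith
      qed
      also have "2 * norm (?y n) * ?S \<le> 2 * (card B * size n) * ?S"
        using y[of n] jump_size_nonneg by (intro mult_right_mono mult_left_mono) auto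
      also have "2 * (card B * size n) * ?S + card B * ?S\<^sup>2 \<le> card B * (2 * ?S + ?S\<^sup>2) * size n"
      proof -
        have "card B * ?S\<^sup>2 * 1 \<le> card B * ?S\<^sup>2 * size n" using s1[of n] by (intro mult_left_mono) auto
        then show ?thesis by (simp add: algebra_simps)
      qed
      finally show "\<bar>?F (state n + s) - ?F (state n)\<bar> \<le> card B * (2 * ?S + ?S\<^sup>2) * size n" by simp
    qed (use \<epsilon> in auto)
  qed
  then have "2 * measure_pmf.expectation \<pi> (\<lambda>n. ?y n \<bullet> drift \<epsilon> n) + measure_pmf.expectation \<pi> D = 0"
    unfolding gen inner_scaleR_left using int_y int_D by simp
  then show "measure_pmf.expectation \<pi> (\<lambda>n. ?y n \<bullet> drift \<epsilon> n) =
      - (1 - \<epsilon>) * (\<Sum>r\<in>UNIV. \<kappa> r * (\<Sum>b\<in>B. (b $ r)\<^sup>2))"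
    unfolding ED by (simp add: algebra_simps)
qed

lemma integrable_total:
  assumes "integrable (measure_pmf \<pi>) (\<lambda>n. size n ^ 3)"
  shows "integrable (measure_pmf \<pi>) (\<lambda>n. \<xi> \<bullet> state n)"
proof (rule integrable_size_power[OF assms])
  fix n
  have "\<bar>\<xi> \<bullet> state n\<bar> \<le> norm \<xi> * norm (state n)" by (rule Cauchy_Schwarz_ineq2)
  also have "\<dots> \<le> norm \<xi> * size n ^ 3"
    using power_increasing[of 1 3 "size n"] size_ge_1[of n]
    by (intro mult_left_mono) (auto simp: size_def)
  finally show "\<bar>\<xi> \<bullet> state n\<bar> \<le> norm \<xi> * size n ^ 3" .
qed

text \<open>\<open>?tr\<close> is the trace of the projection onto the critical span multiplied by
  the diagonal matrix of the weights. Its diagonal entries without weights are nonnegative and sum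
  to \<open>card Ls\<close>, so \<open>?tr\<close> lies between \<open>card Ls\<close> times the
  smallest and the largest weight.\<close>

lemma heavy_traffic_bounds:
  obtains K where
    "\<And>\<delta> \<pi>. 0 < \<delta> \<Longrightarrow> \<delta> < 1 \<Longrightarrow> stationary_distribution (rates (\<delta> ^ 18)) \<pi> \<Longrightarrow>
       integrable (measure_pmf \<pi>) (\<lambda>n. \<xi> \<bullet> state n) \<and>
       (1 - \<delta> ^ 18) * (card Ls * Min (range \<kappa>)) - K * \<delta>
         \<le> \<delta> ^ 18 * measure_pmf.expectation \<pi> (\<lambda>n. \<xi> \<bullet> state n) \<and>
       \<delta> ^ 18 * measure_pmf.expectation \<pi> (\<lambda>n. \<xi> \<bullet> state n)
         \<le> (1 - \<delta> ^ 18) * (card Ls * Max (range \<kappa>)) + K * \<delta>"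
proof -
  obtain M where M: "M > 0" and mom:
    "\<And>\<epsilon> \<pi>. 0 < \<epsilon> \<Longrightarrow> \<epsilon> < 1 \<Longrightarrow> stationary_distribution (rates \<epsilon>) \<pi> \<Longrightarrow>
       integrable (measure_pmf \<pi>) (\<lambda>n. size n ^ 3) \<and>
       measure_pmf.expectation \<pi> (\<lambda>n. size n * (gap n)\<^sup>2) \<le> M / \<epsilon>\<^sup>2"
    using size_moments by blast
  obtain K where K: "K > 0" and gu:
    "\<And>\<delta> \<pi>. 0 < \<delta> \<Longrightarrow> \<delta> < 1 \<Longrightarrow> stationary_distribution (rates (\<delta> ^ 18)) \<pi> \<Longrightarrow>
       integrable (measure_pmf \<pi>) (\<lambda>n. gap n * (\<delta> ^ 18 + (\<Sum>l\<in>Ls. unused n l))) \<and>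
       measure_pmf.expectation \<pi> (\<lambda>n. gap n * (\<delta> ^ 18 + (\<Sum>l\<in>Ls. unused n l))) \<le> K * \<delta>"
    using expectation_gap_unused by blast
  obtain c where c: "c > 0" and pd: "\<And>B \<epsilon> n. pairwise orthogonal B \<Longrightarrow> (\<And>b. b \<in> B \<Longrightarrow> norm b = 1) \<Longrightarrow> finite B \<Longrightarrow>
      span B = span (load ` Ls) \<Longrightarrow> 0 \<le> \<epsilon> \<Longrightarrow>
      \<bar>(\<Sum>b\<in>B. (state n \<bullet> b) *\<^sub>R b) \<bullet> drift \<epsilon> n + \<epsilon> * (\<xi> \<bullet> state n)\<bar> \<le>
        c * gap n * (\<epsilon> + (\<Sum>l\<in>Ls. unused n l))"
    using projected_drift by blast
  obtain B where B: "pairwise orthogonal B" "\<And>b. b \<in> B \<Longrightarrow> norm b = 1" "independent B"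
      "card B = dim (span (load ` Ls))" "span B = span (load ` Ls)"
    using orthonormal_basis_subspace[OF subspace_span] by metis
  have finB: "finite B" by (rule independent_imp_finite[OF B(3)])
  let ?tr = "\<Sum>r\<in>UNIV. \<kappa> r * (\<Sum>b\<in>B. (b $ r)\<^sup>2)"
  have one: "(\<Sum>r\<in>UNIV. \<Sum>b\<in>B. (b $ r)\<^sup>2) = card Ls"
  proof -
    have "(\<Sum>r\<in>UNIV. \<Sum>b\<in>B. (b $ r)\<^sup>2) = (\<Sum>b\<in>B. b \<bullet> b)"
      unfolding inner_vec_def by (subst sum.swap) (simp add: power2_eq_square)
    also have "\<dots> = (\<Sum>b\<in>B. 1)" using B(2) by (intro sum.cong) (auto simp: norm_eq_1)
    finally show ?thesis using B(4)[unfolded dim_loads] by simp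
  qed
  have tr_ge: "card Ls * Min (range \<kappa>) \<le> ?tr"
    unfolding one[symmetric] sum_distrib_right mult.commute[of "\<kappa> _"]
    by (intro sum_mono mult_left_mono sum_nonneg) auto
  have tr_le: "?tr \<le> card Ls * Max (range \<kappa>)"
    unfolding one[symmetric] sum_distrib_right mult.commute[of "\<kappa> _"]
    by (intro sum_mono mult_left_mono sum_nonneg) auto
  show ?thesis
  proof (rule that[of "c * K"])
    fix \<delta> :: real and \<pi>
    assume \<delta>: "0 < \<delta>" "\<delta> < 1" and st: "stationary_distribution (rates (\<delta> ^ 18)) \<pi>"
    have \<epsilon>: "0 < \<delta> ^ 18" "\<delta> ^ 18 < 1" using \<delta> by (simp_all add: power_less_one_iff)
    have int3: "integrable (measure_pmf \<pi>) (\<lambda>n. size n ^ 3)" using mom[OF \<epsilon> st] by simp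
    let ?y = "\<lambda>n. (\<Sum>b\<in>B. (state n \<bullet> b) *\<^sub>R b) \<bullet> drift (\<delta> ^ 18) n"
    note y = expectation_projected_drift[OF \<epsilon> st int3 B(2) finB]
    note i\<xi> = integrable_total[OF int3]
    let ?E = "measure_pmf.expectation \<pi> (\<lambda>n. \<xi> \<bullet> state n)"
    have "\<bar>- (1 - \<delta> ^ 18) * ?tr + \<delta> ^ 18 * ?E\<bar> = \<bar>measure_pmf.expectation \<pi> (\<lambda>n. ?y n + \<delta> ^ 18 * (\<xi> \<bullet> state n))\<bar>"
      using y i\<xi> by simp
    also have "\<dots> \<le> measure_pmf.expectation \<pi> (\<lambda>n. \<bar>?y n + \<delta> ^ 18 * (\<xi> \<bullet> state n)\<bar>)"
      by (rule integral_abs_bound)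
    also have "\<dots> \<le> measure_pmf.expectation \<pi> (\<lambda>n. c * (gap n * (\<delta> ^ 18 + (\<Sum>l\<in>Ls. unused n l))))"
    proof (rule integral_mono)
      show "integrable (measure_pmf \<pi>) (\<lambda>n. \<bar>?y n + \<delta> ^ 18 * (\<xi> \<bullet> state n)\<bar>)"
        using y i\<xi> by simp
      show "integrable (measure_pmf \<pi>) (\<lambda>n. c * (gap n * (\<delta> ^ 18 + (\<Sum>l\<in>Ls. unused n l))))"
        using gu[OF \<delta> st] by (intro integrable_mult_right) blast
      show "\<bar>?y n + \<delta> ^ 18 * (\<xi> \<bullet> state n)\<bar> \<le> c * (gap n * (\<delta> ^ 18 + (\<Sum>l\<in>Ls. unused n l)))" for n
        using pd[OF B(1) B(2) finB B(5), of "\<delta> ^ 18" n] \<epsilon> by (simp add: mult.assoc)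
    qed
    also have "\<dots> = c * measure_pmf.expectation \<pi> (\<lambda>n. gap n * (\<delta> ^ 18 + (\<Sum>l\<in>Ls. unused n l)))"
      by (rule integral_mult_right_zero)
    also have "\<dots> \<le> c * (K * \<delta>)" using gu[OF \<delta> st] c by (intro mult_left_mono) auto
    finally have *: "\<bar>- (1 - \<delta> ^ 18) * ?tr + \<delta> ^ 18 * ?E\<bar> \<le> c * K * \<delta>" by (simp add: mult.assoc)
    have tr: "(1 - \<delta> ^ 18) * (card Ls * Min (range \<kappa>)) \<le> (1 - \<delta> ^ 18) * ?tr"
      "(1 - \<delta> ^ 18) * ?tr \<le> (1 - \<delta> ^ 18) * (card Ls * Max (range \<kappa>))"
      using \<epsilon> tr_ge tr_le by (intro mult_left_mono; simp)+
    show "integrable (measure_pmf \<pi>) (\<lambda>n. \<xi> \<bullet> state n) \<and>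
       (1 - \<delta> ^ 18) * (card Ls * Min (range \<kappa>)) - c * K * \<delta> \<le> \<delta> ^ 18 * ?E \<and>
       \<delta> ^ 18 * ?E \<le> (1 - \<delta> ^ 18) * (card Ls * Max (range \<kappa>)) + c * K * \<delta>"
      by (intro conjI i\<xi>) (use tr *[unfolded mult_minus_left] in linarith)+
  qed
qed

end

theorem theorem2:
  fixes route :: "'r::finite \<Rightarrow> 'l::finite set"
    and C :: "'l \<Rightarrow> real"
    and \<kappa> \<mu> lam0 :: "'r \<Rightarrow> real"
    and x :: "('r \<Rightarrow> nat) \<Rightarrow> 'r \<Rightarrow> real"
    and Ls :: "'l set"
    and \<pi> :: "real \<Rightarrow> ('r \<Rightarrow> nat) pmf"
  assumes capacity_pos: "\<And>l. C l > 0"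
    and route_nonempty: "\<And>r. route r \<noteq> {}"
    and full_row_rank: "rank (routing_matrix route) = CARD('l)"
    and weight_pos: "\<And>r. \<kappa> r > 0"
    and service_rate_pos: "\<And>r. \<mu> r > 0"
    and arrival_rate_pos: "\<And>r. lam0 r > 0"
    and critical_nonempty: "Ls \<noteq> {}"
    and critical: "\<And>l. l \<in> Ls \<Longrightarrow> (\<Sum>r | l \<in> route r. lam0 r / \<mu> r) = C l"
    and noncritical: "\<And>l. l \<notin> Ls \<Longrightarrow> (\<Sum>r | l \<in> route r. lam0 r / \<mu> r) < C l"
    and fair: "weighted_proportionally_fair route C \<kappa> x"
    and stationary: "\<And>\<epsilon>. 0 < \<epsilon> \<Longrightarrow> \<epsilon> < 1 \<Longrightarrow>
      stationary_distribution (flow_count_rates (\<lambda>r. (1 - \<epsilon>) * lam0 r) \<mu> x) (\<pi> \<epsilon>)"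
  shows "\<exists>f g :: real \<Rightarrow> real.
    f \<in> o[at_right 0](\<lambda>\<epsilon>. 1 / \<epsilon>) \<and> g \<in> o[at_right 0](\<lambda>\<epsilon>. 1 / \<epsilon>) \<and>
    (\<forall>\<^sub>F \<epsilon> in at_right 0.
       integrable (measure_pmf (\<pi> \<epsilon>)) (\<lambda>n. \<Sum>r\<in>UNIV. \<kappa> r * real (n r)) \<and>
       real (card Ls) * Min (range \<kappa>) / \<epsilon> + f \<epsilon>
         \<le> measure_pmf.expectation (\<pi> \<epsilon>) (\<lambda>n. \<Sum>r\<in>UNIV. \<kappa> r * real (n r)) \<and>
       measure_pmf.expectation (\<pi> \<epsilon>) (\<lambda>n. \<Sum>r\<in>UNIV. \<kappa> r * real (n r))
         \<le> real (card Ls) * Max (range \<kappa>) / \<epsilon> + g \<epsilon>)"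
proof -
  interpret critical_network route C \<kappa> \<mu> lam0 x Ls
    by (unfold_locales) (fact capacity_pos route_nonempty full_row_rank weight_pos service_rate_pos
      arrival_rate_pos critical noncritical fair)+
  obtain K where K:
    "\<And>\<delta> p. 0 < \<delta> \<Longrightarrow> \<delta> < 1 \<Longrightarrow> stationary_distribution (rates (\<delta> ^ 18)) p \<Longrightarrow>
       integrable (measure_pmf p) (\<lambda>n. \<xi> \<bullet> state n) \<and>
       (1 - \<delta> ^ 18) * (card Ls * Min (range \<kappa>)) - K * \<delta>
         \<le> \<delta> ^ 18 * measure_pmf.expectation p (\<lambda>n. \<xi> \<bullet> state n) \<and>
       \<delta> ^ 18 * measure_pmf.expectation p (\<lambda>n. \<xi> \<bullet> state n)
         \<le> (1 - \<delta> ^ 18) * (card Ls * Max (range \<kappa>)) + K * \<delta>"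
    using heavy_traffic_bounds by blast
  let ?m = "real (card Ls) * Min (range \<kappa>)" and ?M = "real (card Ls) * Max (range \<kappa>)"
  \<comment> \<open>The constant \<open>- ?m\<close> in the lower error comes from the factor
    \<open>1 - \<epsilon>\<close>, since
    \<open>(1 - \<epsilon>) * ?m / \<epsilon> = ?m / \<epsilon> - ?m\<close>. In the upper bound the
    corresponding term is negative or zero and is dropped. \<open>root 18 \<epsilon>\<close> is the
    parameter \<delta> of the moment bounds.\<close>
  let ?f = "\<lambda>\<epsilon>. - ?m - K * root 18 \<epsilon> / \<epsilon>" and ?g = "\<lambda>\<epsilon>. K * root 18 \<epsilon> / \<epsilon>"
  have pos: "\<forall>\<^sub>F \<epsilon> in at_right (0::real). \<epsilon> \<in> {0<..<1}"
    by (rule eventually_at_right_real) simp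
  have root_lim: "(root 18 \<longlongrightarrow> 0) (at_right 0)"
    using tendsto_real_root[OF tendsto_ident_at, of 18 0 "{0<..}"] by simp
  have "?f \<in> o[at_right 0](\<lambda>\<epsilon>. 1 / \<epsilon>)"
  proof (rule smalloI_tendsto)
    have "((\<lambda>\<epsilon>. - ?m * \<epsilon> - K * root 18 \<epsilon>) \<longlongrightarrow> - ?m * 0 - K * 0) (at_right 0)"
      by (intro tendsto_intros root_lim)
    then have "((\<lambda>\<epsilon>. - ?m * \<epsilon> - K * root 18 \<epsilon>) \<longlongrightarrow> 0) (at_right 0)" by simp
    then show "((\<lambda>\<epsilon>. ?f \<epsilon> / (1 / \<epsilon>)) \<longlongrightarrow> 0) (at_right 0)"
      by (rule Lim_transform_eventually) (use pos in eventually_elim, simp add: field_simps)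
    show "\<forall>\<^sub>F \<epsilon> in at_right 0. 1 / \<epsilon> \<noteq> (0::real)" using pos by eventually_elim simp
  qed
  moreover have "?g \<in> o[at_right 0](\<lambda>\<epsilon>. 1 / \<epsilon>)"
  proof (rule smalloI_tendsto)
    have "((\<lambda>\<epsilon>. K * root 18 \<epsilon>) \<longlongrightarrow> K * 0) (at_right 0)"
      by (intro tendsto_intros root_lim)
    then have "((\<lambda>\<epsilon>. K * root 18 \<epsilon>) \<longlongrightarrow> 0) (at_right 0)" by simp
    then show "((\<lambda>\<epsilon>. ?g \<epsilon> / (1 / \<epsilon>)) \<longlongrightarrow> 0) (at_right 0)"
      by (rule Lim_transform_eventually) (use pos in eventually_elim, simp add: field_simps)
    show "\<forall>\<^sub>F \<epsilon> in at_right 0. 1 / \<epsilon> \<noteq> (0::real)" using pos by eventually_elim simp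
  qed
  moreover have "\<forall>\<^sub>F \<epsilon> in at_right 0.
       integrable (measure_pmf (\<pi> \<epsilon>)) (\<lambda>n. \<Sum>r\<in>UNIV. \<kappa> r * real (n r)) \<and>
       ?m / \<epsilon> + ?f \<epsilon> \<le> measure_pmf.expectation (\<pi> \<epsilon>) (\<lambda>n. \<Sum>r\<in>UNIV. \<kappa> r * real (n r)) \<and>
       measure_pmf.expectation (\<pi> \<epsilon>) (\<lambda>n. \<Sum>r\<in>UNIV. \<kappa> r * real (n r)) \<le> ?M / \<epsilon> + ?g \<epsilon>"
    using pos
  proof eventually_elim
    case (elim \<epsilon>)
    then have \<epsilon>: "0 < \<epsilon>" "\<epsilon> < 1" by auto
    define \<delta> where "\<delta> = root 18 \<epsilon>"
    have \<delta>: "0 < \<delta>" "\<delta> < 1" "\<delta> ^ 18 = \<epsilon>"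
      using \<epsilon> by (simp_all add: \<delta>_def)
    have "stationary_distribution (rates \<epsilon>) (\<pi> \<epsilon>)"
      unfolding rates_def by (rule stationary[OF \<epsilon>])
    with K[OF \<delta>(1,2), of "\<pi> \<epsilon>"] have
      int: "integrable (measure_pmf (\<pi> \<epsilon>)) (\<lambda>n. \<xi> \<bullet> state n)" and
      lo: "(1 - \<epsilon>) * ?m - K * \<delta> \<le> \<epsilon> * measure_pmf.expectation (\<pi> \<epsilon>) (\<lambda>n. \<xi> \<bullet> state n)" and
      hi: "\<epsilon> * measure_pmf.expectation (\<pi> \<epsilon>) (\<lambda>n. \<xi> \<bullet> state n) \<le> (1 - \<epsilon>) * ?M + K * \<delta>"
      unfolding \<delta>(3) by auto
    have "0 \<le> \<epsilon> * ?M"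
      using \<epsilon> weight_pos by (intro mult_nonneg_nonneg) (auto simp: Max_ge_iff intro!: less_imp_le)
    then have hi': "\<epsilon> * measure_pmf.expectation (\<pi> \<epsilon>) (\<lambda>n. \<xi> \<bullet> state n) \<le> ?M + K * \<delta>"
      using hi by (simp add: left_diff_distrib)
    show ?case
      using int lo hi' \<epsilon> unfolding \<xi>_state \<delta>_def[symmetric]
      by (simp add: field_simps)
  qed
  ultimately show ?thesis by blast
qed

end
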